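(* Let $p$ be a prime, $G$ a finitely generated pro-$p$ group and $1\to R\to S\to G\to 1$ a minimal presentation of $G$ with $S$ free pro-$p$ of finite rank. Then $\iota:\mathrm{gr}(R,S)\to\mathrm{gr}(R)_{ind}$ is bijective if and only if $R=1$ or the presentation $G=S/R$ is quadratically defined.
   Context: For a pro-$p$ group $H$, $H^{(1)}=H$, $H^{(n+1)}=(H^{(n)})^p[H^{(n)},H]$ (closed subgroup generated). $R^{(1,S)}=R$, $R^{(n+1,S)}=(R^{(n,S)})^p[R^{(n,S)},S]$; $R\subseteq S^{(2)}$ and $R^{(n,S)}\subseteq R\cap S^{(n+1)}$. $\mathrm{gr}_n(S)=S^{(n)}/S^{(n+1)}$; $\mathrm{gr}(S)=\bigoplus_n\mathrm{gr}_n(S)$ is a graded Lie algebra over $\mathbb{F}_p$ (bracket from commutators) with operator $P:\mathrm{gr}_n(S)\to\mathrm{gr}_{n+1}(S)$ induced by $x\mapsto x^p$ (a Lie algebra over $\mathbb{F}_p[\pi]$ with $\pi$ acting by $P$ if $p\ne2$, a mixed Lie algebra if $p=2$). $\mathrm{gr}_n(R)_{ind}=(R\cap S^{(n)})/(R\cap S^{(n+1)})\subseteq\mathrm{gr}_n(S)$; $\mathrm{gr}(R)_{ind}$ is the kernel of $\mathrm{gr}(S)\to\mathrm{gr}(G)$, an ideal, i.e. a module over the enveloping algebra $U$ of $\mathrm{gr}(S)$ (the free associative $\mathbb{F}_p[\pi]$-algebra on the generators of $S$) via the adjoint action. $\mathrm{gr}_n(R,S)=R^{(n,S)}/R^{(n+1,S)}$,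 and $\iota=\bigoplus_n\iota_n$, $\iota_n:\mathrm{gr}_n(R,S)\to\mathrm{gr}_{n+1}(R)_{ind}$ induced by inclusion. The initial form of $r\in R\subseteq S^{(2)}$ is its image in $\mathrm{gr}_2(S)=S^{(2)}/S^{(3)}$. The presentation is quadratic if $R\ne1$ and $R$ has a minimal generating set (as a closed normal subgroup of $S$) whose initial forms are of degree $2$ (i.e. its elements lie outside $S^{(3)}$); it is quadratically defined if it is quadratic and the initial forms of a minimal generating set for $R$ generate $\mathrm{gr}(R)_{ind}$ as an ideal of $\mathrm{gr}(S)$ (as a $U$-submodule). *)

theory Defs
  imports "HOL-Analysis.Analysis" "HOL-Algebra.Product_Groups" "HOL-Algebra.FiniteProduct"
begin

section \<open>Pro-p groups\<close>

definition topological_group :: "'a monoid \<Rightarrow> 'a topology \<Rightarrow> bool" where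
  "topological_group G T \<longleftrightarrow>
     group G \<and> topspace T = carrier G \<and>
     continuous_map (prod_topology T T) T (\<lambda>(x, y). x \<otimes>\<^bsub>G\<^esub> y) \<and>
     continuous_map T T (\<lambda>x. inv\<^bsub>G\<^esub> x)"

definition totally_disconnected_space :: "'a topology \<Rightarrow> bool" where
  "totally_disconnected_space T \<longleftrightarrow> (\<forall>C. connectedin T C \<longrightarrow> (\<exists>a. C \<subseteq> {a}))"

definition profinite_group :: "'a monoid \<Rightarrow> 'a topology \<Rightarrow> bool" where
  "profinite_group G T \<longleftrightarrow>
     topological_group G T \<and> compact_space T \<and> Hausdorff_space T \<and> totally_disconnected_space T"

definition pro_p_group :: "nat \<Rightarrow> 'a monoid \<Rightarrow> 'a topology \<Rightarrow> bool" where
  "pro_p_group p G T \<longleftrightarrow>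
     profinite_group G T \<and>
     (\<forall>N. N \<lhd> G \<and> openin T N \<longrightarrow> (\<exists>k. card (rcosets\<^bsub>G\<^esub> N) = p ^ k))"

definition closed_generate :: "'a monoid \<Rightarrow> 'a topology \<Rightarrow> 'a set \<Rightarrow> 'a set" where
  "closed_generate G T A = \<Inter>{H. subgroup H G \<and> closedin T H \<and> A \<subseteq> H}"

definition closed_normal_generate :: "'a monoid \<Rightarrow> 'a topology \<Rightarrow> 'a set \<Rightarrow> 'a set" where
  "closed_normal_generate G T A = \<Inter>{N. N \<lhd> G \<and> closedin T N \<and> A \<subseteq> N}"

definition topologically_fin_gen :: "'a monoid \<Rightarrow> 'a topology \<Rightarrow> bool" where
  "topologically_fin_gen G T \<longleftrightarrow>
     (\<exists>A. finite A \<and> A \<subseteq> carrier G \<and> closed_generate G T A = carrier G)"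

text \<open>
  The universal property of the free pro-\<open>p\<close> group on a finite set \<open>B\<close>. The test groups \<open>H\<close> are
  the pro-\<open>p\<close> groups whose elements are real numbers. This is no restriction: a map from a finite
  set to a pro-\<open>p\<close> group takes its values in a topologically finitely generated closed subgroup,
  which has at most the cardinality of the continuum, so that it is isomorphic to a pro-\<open>p\<close> group
  of this kind. The topology on \<open>H\<close> is arbitrary and unrelated to that of the reals.
\<close>

definition free_pro_p_on :: "nat \<Rightarrow> 'a monoid \<Rightarrow> 'a topology \<Rightarrow> 'a set \<Rightarrow> bool" where
  "free_pro_p_on p S T B \<longleftrightarrow>
     pro_p_group p S T \<and> finite B \<and> B \<subseteq> carrier S \<and>
     (\<forall>(H :: real monoid) TH f. pro_p_group p H TH \<and> f \<in> B \<rightarrow> carrier H \<longrightarrow>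
        (\<exists>!h. h \<in> extensional (carrier S) \<and> h \<in> hom S H \<and> continuous_map T TH h \<and>
              (\<forall>x\<in>B. h x = f x)))"

definition free_pro_p_finite_rank :: "nat \<Rightarrow> 'a monoid \<Rightarrow> 'a topology \<Rightarrow> bool" where
  "free_pro_p_finite_rank p S T \<longleftrightarrow> (\<exists>B. free_pro_p_on p S T B)"

section \<open>Descending central series\<close>

definition group_commutator :: "'a monoid \<Rightarrow> 'a \<Rightarrow> 'a \<Rightarrow> 'a" where
  "group_commutator S x y = x \<otimes>\<^bsub>S\<^esub> y \<otimes>\<^bsub>S\<^esub> inv\<^bsub>S\<^esub> x \<otimes>\<^bsub>S\<^esub> inv\<^bsub>S\<^esub> y"

definition central_step :: "nat \<Rightarrow> 'a monoid \<Rightarrow> 'a topology \<Rightarrow> 'a set \<Rightarrow> 'a set" where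
  "central_step p S T N =
     closed_generate S T
       ({x [^]\<^bsub>S\<^esub> p | x. x \<in> N} \<union> {group_commutator S x y | x y. x \<in> N \<and> y \<in> carrier S})"

text \<open>
  \<open>rel_series p S T R n\<close> is \<open>R\<^sup>(\<^sup>n\<^sup>,\<^sup>S\<^sup>)\<close> and \<open>p_series p S T n\<close> is \<open>S\<^sup>(\<^sup>n\<^sup>)\<close>. Indices start at 1;
  the value at 0 is a dummy and is never used.
\<close>

definition rel_series :: "nat \<Rightarrow> 'a monoid \<Rightarrow> 'a topology \<Rightarrow> 'a set \<Rightarrow> nat \<Rightarrow> 'a set" where
  "rel_series p S T R n = (central_step p S T ^^ (n - 1)) R"

definition p_series :: "nat \<Rightarrow> 'a monoid \<Rightarrow> 'a topology \<Rightarrow> nat \<Rightarrow> 'a set" where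
  "p_series p S T n = rel_series p S T (carrier S) n"

text \<open>
  A presentation \<open>1 \<rightarrow> R \<rightarrow> S \<rightarrow> G \<rightarrow> 1\<close> is given by the surjection \<open>\<phi> : S \<rightarrow> G\<close> with kernel \<open>R\<close>. It is
  minimal if \<open>R\<close> lies in the Frattini subgroup \<open>S\<^sup>p[S,S]\<close> of \<open>S\<close>, which is \<open>S\<^sup>(\<^sup>2\<^sup>)\<close>.
\<close>

definition minimal_presentation ::
  "nat \<Rightarrow> 'a monoid \<Rightarrow> 'a topology \<Rightarrow> 'b monoid \<Rightarrow> 'b topology \<Rightarrow> ('a \<Rightarrow> 'b) \<Rightarrow> 'a set \<Rightarrow> bool" where
  "minimal_presentation p S TS G TG \<phi> R \<longleftrightarrow>
     \<phi> \<in> hom S G \<and> continuous_map TS TG \<phi> \<and> \<phi> ` carrier S = carrier G \<and>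
     R = kernel S G \<phi> \<and> R \<subseteq> p_series p S TS 2"

section \<open>The graded Lie algebra of \<open>S\<close>\<close>

definition gr_comp :: "nat \<Rightarrow> 'a monoid \<Rightarrow> 'a topology \<Rightarrow> nat \<Rightarrow> 'a set monoid" where
  "gr_comp p S T n = (S\<lparr>carrier := p_series p S T n\<rparr>) Mod p_series p S T (n + 1)"

text \<open>
  The group structures on the graded objects are written multiplicatively, as in the quotients they
  are made of; \<open>sum_group\<close> is the direct sum.
\<close>

definition gr :: "nat \<Rightarrow> 'a monoid \<Rightarrow> 'a topology \<Rightarrow> (nat \<Rightarrow> 'a set) monoid" where
  "gr p S T = sum_group {1..} (gr_comp p S T)"

text \<open>
  In the following maps on cosets, the union is over representatives; all its members are the same
  coset. For \<open>gr_bracket\<close> the choice of commutator \<open>xyx\<inverse>y\<inverse>\<close> or \<open>x\<inverse>y\<inverse>xy\<close> is immaterial.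
\<close>

definition bracket_comp ::
  "nat \<Rightarrow> 'a monoid \<Rightarrow> 'a topology \<Rightarrow> nat \<Rightarrow> nat \<Rightarrow> 'a set \<Rightarrow> 'a set \<Rightarrow> 'a set" where
  "bracket_comp p S T m n C D =
     (\<Union>x\<in>C. \<Union>y\<in>D. p_series p S T (m + n + 1) #>\<^bsub>S\<^esub> group_commutator S x y)"

definition P_comp :: "nat \<Rightarrow> 'a monoid \<Rightarrow> 'a topology \<Rightarrow> nat \<Rightarrow> 'a set \<Rightarrow> 'a set" where
  "P_comp p S T n C = (\<Union>x\<in>C. p_series p S T (n + 2) #>\<^bsub>S\<^esub> (x [^]\<^bsub>S\<^esub> p))"

definition gr_bracket ::
  "nat \<Rightarrow> 'a monoid \<Rightarrow> 'a topology \<Rightarrow> (nat \<Rightarrow> 'a set) \<Rightarrow> (nat \<Rightarrow> 'a set) \<Rightarrow> (nat \<Rightarrow> 'a set)" where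
  "gr_bracket p S T f g =
     (\<lambda>n\<in>{1..}. finprod (gr_comp p S T n) (\<lambda>i. bracket_comp p S T i (n - i) (f i) (g (n - i))) {1..<n})"

definition gr_P :: "nat \<Rightarrow> 'a monoid \<Rightarrow> 'a topology \<Rightarrow> (nat \<Rightarrow> 'a set) \<Rightarrow> (nat \<Rightarrow> 'a set)" where
  "gr_P p S T f =
     (\<lambda>n\<in>{1..}. if n = 1 then \<one>\<^bsub>gr_comp p S T 1\<^esub> else P_comp p S T (n - 1) (f (n - 1)))"

text \<open>
  An ideal of \<open>gr(S)\<close> is an \<open>\<bbbF>\<^sub>p\<close>-subspace, which is the same as a subgroup, closed under the adjoint
  action of \<open>gr(S)\<close> and under \<open>P\<close>. As the enveloping algebra \<open>U\<close> is generated by \<open>gr(S)\<close> and \<open>\<pi>\<close>,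
  which acts by \<open>P\<close>, an ideal contained in \<open>gr(R)\<^sub>i\<^sub>n\<^sub>d\<close> is the same as a \<open>U\<close>-submodule of it.
\<close>

definition gr_ideal :: "nat \<Rightarrow> 'a monoid \<Rightarrow> 'a topology \<Rightarrow> (nat \<Rightarrow> 'a set) set \<Rightarrow> bool" where
  "gr_ideal p S T I \<longleftrightarrow>
     subgroup I (gr p S T) \<and>
     (\<forall>x\<in>carrier (gr p S T). \<forall>y\<in>I. gr_bracket p S T x y \<in> I) \<and>
     (\<forall>y\<in>I. gr_P p S T y \<in> I)"

definition gr_ideal_generated ::
  "nat \<Rightarrow> 'a monoid \<Rightarrow> 'a topology \<Rightarrow> (nat \<Rightarrow> 'a set) set \<Rightarrow> (nat \<Rightarrow> 'a set) set" where
  "gr_ideal_generated p S T A = \<Inter>{I. gr_ideal p S T I \<and> A \<subseteq> I}"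

section \<open>The graded objects attached to \<open>R\<close>\<close>

definition gr_rel_comp :: "nat \<Rightarrow> 'a monoid \<Rightarrow> 'a topology \<Rightarrow> 'a set \<Rightarrow> nat \<Rightarrow> 'a set monoid" where
  "gr_rel_comp p S T R n = (S\<lparr>carrier := rel_series p S T R n\<rparr>) Mod rel_series p S T R (n + 1)"

definition gr_rel :: "nat \<Rightarrow> 'a monoid \<Rightarrow> 'a topology \<Rightarrow> 'a set \<Rightarrow> (nat \<Rightarrow> 'a set) monoid" where
  "gr_rel p S T R = sum_group {1..} (gr_rel_comp p S T R)"

definition gr_ind_comp :: "nat \<Rightarrow> 'a monoid \<Rightarrow> 'a topology \<Rightarrow> 'a set \<Rightarrow> nat \<Rightarrow> 'a set monoid" where
  "gr_ind_comp p S T R n =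
     (S\<lparr>carrier := R \<inter> p_series p S T n\<rparr>) Mod (R \<inter> p_series p S T (n + 1))"

definition gr_ind :: "nat \<Rightarrow> 'a monoid \<Rightarrow> 'a topology \<Rightarrow> 'a set \<Rightarrow> (nat \<Rightarrow> 'a set) monoid" where
  "gr_ind p S T R = sum_group {1..} (gr_ind_comp p S T R)"

text \<open>The inclusion of \<open>gr(R)\<^sub>i\<^sub>n\<^sub>d\<close> in \<open>gr(S)\<close>.\<close>

definition gr_ind_incl :: "nat \<Rightarrow> 'a monoid \<Rightarrow> 'a topology \<Rightarrow> (nat \<Rightarrow> 'a set) \<Rightarrow> (nat \<Rightarrow> 'a set)" where
  "gr_ind_incl p S T f = (\<lambda>n\<in>{1..}. \<Union>x\<in>f n. p_series p S T (n + 1) #>\<^bsub>S\<^esub> x)"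

text \<open>
  The map \<open>\<iota>\<close> raises degrees by 1, and \<open>gr\<^sub>1(R)\<^sub>i\<^sub>n\<^sub>d\<close> is trivial if \<open>R\<close> is contained in \<open>S\<^sup>(\<^sup>2\<^sup>)\<close>.
\<close>

definition iota_comp :: "nat \<Rightarrow> 'a monoid \<Rightarrow> 'a topology \<Rightarrow> 'a set \<Rightarrow> nat \<Rightarrow> 'a set \<Rightarrow> 'a set" where
  "iota_comp p S T R n C = (\<Union>x\<in>C. (R \<inter> p_series p S T (n + 2)) #>\<^bsub>S\<^esub> x)"

definition iota ::
  "nat \<Rightarrow> 'a monoid \<Rightarrow> 'a topology \<Rightarrow> 'a set \<Rightarrow> (nat \<Rightarrow> 'a set) \<Rightarrow> (nat \<Rightarrow> 'a set)" where
  "iota p S T R f =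
     (\<lambda>n\<in>{1..}. if n = 1 then \<one>\<^bsub>gr_ind_comp p S T R 1\<^esub> else iota_comp p S T R (n - 1) (f (n - 1)))"

section \<open>Quadratic presentations\<close>

definition minimal_normal_generating_set ::
  "'a monoid \<Rightarrow> 'a topology \<Rightarrow> 'a set \<Rightarrow> 'a set \<Rightarrow> bool" where
  "minimal_normal_generating_set S T R E \<longleftrightarrow>
     E \<subseteq> R \<and> closed_normal_generate S T E = R \<and>
     (\<forall>E'. E' \<subset> E \<longrightarrow> closed_normal_generate S T E' \<noteq> R)"

definition initial_form :: "nat \<Rightarrow> 'a monoid \<Rightarrow> 'a topology \<Rightarrow> 'a \<Rightarrow> (nat \<Rightarrow> 'a set)" where
  "initial_form p S T r =
     (\<lambda>n\<in>{1..}. if n = 2 then p_series p S T 3 #>\<^bsub>S\<^esub> r else \<one>\<^bsub>gr_comp p S T n\<^esub>)"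

definition quadratic :: "nat \<Rightarrow> 'a monoid \<Rightarrow> 'a topology \<Rightarrow> 'a set \<Rightarrow> bool" where
  "quadratic p S T R \<longleftrightarrow>
     R \<noteq> {\<one>\<^bsub>S\<^esub>} \<and>
     (\<exists>E. minimal_normal_generating_set S T R E \<and> (\<forall>r\<in>E. r \<notin> p_series p S T 3))"

definition quadratically_defined :: "nat \<Rightarrow> 'a monoid \<Rightarrow> 'a topology \<Rightarrow> 'a set \<Rightarrow> bool" where
  "quadratically_defined p S T R \<longleftrightarrow>
     quadratic p S T R \<and>
     (\<exists>E. minimal_normal_generating_set S T R E \<and>
          gr_ideal_generated p S T (initial_form p S T ` E) =
            gr_ind_incl p S T ` carrier (gr_ind p S T R))"

end

theory Submission
  imports Defs "HOL-Algebra.Group_Action" "HOL-Algebra.Multiplicative_Group" "HOL-Algebra.Zassenhaus"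
begin

text \<open>
  Write \<open>S\<^sub>n\<close> for \<open>S\<^sup>(\<^sup>n\<^sup>)\<close>, \<open>R\<^sub>n\<close> for \<open>R\<^sup>(\<^sup>n\<^sup>,\<^sup>S\<^sup>)\<close> and \<open>I\<^sub>n = R \<inter> S\<^sub>n\<close>, so that \<open>R\<^sub>n \<subseteq> I\<^sub>n\<^sub>+\<^sub>1\<close>. If \<open>\<iota>\<close> is surjective, then
  \<open>I\<^sub>n\<^sub>+\<^sub>1 = R\<^sub>n I\<^sub>n\<^sub>+\<^sub>2\<close> for all \<open>n\<close>, hence \<open>I\<^sub>n\<^sub>+\<^sub>1 = R\<^sub>n I\<^sub>k\<close> for all \<open>k > n\<close>, and compactness yields
  \<open>I\<^sub>n\<^sub>+\<^sub>1 = R\<^sub>n\<close> because \<open>R\<^sub>n\<close> is closed and the \<open>S\<^sub>k\<close> are eventually contained in every open normal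
  subgroup. So surjectivity, bijectivity and the equalities \<open>I\<^sub>n\<^sub>+\<^sub>1 = R\<^sub>n\<close> are all equivalent.

  By \<open>[S\<^sub>m, R\<^sub>n] \<subseteq> R\<^sub>m\<^sub>+\<^sub>n\<close> the images of the \<open>R\<^sub>n\<close> in \<open>gr\<^sub>n\<^sub>+\<^sub>1(S)\<close> form an ideal containing the initial forms
  of all elements of \<open>R\<close>. If some of these generate \<open>gr(R)\<^sub>i\<^sub>n\<^sub>d\<close>, then \<open>\<iota>\<close> is surjective. Conversely, if
  \<open>I\<^sub>n\<^sub>+\<^sub>1 = R\<^sub>n\<close> for all \<open>n\<close>, then \<open>R/R\<^sub>2\<close> embeds in the finite group \<open>S\<^sub>2/S\<^sub>3\<close>, a subset of \<open>R\<close> generates \<open>R\<close> as a closed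
  normal subgroup iff it does so modulo \<open>R\<^sub>2 = R \<inter> S\<^sub>3\<close>, and the recursive description of \<open>R\<^sub>n\<close> by
  \<open>p\<close>-th powers and commutators shows that the initial forms of such a set generate \<open>gr(R)\<^sub>i\<^sub>n\<^sub>d\<close>. Freeness of
  \<open>S\<close> enters only through the finiteness of \<open>S/S\<^sub>2\<close>.
\<close>

section \<open>Commutators and finite \<open>p\<close>-groups\<close>

text \<open>Two closures have to be reconciled: \<open>gr_ideal_generated\<close> is purely
  algebraic, while each term of \<open>rel_series\<close> is generated topologically. An induction
  along the series must therefore know that the elements of \<open>S_n\<close> whose class lies in a
  given ideal form a closed subgroup. This is what finiteness of \<open>S_n/S_(n+1)\<close>
  provides: every subgroup between the two terms is a finite union of closed cosets. Finiteness
  propagates from \<open>n = 1\<close>, because the next layer is generated by \<open>p\<close>-th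
  powers and commutators of finitely many representatives.

  That the \<open>S_k\<close> sink into every open normal subgroup rests on finite
  \<open>p\<close>-groups: a nontrivial quotient \<open>S/N\<close> has a central element of order
  \<open>p\<close>, so that \<open>N\<close> can be enlarged to a group which one central step sends
  into \<open>N\<close>.

  Commutator estimates are proved elementwise in quotients: the elements centralizing a given set
  modulo \<open>N\<close> form a closed subgroup, so that only generators need to be tested, and in
  \<open>S/N\<close> enough factors commute to make each identity a matter of moving them past one
  another.\<close>

text \<open>The commutator of the definitions is typed for plain monoid records only.\<close>

locale mgroup = group G for G :: "'a monoid" (structure)

locale mgroup_hom = group_hom G H h for G :: "'a monoid" (structure) and H :: "'b monoid" (structure) and h

locale mnormal = normal H G for H and G :: "'a monoid" (structure)

sublocale mgroup_hom \<subseteq> G: mgroup G by unfold_locales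
sublocale mgroup_hom \<subseteq> H: mgroup H by unfold_locales
sublocale mnormal \<subseteq> mgroup G by unfold_locales

lemma (in mgroup) inv_mult_cancel [simp]:
  assumes "x \<in> carrier G" "y \<in> carrier G"
  shows "inv x \<otimes> (x \<otimes> y) = y" "x \<otimes> (inv x \<otimes> y) = y"
  using assms by (simp_all flip: m_assoc)

lemma (in mgroup) commutator_closed [simp]:
  "x \<in> carrier G \<Longrightarrow> y \<in> carrier G \<Longrightarrow> group_commutator G x y \<in> carrier G"
  by (simp add: group_commutator_def)

lemma (in mgroup) commutator_mult:
  assumes "x \<in> carrier G" "y \<in> carrier G"
  shows "group_commutator G x y \<otimes> (y \<otimes> x) = x \<otimes> y"
  using assms by (simp add: group_commutator_def m_assoc inv_solve_left')

lemma (in mgroup) commutator_eq_one_iff: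
  assumes "x \<in> carrier G" "y \<in> carrier G"
  shows "group_commutator G x y = \<one> \<longleftrightarrow> x \<otimes> y = y \<otimes> x"
  using commutator_mult[OF assms] assms by (metis commutator_closed l_one m_closed right_cancel one_closed)

lemma (in mgroup) inv_commutator:
  assumes "x \<in> carrier G" "y \<in> carrier G"
  shows "inv (group_commutator G x y) = group_commutator G y x"
  using assms by (simp add: group_commutator_def inv_mult_group m_assoc)

lemma (in mgroup) conj_eq_commutator_mult:
  assumes "x \<in> carrier G" "y \<in> carrier G"
  shows "x \<otimes> y \<otimes> inv x = group_commutator G x y \<otimes> y"
  using assms by (simp add: group_commutator_def m_assoc)

lemma (in mgroup_hom) hom_commutator:
  assumes "x \<in> carrier G" "y \<in> carrier G"
  shows "h (group_commutator G x y) = group_commutator H (h x) (h y)"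
  using assms by (simp add: group_commutator_def)

lemma (in mgroup) pow_conj:
  assumes "x \<in> carrier G" "y \<in> carrier G"
  shows "(x \<otimes> y \<otimes> inv x) [^] (n::nat) = x \<otimes> y [^] n \<otimes> inv x"
proof (induction n)
  case (Suc n)
  then show ?case
    using assms by (simp add: m_assoc)
qed (use assms in simp)

lemma (in mgroup) commutator_conj:
  assumes "g \<in> carrier G" "x \<in> carrier G" "y \<in> carrier G"
  shows "g \<otimes> group_commutator G x y \<otimes> inv g
       = group_commutator G (g \<otimes> x \<otimes> inv g) (g \<otimes> y \<otimes> inv g)"
  using assms by (simp add: group_commutator_def inv_mult_group m_assoc)

text \<open>The hypothesis says that \<open>c\<close> is the commutator of \<open>x\<close> and
  \<open>r\<close>. Each \<open>x\<close> that passes \<open>r\<close> leaves one factor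
  \<open>c\<close>, and these factors accumulate since \<open>x\<close> commutes with
  \<open>c\<close>. If \<open>c\<close> has exponent \<open>n\<close>, then \<open>x [^] n\<close>
  commutes with \<open>r\<close>.\<close>

lemma (in mgroup) pow_mult_eq_of_commute:
  assumes "x \<in> carrier G" "r \<in> carrier G" "c \<in> carrier G"
    and "x \<otimes> r = c \<otimes> r \<otimes> x" and xc: "x \<otimes> c = c \<otimes> x"
  shows "x [^] (n::nat) \<otimes> r = c [^] n \<otimes> r \<otimes> x [^] n"
proof (induction n)
  case (Suc n)
  have xn: "x [^] n \<otimes> c = c \<otimes> x [^] n"
    using assms by (simp add: group_commutes_pow)
  have "x [^] Suc n \<otimes> r = x [^] n \<otimes> (c \<otimes> r \<otimes> x)"
    using assms by (simp add: m_assoc)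
  also have "\<dots> = (x [^] n \<otimes> c) \<otimes> r \<otimes> x"
    using assms by (simp add: m_assoc)
  also have "\<dots> = c \<otimes> (x [^] n \<otimes> r) \<otimes> x"
    unfolding xn using assms by (simp add: m_assoc)
  also have "\<dots> = c \<otimes> c [^] n \<otimes> r \<otimes> (x [^] n \<otimes> x)"
    unfolding Suc using assms by (simp add: m_assoc)
  finally show ?case
    using assms by (simp add: m_assoc group_commutes_pow)
qed (use assms in simp)

lemma (in mnormal) rcos_group_hom: "mgroup_hom G (G Mod H) (\<lambda>x. H #> x)"
  by (simp add: mgroup_hom_def group_hom_def group_hom_axioms_def factorgroup_is_group is_group r_coset_hom_Mod)

lemma (in mnormal) rcos_eq_iff:
  assumes "x \<in> carrier G" "y \<in> carrier G"
  shows "H #> x = H #> y \<longleftrightarrow> x \<otimes> inv y \<in> H"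
  using assms rcos_module[OF is_group, of y x] subgroup_axioms
  by (metis is_group repr_independence rcos_self rcos_const)

lemma (in mnormal) rcos_eq_one_iff:
  assumes "x \<in> carrier G"
  shows "H #> x = H \<longleftrightarrow> x \<in> H"
  using assms by (metis coset_join1 coset_join2 subset subgroup_axioms)

text \<open>Translates congruences between commutators into commutation in the quotient, where the
  later computations take place.\<close>

lemma (in mnormal) commutator_mem_iff:
  assumes "x \<in> carrier G" "y \<in> carrier G"
  shows "group_commutator G x y \<in> H \<longleftrightarrow>
    (H #> x) \<otimes>\<^bsub>G Mod H\<^esub> (H #> y) = (H #> y) \<otimes>\<^bsub>G Mod H\<^esub> (H #> x)"
proof -
  interpret q: mgroup_hom G "G Mod H" "\<lambda>x. H #> x" by (rule rcos_group_hom)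
  show ?thesis
    using rcos_eq_one_iff[of "group_commutator G x y"] assms q.hom_commutator[OF assms]
      q.H.commutator_eq_one_iff[of "H #> x" "H #> y"]
    by (metis commutator_closed one_FactGroup q.hom_closed)
qed

text \<open>Class equation: the lengths of conjugacy classes divide \<open>p ^ k\<close>. If
  \<open>\<one>\<close> were the only class of length 1 besides possibly longer ones, all other
  lengths would be divisible by \<open>p\<close>, and \<open>p\<close> would divide 1.\<close>

lemma (in mgroup) central_element_of_p_group:
  assumes p: "Factorial_Ring.prime p" and ord: "card (carrier G) = p ^ k" and "k > 0"
  obtains z where "z \<in> carrier G" "z \<noteq> \<one>" "\<And>y. y \<in> carrier G \<Longrightarrow> z \<otimes> y = y \<otimes> z"
proof -
  let ?\<phi> = "\<lambda>g. \<lambda>h\<in>carrier G. g \<otimes> h \<otimes> inv g"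
  interpret act: group_action G "carrier G" ?\<phi> by (rule action_by_conjugation)
  let ?O = "orbits G (carrier G) ?\<phi>"
  have fin: "finite (carrier G)"
    using ord p by (metis card.infinite not_prime_0 power_not_zero)
  have orb: "orbit G ?\<phi> x = {g \<otimes> x \<otimes> inv g | g. g \<in> carrier G}" if "x \<in> carrier G" for x
    using that by (auto simp: orbit_def)
  have "\<exists>z\<in>carrier G. z \<noteq> \<one> \<and> card (orbit G ?\<phi> z) = 1"
  proof (rule ccontr)
    assume no: "\<not> ?thesis"
    have o1: "orbit G ?\<phi> \<one> = {\<one>}"
      unfolding orb[OF one_closed] by (auto intro: exI[of _ \<one>])
    have mem: "{\<one>} \<in> ?O"
      unfolding orbits_def using o1 one_closed by blast
    have cu: "card (carrier G) = (\<Sum>C\<in>?O. card C)"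
    proof -
      have U: "\<Union>?O = carrier G"
        using act.orbits_coverture by simp
      have "card (\<Union>?O) = (\<Sum>C\<in>?O. card C)"
      proof (rule card_Union_disjoint)
        show "pairwise disjnt ?O"
          using act.disjoint_union by (auto simp: pairwise_def disjnt_def)
        fix A assume "A \<in> ?O"
        then have "A \<subseteq> \<Union>?O" by (rule Union_upper)
        then show "finite A" unfolding U using fin by (rule finite_subset)
      qed
      with U show ?thesis by simp
    qed
    have "p dvd card C" if C: "C \<in> ?O - {{\<one>}}" for C
    proof -
      obtain x where x: "x \<in> carrier G" "C = orbit G ?\<phi> x"
        using C unfolding orbits_def by blast
      with C o1 have "x \<noteq> \<one>" by fast
      then have "card C \<noteq> 1" using no x by blast
      moreover have "card C dvd p ^ k"
        unfolding ord[symmetric] x(2) using act.orbit_stabilizer_theorem[OF x(1)]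
        by (intro dvdI[of _ _ "card (stabilizer G ?\<phi> x)"]) (simp add: order_def)
      ultimately show ?thesis
        using p divides_primepow_nat[of p "card C" k] by (auto simp: gr0_conv_Suc intro: Nat.gr0I)
    qed
    then have d: "p dvd (\<Sum>C\<in>?O - {{\<one>}}. card C)" by (rule dvd_sum)
    have "finite ?O"
      using fin unfolding orbits_def by (simp add: Setcompr_eq_image)
    then have "(\<Sum>C\<in>?O. card C) = 1 + (\<Sum>C\<in>?O - {{\<one>}}. card C)"
      using mem by (simp add: sum.remove)
    then have "p ^ k = 1 + (\<Sum>C\<in>?O - {{\<one>}}. card C)"
      unfolding cu[symmetric] ord .
    moreover have "p dvd p ^ k" using \<open>k > 0\<close> by simp
    ultimately have "p dvd 1"
      using dvd_add_left_iff[OF d, of 1] by argo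
    then show False using p by simp
  qed
  then obtain z where z: "z \<in> carrier G" "z \<noteq> \<one>" "card (orbit G ?\<phi> z) = 1" by blast
  then obtain w where "orbit G ?\<phi> z = {w}" by (auto simp: card_1_singleton_iff)
  moreover have "z \<in> orbit G ?\<phi> z" using act.orbit_refl z(1) .
  ultimately have "orbit G ?\<phi> z = {z}" by auto
  then have *: "y \<otimes> z \<otimes> inv y = z" if "y \<in> carrier G" for y
    using orb[OF z(1)] that by blast
  show thesis
  proof (rule that[OF z(1,2)])
    fix y assume y: "y \<in> carrier G"
    then show "z \<otimes> y = y \<otimes> z"
      using *[OF y] z(1) by (metis inv_solve_right m_closed)
  qed
qed

lemma (in mgroup) central_element_of_order_p:
  assumes p: "Factorial_Ring.prime p" and ord: "card (carrier G) = p ^ k" and "k > 0"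
  obtains z where "z \<in> carrier G" "z \<noteq> \<one>" "z [^] p = \<one>"
    "\<And>y. y \<in> carrier G \<Longrightarrow> z \<otimes> y = y \<otimes> z"
proof -
  obtain z where z: "z \<in> carrier G" "z \<noteq> \<one>" "\<And>y. y \<in> carrier G \<Longrightarrow> z \<otimes> y = y \<otimes> z"
    using central_element_of_p_group[OF assms] by blast
  \<comment> \<open>The order of \<open>z\<close> is \<open>p ^ j\<close>; the power with exponent
    \<open>p ^ (j - 1)\<close> is then nontrivial of order \<open>p\<close>, and still
    central.\<close>
  define j where "j = (LEAST j. z [^] (p ^ j) = \<one>)"
  have "z [^] (p ^ k) = \<one>"
    using pow_order_eq_1[OF z(1)] ord by (simp add: order_def)
  then have j: "z [^] (p ^ j) = \<one>" unfolding j_def by (rule LeastI)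
  have "j \<noteq> 0" using j z(1,2) by (metis power_0 nat_pow_eone)
  then obtain i where i: "j = Suc i" using not0_implies_Suc by blast
  define w where "w = z [^] (p ^ i)"
  have "w \<noteq> \<one>"
    unfolding w_def using i j_def not_less_Least[of i] by (metis lessI)
  moreover have "w [^] p = \<one>"
    using j i z(1) by (simp add: w_def nat_pow_pow mult.commute)
  moreover have "w \<otimes> y = y \<otimes> w" if "y \<in> carrier G" for y
    unfolding w_def using z that by (simp add: group_commutes_pow)
  ultimately show thesis using that[of w] z(1) w_def by blast
qed

section \<open>Profinite groups\<close>

locale profinite = mgroup S for S :: "'a monoid" (structure) +
  fixes T :: "'a topology"
  assumes profinite: "profinite_group S T"
begin

lemma topspace_eq [simp]: "topspace T = carrier S"
  using profinite by (simp add: profinite_group_def topological_group_def)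

lemma compact: "compact_space T" and Hausdorff: "Hausdorff_space T"
  using profinite by (auto simp: profinite_group_def)

lemma continuous_mult:
  assumes "continuous_map X T f" "continuous_map X T g"
  shows "continuous_map X T (\<lambda>x. f x \<otimes> g x)"
proof -
  have "continuous_map (prod_topology T T) T (\<lambda>(x, y). x \<otimes> y)"
    using profinite by (simp add: profinite_group_def topological_group_def)
  moreover have "continuous_map X (prod_topology T T) (\<lambda>x. (f x, g x))"
    using assms by (simp add: continuous_map_pairwise o_def)
  ultimately have "continuous_map X T ((\<lambda>(x, y). x \<otimes> y) \<circ> (\<lambda>x. (f x, g x)))"
    by (rule continuous_map_compose[rotated])
  then show ?thesis by (simp add: o_def)
qed

lemma continuous_inv:
  assumes "continuous_map X T f"
  shows "continuous_map X T (\<lambda>x. inv f x)"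
proof -
  have "continuous_map T T (\<lambda>x. inv x)"
    using profinite by (simp add: profinite_group_def topological_group_def)
  from continuous_map_compose[OF assms this] show ?thesis by (simp add: o_def)
qed

lemma continuous_ident: "continuous_map T T (\<lambda>x. x)"
  using continuous_map_id by (simp add: id_def)

lemma continuous_commutator:
  assumes "continuous_map X T f" "continuous_map X T g"
  shows "continuous_map X T (\<lambda>x. group_commutator S (f x) (g x))"
  unfolding group_commutator_def by (intro continuous_mult continuous_inv assms)

lemma closedin_preimage:
  assumes "continuous_map T T f" "closedin T C"
  shows "closedin T {x \<in> carrier S. f x \<in> C}"
  using closedin_continuous_map_preimage[OF assms] by simp

lemma openin_preimage:
  assumes "continuous_map T T f" "openin T C"
  shows "openin T {x \<in> carrier S. f x \<in> C}"
  using openin_continuous_map_preimage[OF assms] by simp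

lemma closedin_carrier [simp]: "closedin T (carrier S)"
  using closedin_topspace[of T] by simp

lemma openin_carrier [simp]: "openin T (carrier S)"
  using openin_topspace[of T] by simp

text \<open>The product set is the continuous image of a compact set, hence compact, hence closed in
  a Hausdorff space.\<close>

lemma closedin_set_mult:
  assumes "closedin T A" "closedin T B"
  shows "closedin T (A <#> B)"
proof -
  have "compactin (prod_topology T T) (A \<times> B)"
    using assms compact by (simp add: compactin_Times closedin_compact_space)
  moreover have "continuous_map (prod_topology T T) T (\<lambda>z. fst z \<otimes> snd z)"
    by (intro continuous_mult continuous_map_fst continuous_map_snd)
  ultimately have "compactin T ((\<lambda>z. fst z \<otimes> snd z) ` (A \<times> B))"
    by (rule image_compactin)
  moreover have "(\<lambda>z. fst z \<otimes> snd z) ` (A \<times> B) = A <#> B"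
    by (force simp: set_mult_def)
  ultimately show ?thesis
    using compactin_imp_closedin[OF Hausdorff] by simp
qed

text \<open>In this form a coset inherits closedness or openness from \<open>A\<close> by continuity
  of right translation.\<close>

lemma r_coset_eq_preimage:
  assumes "A \<subseteq> carrier S" "x \<in> carrier S"
  shows "A #> x = {y \<in> carrier S. y \<otimes> inv x \<in> A}"
proof (intro equalityI subsetI)
  fix y assume y: "y \<in> {y \<in> carrier S. y \<otimes> inv x \<in> A}"
  then have "y = (y \<otimes> inv x) \<otimes> x"
    using assms by (simp add: m_assoc)
  then show "y \<in> A #> x"
    using y by (auto simp: r_coset_def)
qed (use assms in \<open>auto simp: r_coset_def m_assoc\<close>)

lemma closedin_r_coset:
  assumes "closedin T A" "x \<in> carrier S"
  shows "closedin T (A #> x)"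
  using closedin_subset[OF assms(1)] assms
  by (simp add: r_coset_eq_preimage closedin_preimage continuous_mult continuous_ident)

lemma openin_r_coset:
  assumes "openin T A" "x \<in> carrier S"
  shows "openin T (A #> x)"
  using openin_subset[OF assms(1)] assms
  by (simp add: r_coset_eq_preimage openin_preimage continuous_mult continuous_ident)

lemma openin_subgroup:
  assumes H: "subgroup H S" and W: "openin T W" "\<one> \<in> W" "W \<subseteq> H"
  shows "openin T H"
proof -
  have "H = (\<Union>h\<in>H. W #> h)"
  proof (intro equalityI subsetI)
    fix h assume h: "h \<in> H"
    then have "h = \<one> \<otimes> h" using H subgroup.mem_carrier by force
    then show "h \<in> (\<Union>h\<in>H. W #> h)"
      using h W by (auto simp: r_coset_def)
  next
    fix x assume "x \<in> (\<Union>h\<in>H. W #> h)"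
    then show "x \<in> H"
      using W(3) subgroup.m_closed[OF H] by (auto simp: r_coset_def)
  qed
  moreover have "openin T (\<Union>h\<in>H. W #> h)"
    using W(1) subgroup.mem_carrier[OF H] by (auto intro!: openin_r_coset)
  ultimately show ?thesis by simp
qed

lemma closedin_open_subgroup:
  assumes H: "subgroup H S" and op: "openin T H"
  shows "closedin T H"
proof -
  have "carrier S - H = (\<Union>x\<in>carrier S - H. H #> x)"
  proof (intro equalityI subsetI)
    fix x assume "x \<in> carrier S - H"
    then show "x \<in> (\<Union>x\<in>carrier S - H. H #> x)"
      using rcos_self[OF _ H] by blast
  next
    fix y assume "y \<in> (\<Union>x\<in>carrier S - H. H #> x)"
    then obtain x h where xh: "x \<in> carrier S" "x \<notin> H" "h \<in> H" "y = h \<otimes> x"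
      by (auto simp: r_coset_def)
    have "y \<notin> H"
    proof
      assume "y \<in> H"
      then have "inv h \<otimes> y \<in> H"
        using xh H by (simp add: subgroup.m_closed subgroup.m_inv_closed)
      then show False
        using xh subgroup.mem_carrier[OF H] by simp
    qed
    then show "y \<in> carrier S - H"
      using xh subgroup.mem_carrier[OF H] by simp
  qed
  moreover have "openin T (\<Union>x\<in>carrier S - H. H #> x)"
    using op by (auto intro!: openin_r_coset)
  ultimately show ?thesis
    using subgroup.subset[OF H] by (simp add: closedin_def)
qed

text \<open>Total disconnectedness enters here. In a compact Hausdorff space quasi-components are
  components, so the quasi-component of \<open>\<one>\<close> is a point, and a clopen set separates
  it from the compact complement of \<open>U\<close>.\<close>

lemma clopen_neighbourhood:
  assumes "openin T U" "\<one> \<in> U"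
  obtains V where "openin T V" "closedin T V" "\<one> \<in> V" "V \<subseteq> U"
proof -
  have q: "quasi_component_of T \<one> = connected_component_of T \<one>"
    using quasi_eq_connected_component_of[of T] compact Hausdorff by blast
  have td: "totally_disconnected_space T"
    using profinite by (simp add: profinite_group_def)
  have "quasi_component_of_set T \<one> = {\<one>}"
  proof -
    have "connectedin T (connected_component_of_set T \<one>)"
      by (rule connectedin_connected_component_of)
    then obtain a where "connected_component_of_set T \<one> \<subseteq> {a}"
      using td unfolding totally_disconnected_space_def by blast
    moreover have "\<one> \<in> connected_component_of_set T \<one>"
      by (simp add: connected_component_of_refl)
    ultimately show ?thesis unfolding q by blast
  qed
  then have "{\<one>} \<in> quasi_components_of T"
    unfolding quasi_components_of_def by force
  moreover have "compactin T (carrier S - U)"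
    using assms compact by (simp add: closedin_compact_space closedin_diff)
  ultimately have "separated_between T {\<one>} (carrier S - U)"
    using separated_between_quasi_component_compact[of "{\<one>}" T "carrier S - U"] assms(2) by simp
  then obtain V where "closedin T V" "openin T V" "{\<one>} \<subseteq> V" "carrier S - U \<subseteq> carrier S - V"
    by (auto simp: separated_between)
  then show thesis
    using that[of V] openin_subset[of T V] by auto
qed

text \<open>Take the elements \<open>g\<close> for which right multiplication by \<open>g\<close>
  and by its inverse preserves a clopen neighbourhood \<open>V\<close> of \<open>\<one>\<close>
  inside \<open>U\<close>. They lie in \<open>V\<close> because \<open>\<one> \<in> V\<close>.
  Openness comes from the tube lemma: as \<open>V\<close> is compact, some neighbourhood
  \<open>W\<close> of \<open>\<one>\<close> satisfies \<open>V W \<subseteq> V\<close>.\<close>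

lemma open_subgroup_in_neighbourhood:
  assumes "openin T U" "\<one> \<in> U"
  obtains H where "subgroup H S" "openin T H" "H \<subseteq> U"
proof -
  obtain V where V: "openin T V" "closedin T V" "\<one> \<in> V" "V \<subseteq> U"
    using clopen_neighbourhood[OF assms] .
  have Vc: "V \<subseteq> carrier S" using openin_subset[OF V(1)] by simp
  let ?W = "{z \<in> topspace (prod_topology T T). fst z \<otimes> snd z \<in> V}"
  have "continuous_map (prod_topology T T) T (\<lambda>z. fst z \<otimes> snd z)"
    by (intro continuous_mult continuous_map_fst continuous_map_snd)
  then have "openin (prod_topology T T) ?W"
    by (rule openin_continuous_map_preimage[OF _ V(1)])
  moreover have "V \<times> {\<one>} \<subseteq> ?W" using Vc by auto
  moreover have "compactin T V" using V(2) compact by (simp add: closedin_compact_space)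
  ultimately obtain U' W where W: "openin T W" "\<one> \<in> W" "V \<subseteq> U'" "U' \<times> W \<subseteq> ?W"
    using tube_lemma_left[of T T ?W V \<one>] by auto
  have Wc: "W \<subseteq> carrier S" using openin_subset[OF W(1)] by simp
  have VW: "v \<otimes> w \<in> V" if "v \<in> V" "w \<in> W" for v w
  proof -
    have "(v, w) \<in> ?W" using that W(3,4) by blast
    then show ?thesis by simp
  qed
  let ?H = "{g \<in> carrier S. (\<forall>v\<in>V. v \<otimes> g \<in> V) \<and> (\<forall>v\<in>V. v \<otimes> inv g \<in> V)}"
  have sub: "subgroup ?H S"
  proof (rule subgroupI)
    show "?H \<noteq> {}" using Vc by (auto intro!: exI[of _ \<one>])
    show "a \<otimes> b \<in> ?H" if "a \<in> ?H" "b \<in> ?H" for a b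
    proof -
      have "v \<otimes> (a \<otimes> b) \<in> V" "v \<otimes> inv (a \<otimes> b) \<in> V" if v: "v \<in> V" for v
        using \<open>a \<in> ?H\<close> \<open>b \<in> ?H\<close> v Vc by (auto simp: inv_mult_group subset_iff simp flip: m_assoc)
      then show ?thesis using that by auto
    qed
  qed auto
  let ?W' = "W \<inter> {x \<in> carrier S. inv x \<in> W}"
  have "openin T ?W'"
    using W(1) by (intro openin_Int openin_preimage continuous_inv continuous_ident)
  moreover have "?W' \<subseteq> ?H" using VW Wc by auto
  ultimately have "openin T ?H"
    using openin_subgroup[OF sub, of ?W'] W(2) by simp
  moreover have "?H \<subseteq> U"
  proof
    fix g assume "g \<in> ?H"
    then have "\<one> \<otimes> g \<in> V" "g \<in> carrier S" using V(3) by blast+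
    then show "g \<in> U" using V(4) by auto
  qed
  ultimately show thesis using that[OF sub] by blast
qed

text \<open>The core of an open subgroup \<open>H\<close>. It is open by the tube lemma for the
  conjugation map: as the whole group is compact, one neighbourhood \<open>W\<close> of
  \<open>\<one>\<close> is conjugated into \<open>H\<close> by all elements at once.\<close>

lemma open_normal_in_neighbourhood:
  assumes "openin T U" "\<one> \<in> U"
  obtains N where "N \<lhd> S" "openin T N" "N \<subseteq> U"
proof -
  obtain H where H: "subgroup H S" "openin T H" "H \<subseteq> U"
    using open_subgroup_in_neighbourhood[OF assms] .
  let ?W = "{z \<in> topspace (prod_topology T T). fst z \<otimes> snd z \<otimes> inv (fst z) \<in> H}"
  have "continuous_map (prod_topology T T) T (\<lambda>z. fst z \<otimes> snd z \<otimes> inv (fst z))"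
    by (intro continuous_mult continuous_inv continuous_map_fst continuous_map_snd)
  then have "openin (prod_topology T T) ?W"
    by (rule openin_continuous_map_preimage[OF _ H(2)])
  moreover have "carrier S \<times> {\<one>} \<subseteq> ?W"
    using subgroup.one_closed[OF H(1)] by auto
  moreover have "compactin T (carrier S)" using compact by (simp add: compact_space_def)
  ultimately obtain U' W where W: "openin T W" "\<one> \<in> W" "carrier S \<subseteq> U'" "U' \<times> W \<subseteq> ?W"
    using tube_lemma_left[of T T ?W "carrier S" \<one>] by auto
  have Wc: "W \<subseteq> carrier S" using openin_subset[OF W(1)] by simp
  let ?N = "{g \<in> carrier S. \<forall>x\<in>carrier S. x \<otimes> g \<otimes> inv x \<in> H}"
  have sub: "subgroup ?N S"
  proof (rule subgroupI)
    show "?N \<noteq> {}" using subgroup.one_closed[OF H(1)] by (auto intro!: exI[of _ \<one>])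
    show "inv a \<in> ?N" if "a \<in> ?N" for a
    proof -
      have "x \<otimes> inv a \<otimes> inv x = inv (x \<otimes> a \<otimes> inv x)" if "x \<in> carrier S" for x
        using that \<open>a \<in> ?N\<close> by (simp add: inv_mult_group m_assoc)
      then show ?thesis
        using that subgroup.m_inv_closed[OF H(1)] by auto
    qed
    show "a \<otimes> b \<in> ?N" if "a \<in> ?N" "b \<in> ?N" for a b
    proof -
      have "x \<otimes> (a \<otimes> b) \<otimes> inv x = (x \<otimes> a \<otimes> inv x) \<otimes> (x \<otimes> b \<otimes> inv x)" if "x \<in> carrier S" for x
        using that \<open>a \<in> ?N\<close> \<open>b \<in> ?N\<close> by (simp add: m_assoc)
      then show ?thesis
        using that subgroup.m_closed[OF H(1)] by auto
    qed
  qed auto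
  have "?N \<lhd> S"
    unfolding normal_inv_iff
  proof (intro conjI sub ballI)
    fix x h assume x: "x \<in> carrier S" and h: "h \<in> ?N"
    have "y \<otimes> (x \<otimes> h \<otimes> inv x) \<otimes> inv y = (y \<otimes> x) \<otimes> h \<otimes> inv (y \<otimes> x)" if "y \<in> carrier S" for y
      using that x h by (simp add: inv_mult_group m_assoc)
    then show "x \<otimes> h \<otimes> inv x \<in> ?N"
      using x h by auto
  qed
  moreover have "W \<subseteq> ?N"
  proof
    fix w assume w: "w \<in> W"
    have "x \<otimes> w \<otimes> inv x \<in> H" if "x \<in> carrier S" for x
    proof -
      have "(x, w) \<in> ?W" using that w W(3,4) by blast
      then show ?thesis by simp
    qed
    then show "w \<in> ?N" using w Wc by blast
  qed
  then have "openin T ?N" using openin_subgroup[OF sub W(1,2)] by blast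
  moreover have "?N \<subseteq> U"
  proof
    fix g assume "g \<in> ?N"
    then have "\<one> \<otimes> g \<otimes> inv \<one> \<in> H" "g \<in> carrier S" by blast+
    then show "g \<in> U" using H(3) by auto
  qed
  ultimately show thesis using that by blast
qed

text \<open>Choose \<open>N\<close> inside the open neighbourhood of \<open>\<one>\<close> formed by
  the \<open>y\<close> with \<open>x \<otimes> inv y\<close> outside \<open>M\<close>.\<close>

lemma open_normal_separates:
  assumes "closedin T M" "x \<in> carrier S" "x \<notin> M"
  obtains N where "N \<lhd> S" "openin T N" "x \<notin> M <#> N"
proof -
  have Mc: "M \<subseteq> carrier S" using closedin_subset[OF assms(1)] by simp
  have "openin T (carrier S - M)" using assms(1) by (simp add: openin_diff)
  then have "openin T {y \<in> carrier S. x \<otimes> inv y \<in> carrier S - M}"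
    using assms(2) by (intro openin_preimage continuous_mult continuous_inv continuous_ident) auto
  moreover have "\<one> \<in> {y \<in> carrier S. x \<otimes> inv y \<in> carrier S - M}"
    using assms by simp
  ultimately obtain N where N: "N \<lhd> S" "openin T N" "N \<subseteq> {y \<in> carrier S. x \<otimes> inv y \<in> carrier S - M}"
    using open_normal_in_neighbourhood by blast
  have "x \<notin> M <#> N"
  proof
    assume "x \<in> M <#> N"
    then obtain m n where mn: "m \<in> M" "n \<in> N" "x = m \<otimes> n" by (auto simp: set_mult_def)
    then have "x \<otimes> inv n = m" using Mc N(3) by (auto simp: m_assoc subset_iff)
    then show False using mn N(3) by auto
  qed
  then show thesis using that N by blast
qed

section \<open>Closed subgroups and closed normal subgroups generated by a set\<close>

lemma closed_generate_subgroup: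
  assumes "A \<subseteq> carrier S"
  shows "subgroup (closed_generate S T A) S" "closedin T (closed_generate S T A)"
    "A \<subseteq> closed_generate S T A"
proof -
  have *: "carrier S \<in> {H. subgroup H S \<and> closedin T H \<and> A \<subseteq> H}"
    using assms subgroup_self by simp
  show "subgroup (closed_generate S T A) S"
    unfolding closed_generate_def by (rule subgroups_Inter) (use * in blast)+
  show "closedin T (closed_generate S T A)"
    unfolding closed_generate_def by (rule closedin_Inter) (use * in blast)+
  show "A \<subseteq> closed_generate S T A"
    unfolding closed_generate_def by blast
qed

lemma closed_generate_minimal:
  "\<lbrakk>subgroup H S; closedin T H; A \<subseteq> H\<rbrakk> \<Longrightarrow> closed_generate S T A \<subseteq> H"
  unfolding closed_generate_def by blast

lemma normal_Inter:
  assumes "\<And>N. N \<in> \<N> \<Longrightarrow> N \<lhd> S" "\<N> \<noteq> {}"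
  shows "\<Inter>\<N> \<lhd> S"
  unfolding normal_inv_iff
proof (intro conjI ballI)
  show "subgroup (\<Inter>\<N>) S"
    using assms by (intro subgroups_Inter) (auto simp: normal_inv_iff)
qed (use assms in \<open>auto simp: normal_inv_iff\<close>)

lemma closed_normal_generate_normal:
  assumes "A \<subseteq> carrier S"
  shows "closed_normal_generate S T A \<lhd> S" "closedin T (closed_normal_generate S T A)"
    "A \<subseteq> closed_normal_generate S T A"
proof -
  have *: "carrier S \<in> {H. H \<lhd> S \<and> closedin T H \<and> A \<subseteq> H}"
    using assms by (simp add: normal_inv_iff subgroup_self)
  show "closed_normal_generate S T A \<lhd> S"
    unfolding closed_normal_generate_def by (rule normal_Inter) (use * in blast)+
  show "closedin T (closed_normal_generate S T A)"
    unfolding closed_normal_generate_def by (rule closedin_Inter) (use * in blast)+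
  show "A \<subseteq> closed_normal_generate S T A"
    unfolding closed_normal_generate_def by blast
qed

lemma closed_normal_generate_minimal:
  "\<lbrakk>N \<lhd> S; closedin T N; A \<subseteq> N\<rbrakk> \<Longrightarrow> closed_normal_generate S T A \<subseteq> N"
  unfolding closed_normal_generate_def by blast

lemma conj_preimage_subgroup:
  assumes H: "subgroup H S" and g: "g \<in> carrier S"
  shows "subgroup {x \<in> carrier S. g \<otimes> x \<otimes> inv g \<in> H} S"
proof (rule subgroupI)
  show "{x \<in> carrier S. g \<otimes> x \<otimes> inv g \<in> H} \<noteq> {}"
    using subgroup.one_closed[OF H] g by (auto intro!: exI[of _ \<one>])
next
  fix a assume a: "a \<in> {x \<in> carrier S. g \<otimes> x \<otimes> inv g \<in> H}"
  then have "g \<otimes> inv a \<otimes> inv g = inv (g \<otimes> a \<otimes> inv g)"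
    using g by (simp add: inv_mult_group m_assoc)
  then show "inv a \<in> {x \<in> carrier S. g \<otimes> x \<otimes> inv g \<in> H}"
    using a subgroup.m_inv_closed[OF H] by auto
next
  fix a b assume ab: "a \<in> {x \<in> carrier S. g \<otimes> x \<otimes> inv g \<in> H}" "b \<in> {x \<in> carrier S. g \<otimes> x \<otimes> inv g \<in> H}"
  then have "g \<otimes> (a \<otimes> b) \<otimes> inv g = (g \<otimes> a \<otimes> inv g) \<otimes> (g \<otimes> b \<otimes> inv g)"
    using g by (simp add: m_assoc)
  then show "a \<otimes> b \<in> {x \<in> carrier S. g \<otimes> x \<otimes> inv g \<in> H}"
    using ab subgroup.m_closed[OF H] by auto
qed auto

text \<open>For fixed \<open>g\<close>, the elements whose conjugate by \<open>g\<close> lies in the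
  generated subgroup form a closed subgroup, which contains \<open>A\<close> by invariance.\<close>

lemma closed_generate_normal:
  assumes A: "A \<subseteq> carrier S"
    and inv: "\<And>g a. g \<in> carrier S \<Longrightarrow> a \<in> A \<Longrightarrow> g \<otimes> a \<otimes> inv g \<in> A"
  shows "closed_generate S T A \<lhd> S"
  unfolding normal_inv_iff
proof (intro conjI ballI closed_generate_subgroup[OF A])
  fix g h assume g: "g \<in> carrier S" and h: "h \<in> closed_generate S T A"
  let ?K = "{x \<in> carrier S. g \<otimes> x \<otimes> inv g \<in> closed_generate S T A}"
  have "closed_generate S T A \<subseteq> ?K"
  proof (rule closed_generate_minimal)
    show "subgroup ?K S" using closed_generate_subgroup(1)[OF A] g by (rule conj_preimage_subgroup)
    show "closedin T ?K"
      using g closed_generate_subgroup(2)[OF A]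
      by (intro closedin_preimage continuous_mult continuous_ident) auto
    show "A \<subseteq> ?K" using inv[OF g] closed_generate_subgroup(3)[OF A] A by blast
  qed
  with h show "g \<otimes> h \<otimes> inv g \<in> closed_generate S T A" by blast
qed

end

section \<open>Central series\<close>

locale pro_p = profinite S T for S :: "'a monoid" (structure) and T +
  fixes p :: nat
  assumes prime_p: "Factorial_Ring.prime p"
    and pro_p: "pro_p_group p S T"
begin

lemma mnormalI: "N \<lhd> S \<Longrightarrow> mnormal N S"
  by (simp add: mnormal_def)

lemma normal_mem: "N \<lhd> S \<Longrightarrow> x \<in> N \<Longrightarrow> x \<in> carrier S"
  by (meson normal_imp_subgroup subgroup.mem_carrier)

lemma normal_subset: "N \<lhd> S \<Longrightarrow> N \<subseteq> carrier S"
  by (meson normal_imp_subgroup subgroup.subset)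

lemma closed_subgroup_mult:
  assumes M: "M \<lhd> S" "closedin T M" and K: "subgroup K S" "closedin T K"
  shows "subgroup (M <#> K) S" "closedin T (M <#> K)"
    "M \<subseteq> M <#> K" "K \<subseteq> M <#> K"
proof -
  show "subgroup (M <#> K) S"
    by (meson M(1) K(1) mult_norm_subgroup)
  show "closedin T (M <#> K)" using M K by (simp add: closedin_set_mult)
  have "m = m \<otimes> \<one>" "m \<in> carrier S" if "m \<in> M" for m
    using that M(1) by (auto simp: normal_inv_iff subgroup.mem_carrier)
  then show "M \<subseteq> M <#> K"
    using subgroup.one_closed[OF K(1)] by (fastforce simp: set_mult_def)
  have "k = \<one> \<otimes> k" if "k \<in> K" for k
    using that K(1) by (auto simp: subgroup.mem_carrier)
  moreover have "\<one> \<in> M" using M(1) by (simp add: normal_inv_iff subgroup.one_closed)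
  ultimately show "K \<subseteq> M <#> K"
    by (fastforce simp: set_mult_def)
qed

lemma normal_set_mult:
  assumes M: "M \<lhd> S" and K: "K \<lhd> S"
  shows "M <#> K \<lhd> S"
  unfolding normal_inv_iff
proof (intro conjI ballI)
  show "subgroup (M <#> K) S"
    by (meson M K mult_norm_subgroup normal_imp_subgroup)
  fix x h assume x: "x \<in> carrier S" and "h \<in> M <#> K"
  then obtain m k where mk: "m \<in> M" "k \<in> K" "h = m \<otimes> k" by (auto simp: set_mult_def)
  have c: "m \<in> carrier S" "k \<in> carrier S"
    using mk M K by (auto simp: normal_inv_iff subgroup.mem_carrier)
  have "x \<otimes> h \<otimes> inv x = (x \<otimes> m \<otimes> inv x) \<otimes> (x \<otimes> k \<otimes> inv x)"
    using mk x c by (simp add: m_assoc)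
  moreover have "x \<otimes> m \<otimes> inv x \<in> M" "x \<otimes> k \<otimes> inv x \<in> K"
    using mk x M K by (auto simp: normal_inv_iff)
  ultimately show "x \<otimes> h \<otimes> inv x \<in> M <#> K" by (auto simp: set_mult_def)
qed

section \<open>The central step and the series obtained by iterating it\<close>

abbreviation "cstep \<equiv> central_step p S T"
abbreviation "Ser \<equiv> p_series p S T"
abbreviation "Rel \<equiv> rel_series p S T"

definition cgens :: "'a set \<Rightarrow> 'a set" where
  "cgens N = {x [^] p | x. x \<in> N} \<union> {group_commutator S x y | x y. x \<in> N \<and> y \<in> carrier S}"

lemma cstep_eq: "cstep N = closed_generate S T (cgens N)"
  by (simp add: central_step_def cgens_def)

lemma cgens_subset: "N \<subseteq> carrier S \<Longrightarrow> cgens N \<subseteq> carrier S"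
  by (auto simp: cgens_def)

lemma cstep_closed: "N \<subseteq> carrier S \<Longrightarrow> closedin T (cstep N)"
  unfolding cstep_eq by (intro closed_generate_subgroup cgens_subset)

lemma cstep_subgroup: "N \<subseteq> carrier S \<Longrightarrow> subgroup (cstep N) S"
  unfolding cstep_eq by (intro closed_generate_subgroup cgens_subset)

lemma pow_in_cstep: "N \<subseteq> carrier S \<Longrightarrow> x \<in> N \<Longrightarrow> x [^] p \<in> cstep N"
  unfolding cstep_eq by (rule subsetD[OF closed_generate_subgroup(3)[OF cgens_subset]]) (auto simp: cgens_def)

lemma commutator_in_cstep:
  "N \<subseteq> carrier S \<Longrightarrow> x \<in> N \<Longrightarrow> y \<in> carrier S \<Longrightarrow> group_commutator S x y \<in> cstep N"
  unfolding cstep_eq by (rule subsetD[OF closed_generate_subgroup(3)[OF cgens_subset]]) (auto simp: cgens_def)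

lemma cstep_minimal:
  assumes "subgroup H S" "closedin T H" "\<And>x. x \<in> N \<Longrightarrow> x [^] p \<in> H"
    "\<And>x y. x \<in> N \<Longrightarrow> y \<in> carrier S \<Longrightarrow> group_commutator S x y \<in> H"
  shows "cstep N \<subseteq> H"
  unfolding cstep_eq using assms by (intro closed_generate_minimal) (auto simp: cgens_def)

lemma cstep_normal:
  assumes "N \<lhd> S"
  shows "cstep N \<lhd> S"
  unfolding cstep_eq
proof (rule closed_generate_normal)
  have N: "x \<in> carrier S" "g \<otimes> x \<otimes> inv g \<in> N" if "x \<in> N" "g \<in> carrier S" for g x
    using assms that by (auto simp: normal_inv_iff subgroup.mem_carrier)
  show "cgens N \<subseteq> carrier S" using N one_closed by (intro cgens_subset) blast
  fix g a assume g: "g \<in> carrier S" and "a \<in> cgens N"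
  then consider x where "x \<in> N" "a = x [^] p"
    | x y where "x \<in> N" "y \<in> carrier S" "a = group_commutator S x y"
    by (auto simp: cgens_def)
  then show "g \<otimes> a \<otimes> inv g \<in> cgens N"
  proof cases
    case 1
    then have "g \<otimes> a \<otimes> inv g = (g \<otimes> x \<otimes> inv g) [^] p" using g N by (simp add: pow_conj)
    then show ?thesis using N[OF \<open>x \<in> N\<close> g] by (auto simp: cgens_def)
  next
    case 2
    then have "g \<otimes> a \<otimes> inv g = group_commutator S (g \<otimes> x \<otimes> inv g) (g \<otimes> y \<otimes> inv g)"
      using g N by (simp add: commutator_conj)
    then show ?thesis using N[OF \<open>x \<in> N\<close> g] 2 g unfolding cgens_def by blast
  qed
qed

lemma commutator_mem_normal:
  assumes "N \<lhd> S" "x \<in> N" "y \<in> carrier S"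
  shows "group_commutator S x y \<in> N" "group_commutator S y x \<in> N"
proof -
  have N: "subgroup N S" "\<And>g x. x \<in> N \<Longrightarrow> g \<in> carrier S \<Longrightarrow> g \<otimes> x \<otimes> inv g \<in> N"
    using assms(1) by (auto simp: normal_inv_iff)
  have x: "x \<in> carrier S" using N assms(2) by (simp add: subgroup.mem_carrier)
  have "group_commutator S y x = (y \<otimes> x \<otimes> inv y) \<otimes> inv x"
    by (simp add: group_commutator_def)
  then show 1: "group_commutator S y x \<in> N"
    using N assms(2,3) by (simp add: subgroup.m_closed subgroup.m_inv_closed)
  then show "group_commutator S x y \<in> N"
    using subgroup.m_inv_closed[OF N(1) 1] x assms(3) by (simp add: inv_commutator)
qed

lemma cstep_subset:
  assumes "N \<lhd> S" "closedin T N"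
  shows "cstep N \<subseteq> N"
proof (rule cstep_minimal)
  show N: "subgroup N S" using assms by (simp add: normal_imp_subgroup)
  have "x [^] n \<in> N" if "x \<in> N" for x and n :: nat
    using that N by (induction n) (auto simp: subgroup.m_closed subgroup.one_closed)
  then show "\<And>x. x \<in> N \<Longrightarrow> x [^] p \<in> N" by blast
qed (use assms commutator_mem_normal in auto)

lemma cstep_mono:
  assumes "M \<subseteq> N" "N \<subseteq> carrier S"
  shows "cstep M \<subseteq> cstep N"
  using assms
  by (intro cstep_minimal cstep_subgroup cstep_closed pow_in_cstep commutator_in_cstep) auto

lemma Rel_1 [simp]: "Rel R (Suc 0) = R"
  by (simp add: rel_series_def)

text \<open>The hypothesis excludes the dummy index: subtraction on \<open>nat\<close> is truncated,
  so the values at 0 and 1 coincide.\<close>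

lemma Rel_Suc: "n \<ge> 1 \<Longrightarrow> Rel R (Suc n) = cstep (Rel R n)"
  by (cases n) (auto simp: rel_series_def)

lemma Ser_1 [simp]: "Ser (Suc 0) = carrier S"
  by (simp add: p_series_def)

lemma Ser_Suc: "n \<ge> 1 \<Longrightarrow> Ser (Suc n) = cstep (Ser n)"
  by (simp add: p_series_def Rel_Suc)

lemma carrier_normal: "carrier S \<lhd> S"
  by (simp add: normal_inv_iff subgroup_self)

lemma Rel_closed_normal:
  assumes "R \<lhd> S" "closedin T R"
  shows "Rel R n \<lhd> S \<and> closedin T (Rel R n)"
proof (induction n)
  case 0
  then show ?case using assms by (simp add: rel_series_def)
next
  case (Suc n)
  show ?case
  proof (cases "n \<ge> 1")
    case True
    then show ?thesis
      using Suc cstep_normal cstep_closed by (simp add: Rel_Suc normal_subset)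
    next
    case False
    then have "n = 0" by simp
    then show ?thesis using assms by (simp add: rel_series_def)
  qed
qed

lemma Ser_normal: "Ser n \<lhd> S" and Ser_closed: "closedin T (Ser n)"
  using Rel_closed_normal[OF carrier_normal closedin_carrier] by (auto simp: p_series_def)

lemma Ser_subgroup: "subgroup (Ser n) S"
  using Ser_normal by (simp add: normal_imp_subgroup)

lemma Ser_mem [simp]: "x \<in> Ser n \<Longrightarrow> x \<in> carrier S"
  using Ser_normal by (rule normal_mem)

lemma Rel_antimono:
  assumes "R \<lhd> S" "closedin T R" "m \<le> n"
  shows "Rel R n \<subseteq> Rel R m"
  using assms(3)
proof (induction n rule: dec_induct)
  case (step n)
  show ?case
  proof (cases "n \<ge> 1")
    case True
    then show ?thesis
      using step.IH cstep_subset[of "Rel R n"] Rel_closed_normal[OF assms(1,2), of n] by (auto simp: Rel_Suc)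
  next
    case False
    then have "n = 0" "m = 0" using step by simp_all
    then show ?thesis by (simp add: rel_series_def)
  qed
qed simp

lemma Ser_antimono: "m \<le> n \<Longrightarrow> Ser n \<subseteq> Ser m"
  using Rel_antimono[OF carrier_normal closedin_carrier] by (simp add: p_series_def)

text \<open>This set is the preimage of the centralizer of the image of \<open>R\<close> in
  \<open>S/N\<close>. It is closed as an intersection of preimages of \<open>N\<close> under the
  continuous maps sending \<open>g\<close> to its commutator with \<open>r\<close>.\<close>

lemma centralizer_mod_subgroup:
  assumes N: "N \<lhd> S" "closedin T N" and R: "R \<subseteq> carrier S"
  shows "subgroup {g \<in> carrier S. \<forall>r\<in>R. group_commutator S g r \<in> N} S"
    and "closedin T {g \<in> carrier S. \<forall>r\<in>R. group_commutator S g r \<in> N}" (is "closedin T ?C")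
proof -
  interpret N: mnormal N S by (rule mnormalI[OF N(1)])
  interpret q: mgroup_hom S "S Mod N" "\<lambda>x. N #> x" by (rule N.rcos_group_hom)
  have C: "g \<in> ?C \<longleftrightarrow> g \<in> carrier S \<and> (\<forall>r\<in>R. (N #> g) \<otimes>\<^bsub>S Mod N\<^esub> (N #> r) = (N #> r) \<otimes>\<^bsub>S Mod N\<^esub> (N #> g))" for g
    using R N.commutator_mem_iff by (auto simp: subset_iff)
  show "subgroup ?C S"
  proof (rule subgroupI)
    show "?C \<noteq> {}"
    proof -
      have "group_commutator S \<one> r = \<one>" if "r \<in> R" for r
        using that R by (auto simp: group_commutator_def)
      then have "\<one> \<in> ?C" by simp
      then show ?thesis by blast
    qed
  next
    fix a assume a: "a \<in> ?C"
    then have ac: "a \<in> carrier S" by simp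
    have "(N #> inv a) \<otimes>\<^bsub>S Mod N\<^esub> (N #> r) = (N #> r) \<otimes>\<^bsub>S Mod N\<^esub> (N #> inv a)" if r: "r \<in> R" for r
    proof -
      have rc: "N #> r \<in> carrier (S Mod N)" using r R by (intro q.hom_closed) auto
      have "N #> inv a = inv\<^bsub>S Mod N\<^esub> (N #> a)" using ac by simp
      moreover have "(N #> a) \<otimes>\<^bsub>S Mod N\<^esub> (N #> r) = (N #> r) \<otimes>\<^bsub>S Mod N\<^esub> (N #> a)"
        using a r C by blast
      ultimately show ?thesis
        using rc q.hom_closed[OF ac]
        by (metis q.H.inv_solve_left' q.H.inv_solve_right' q.H.inv_closed q.H.m_assoc q.H.m_closed)
    qed
    then show "inv a \<in> ?C" using C[of "inv a"] ac by simp
  next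
    fix a b assume a: "a \<in> ?C" and b: "b \<in> ?C"
    then have c: "a \<in> carrier S" "b \<in> carrier S" by simp_all
    have "(N #> (a \<otimes> b)) \<otimes>\<^bsub>S Mod N\<^esub> (N #> r) = (N #> r) \<otimes>\<^bsub>S Mod N\<^esub> (N #> (a \<otimes> b))" if r: "r \<in> R" for r
    proof -
      have rc: "N #> r \<in> carrier (S Mod N)" using r R by (intro q.hom_closed) auto
      have e: "N #> (a \<otimes> b) = (N #> a) \<otimes>\<^bsub>S Mod N\<^esub> (N #> b)" using c by (rule q.hom_mult)
      have "(N #> a) \<otimes>\<^bsub>S Mod N\<^esub> (N #> r) = (N #> r) \<otimes>\<^bsub>S Mod N\<^esub> (N #> a)"
        "(N #> b) \<otimes>\<^bsub>S Mod N\<^esub> (N #> r) = (N #> r) \<otimes>\<^bsub>S Mod N\<^esub> (N #> b)"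
        using a b r C by blast+
      then show ?thesis
        unfolding e using rc q.hom_closed[OF c(1)] q.hom_closed[OF c(2)]
        by (metis q.H.m_assoc)
    qed
    then show "a \<otimes> b \<in> ?C" using C[of "a \<otimes> b"] c by simp
  qed auto
  \<comment> \<open>For empty \<open>R\<close> the intersection would be the whole type instead of
    the carrier.\<close>
  have "?C = (if R = {} then carrier S else (\<Inter>r\<in>R. {g \<in> carrier S. group_commutator S g r \<in> N}))"
    by auto
  moreover have "closedin T {g \<in> carrier S. group_commutator S g r \<in> N}" if "r \<in> R" for r
    using that R N(2) by (intro closedin_preimage continuous_commutator continuous_ident) auto
  ultimately show "closedin T ?C" by auto
qed

end

text \<open>Here \<open>b\<close> is the commutator of \<open>x\<close> with \<open>r\<close>, and
  \<open>a\<close> that of \<open>y\<close> with \<open>r\<close>. Moving \<open>x\<close> past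
  \<open>a\<close> and \<open>y\<close> past \<open>b\<close> shows that both conjugates equal
  \<open>a \<otimes> b \<otimes> r\<close>. Together with \<open>commute_commutator\<close> this
  takes the place of the three subgroups lemma.\<close>

lemma (in mgroup) conj_swap_of_commute:
  assumes c: "x \<in> carrier G" "y \<in> carrier G" "r \<in> carrier G" "a \<in> carrier G" "b \<in> carrier G"
    and xr: "x \<otimes> r = b \<otimes> r \<otimes> x" and yr: "y \<otimes> r = a \<otimes> r \<otimes> y"
    and xa: "x \<otimes> a = a \<otimes> x" and yb: "y \<otimes> b = b \<otimes> y" and ab: "a \<otimes> b = b \<otimes> a"
  shows "(x \<otimes> y) \<otimes> r \<otimes> inv (x \<otimes> y) = (y \<otimes> x) \<otimes> r \<otimes> inv (y \<otimes> x)"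
proof -
  have "(x \<otimes> y) \<otimes> r = x \<otimes> (a \<otimes> r \<otimes> y)" using c yr by (simp add: m_assoc)
  also have "\<dots> = (x \<otimes> a) \<otimes> r \<otimes> y" using c by (simp add: m_assoc)
  also have "\<dots> = a \<otimes> (x \<otimes> r) \<otimes> y" unfolding xa using c by (simp add: m_assoc)
  also have "\<dots> = (a \<otimes> b) \<otimes> r \<otimes> (x \<otimes> y)" unfolding xr using c by (simp add: m_assoc)
  finally have 1: "(x \<otimes> y) \<otimes> r = (a \<otimes> b \<otimes> r) \<otimes> (x \<otimes> y)" .
  have "(y \<otimes> x) \<otimes> r = y \<otimes> (b \<otimes> r \<otimes> x)" using c xr by (simp add: m_assoc)
  also have "\<dots> = (y \<otimes> b) \<otimes> r \<otimes> x" using c by (simp add: m_assoc)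
  also have "\<dots> = b \<otimes> (y \<otimes> r) \<otimes> x" unfolding yb using c by (simp add: m_assoc)
  also have "\<dots> = (b \<otimes> a) \<otimes> r \<otimes> (y \<otimes> x)" unfolding yr using c by (simp add: m_assoc)
  finally have 2: "(y \<otimes> x) \<otimes> r = (a \<otimes> b \<otimes> r) \<otimes> (y \<otimes> x)" unfolding ab .
  have "(x \<otimes> y) \<otimes> r \<otimes> inv (x \<otimes> y) = a \<otimes> b \<otimes> r"
    unfolding 1 using c by (simp add: m_assoc del: inv_mult_group)
  moreover have "(y \<otimes> x) \<otimes> r \<otimes> inv (y \<otimes> x) = a \<otimes> b \<otimes> r"
    unfolding 2 using c by (simp add: m_assoc del: inv_mult_group)
  ultimately show ?thesis by simp
qed

text \<open>Since the commutator is \<open>(x \<otimes> y) \<otimes> inv (y \<otimes> x)\<close>, it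
  conjugates the right-hand side of the hypothesis into the left-hand side; their equality means
  that it commutes with this element.\<close>

lemma (in mgroup) commute_commutator:
  assumes c: "x \<in> carrier G" "y \<in> carrier G" "r \<in> carrier G"
    and e: "(x \<otimes> y) \<otimes> r \<otimes> inv (x \<otimes> y) = (y \<otimes> x) \<otimes> r \<otimes> inv (y \<otimes> x)"
  shows "group_commutator G x y \<otimes> ((y \<otimes> x) \<otimes> r \<otimes> inv (y \<otimes> x))
       = ((y \<otimes> x) \<otimes> r \<otimes> inv (y \<otimes> x)) \<otimes> group_commutator G x y"
proof -
  let ?u = "x \<otimes> y" and ?v = "y \<otimes> x"
  have g: "group_commutator G x y = ?u \<otimes> inv ?v"
    using c by (simp add: group_commutator_def inv_mult_group m_assoc)
  have "group_commutator G x y \<otimes> (?v \<otimes> r \<otimes> inv ?v) = ?u \<otimes> (inv ?v \<otimes> (?v \<otimes> (r \<otimes> inv ?v)))"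
    unfolding g using c by (simp add: m_assoc del: inv_mult_cancel)
  also have "\<dots> = ?u \<otimes> r \<otimes> inv ?v" using c inv_mult_cancel(1)[of ?v "r \<otimes> inv ?v"] by (simp add: m_assoc)
  also have "\<dots> = (?u \<otimes> r \<otimes> inv ?u) \<otimes> (?u \<otimes> inv ?v)"
    using c inv_mult_cancel(1)[of ?u "inv ?v"] by (simp add: m_assoc)
  finally show ?thesis unfolding e g .
qed

context pro_p
begin

text \<open>Induction on \<open>m\<close> for all \<open>n\<close> simultaneously: to treat a
  generator \<open>group_commutator S x y\<close> of the next term, the induction hypothesis is
  applied to \<open>r\<close> and also to the commutator of \<open>y\<close> with \<open>r\<close>,
  which lies one term deeper in the series of \<open>R\<close>.\<close>

lemma commutator_Ser_Rel:
  assumes R: "R \<lhd> S" "closedin T R" and "m \<ge> 1" "n \<ge> 1" "x \<in> Ser m" "r \<in> Rel R n"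
  shows "group_commutator S x r \<in> Rel R (m + n)"
  using assms(3-6)
proof (induction m arbitrary: n x r rule: nat_induct_at_least)
  case base
  have Rc: "Rel R n \<subseteq> carrier S" using Rel_closed_normal[OF R] by (simp add: normal_subset)
  have x: "x \<in> carrier S" using base by simp
  have "group_commutator S r x \<in> Rel R (Suc n)"
    using base x Rc by (simp add: Rel_Suc commutator_in_cstep)
  then have "inv (group_commutator S r x) \<in> Rel R (Suc n)"
    using Rel_closed_normal[OF R] by (simp add: normal_inv_iff subgroup.m_inv_closed)
  then show ?case using base Rc x by (simp add: inv_commutator subset_iff)
next
  case (Suc m)
  let ?N = "Rel R (Suc (m + n))"
  have nn: "Rel R k \<lhd> S" "closedin T (Rel R k)" for k using Rel_closed_normal[OF R] by auto
  have Rc: "r \<in> carrier S" if "r \<in> Rel R k" for r k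
    using nn(1)[of k] that by (rule normal_mem)
  interpret N: mnormal ?N S by (rule mnormalI[OF nn(1)])
  interpret q: mgroup_hom S "S Mod ?N" "\<lambda>x. ?N #> x" by (rule N.rcos_group_hom)
  let ?Q = "S Mod ?N" and ?q = "\<lambda>x. ?N #> x"
  let ?C = "{g \<in> carrier S. \<forall>r\<in>Rel R n. group_commutator S g r \<in> ?N}"
  \<comment> \<open>By construction of the series, \<open>Rel R (m + n)\<close> becomes central
    modulo its next term.\<close>
  have central: "?q b \<otimes>\<^bsub>?Q\<^esub> ?q y = ?q y \<otimes>\<^bsub>?Q\<^esub> ?q b" if "b \<in> Rel R (m + n)" "y \<in> carrier S" for b y
  proof -
    have "group_commutator S b y \<in> cstep (Rel R (m + n))"
      using that Rc by (intro commutator_in_cstep) auto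
    then have "group_commutator S b y \<in> ?N"
      using Suc.prems(1) by (simp add: Rel_Suc)
    then show ?thesis using N.commutator_mem_iff that Rc by blast
  qed
  have conj: "?q z \<otimes>\<^bsub>?Q\<^esub> ?q r = ?q (group_commutator S z r) \<otimes>\<^bsub>?Q\<^esub> ?q r \<otimes>\<^bsub>?Q\<^esub> ?q z"
    if "z \<in> carrier S" "r \<in> carrier S" for z r
    using that commutator_mult[of z r] q.hom_mult
    by (metis commutator_closed m_assoc m_closed)
  \<comment> \<open>The elements centralizing \<open>R\<^sub>n\<close> modulo \<open>R\<^sub>m\<^sub>+\<^sub>n\<^sub>+\<^sub>1\<close> form a closed subgroup, so only generators of \<open>S\<^sub>m\<^sub>+\<^sub>1\<close> matter.\<close>
  have "Ser (Suc m) \<subseteq> ?C"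
    unfolding Ser_Suc[OF Suc.hyps]
  proof (rule cstep_minimal)
    show "subgroup ?C S" "closedin T ?C"
      using centralizer_mod_subgroup[OF nn] Rc by blast+
  next
    fix x assume x: "x \<in> Ser m"
    then have xc: "x \<in> carrier S" by simp
    have "group_commutator S (x [^] p) r \<in> ?N" if r: "r \<in> Rel R n" for r
    proof -
      let ?c = "group_commutator S x r"
      have c: "?c \<in> Rel R (m + n)" using Suc.IH[OF \<open>n \<ge> 1\<close> x r] .
      have cc: "?c \<in> carrier S" "r \<in> carrier S" using Rc c r by auto
      \<comment> \<open>The commutator of \<open>x\<close> and \<open>r\<close> also has exponent
        \<open>p\<close> modulo \<open>?N\<close>, so the accumulated factor in
        \<open>pow_mult_eq_of_commute\<close> vanishes.\<close>
      have "?c [^] p \<in> cstep (Rel R (m + n))" using c Rc by (intro pow_in_cstep) auto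
      then have cp: "?c [^] p \<in> ?N" using Suc.prems(1) by (simp add: Rel_Suc)
      have "?q x [^]\<^bsub>?Q\<^esub> p \<otimes>\<^bsub>?Q\<^esub> ?q r = ?q ?c [^]\<^bsub>?Q\<^esub> p \<otimes>\<^bsub>?Q\<^esub> ?q r \<otimes>\<^bsub>?Q\<^esub> ?q x [^]\<^bsub>?Q\<^esub> p"
        using conj[OF xc cc(2)] central[OF c xc] xc cc
        by (intro q.H.pow_mult_eq_of_commute q.hom_closed) simp_all
      moreover have "?q ?c [^]\<^bsub>?Q\<^esub> p = \<one>\<^bsub>?Q\<^esub>"
        using N.FactGroup_pow[OF cc(1), of p] N.rcos_eq_one_iff cp cc by simp
      ultimately have "?q (x [^] p) \<otimes>\<^bsub>?Q\<^esub> ?q r = ?q r \<otimes>\<^bsub>?Q\<^esub> ?q (x [^] p)"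
        using N.FactGroup_pow[OF xc, of p] q.hom_closed[OF cc(2)] q.H.l_one by metis
      then show ?thesis using N.commutator_mem_iff xc cc by simp
    qed
    then show "x [^] p \<in> ?C" using xc by simp
  next
    fix x y assume x: "x \<in> Ser m" and y: "y \<in> carrier S"
    then have xc: "x \<in> carrier S" by simp
    have "group_commutator S (group_commutator S x y) r' \<in> ?N" if r': "r' \<in> Rel R n" for r'
    proof -
      let ?v = "y \<otimes> x"
      have r'c: "r' \<in> carrier S" using Rc r' .
      have vc: "?v \<in> carrier S" using xc y by simp
      \<comment> \<open>\<open>xy\<close> and \<open>yx\<close> conjugate \<open>R\<^sub>n\<close> in the same way modulo \<open>?N\<close>, so \<open>[x,y]\<close> centralizes every \<open>(yx)r(yx)\<inverse>\<close>.\<close>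
      define r where "r = inv ?v \<otimes> r' \<otimes> ?v"
      have r: "r \<in> Rel R n"
      proof -
        have "inv ?v \<otimes> r' \<otimes> inv (inv ?v) \<in> Rel R n"
          using nn(1)[of n] r' vc by (meson normal_inv_iff inv_closed)
        then show ?thesis using vc by (simp add: r_def)
      qed
      have rc: "r \<in> carrier S" using Rc r .
      have r'_eq: "r' = ?v \<otimes> r \<otimes> inv ?v"
        unfolding r_def using conjugation_is_surj[OF vc r'c] by simp
      let ?a = "group_commutator S y r" and ?b = "group_commutator S x r"
      have "group_commutator S y r \<in> Rel R (1 + n)"
      proof -
        have "group_commutator S r y \<in> Rel R (Suc n)"
          using r y Rc \<open>n \<ge> 1\<close> by (simp add: Rel_Suc commutator_in_cstep subset_iff)
        then have "inv (group_commutator S r y) \<in> Rel R (Suc n)"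
          using nn(1)[of "Suc n"] by (simp add: normal_inv_iff subgroup.m_inv_closed)
        then show ?thesis using y rc by (simp add: inv_commutator)
      qed
      then have a: "?a \<in> Rel R (Suc n)" by simp
      have b: "?b \<in> Rel R (m + n)" using Suc.IH[OF \<open>n \<ge> 1\<close> x r] .
      have cc: "?a \<in> carrier S" "?b \<in> carrier S" using xc y rc by auto
      \<comment> \<open>This is the instance of the induction hypothesis with \<open>n\<close>
        raised by one.\<close>
      have "group_commutator S x ?a \<in> ?N" using Suc.IH[of "Suc n" x ?a] a x by simp
      then have xa: "?q x \<otimes>\<^bsub>?Q\<^esub> ?q ?a = ?q ?a \<otimes>\<^bsub>?Q\<^esub> ?q x" using N.commutator_mem_iff xc cc by blast
      have "?q x \<otimes>\<^bsub>?Q\<^esub> ?q y \<otimes>\<^bsub>?Q\<^esub> ?q r \<otimes>\<^bsub>?Q\<^esub> inv\<^bsub>?Q\<^esub> (?q x \<otimes>\<^bsub>?Q\<^esub> ?q y)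
         = ?q y \<otimes>\<^bsub>?Q\<^esub> ?q x \<otimes>\<^bsub>?Q\<^esub> ?q r \<otimes>\<^bsub>?Q\<^esub> inv\<^bsub>?Q\<^esub> (?q y \<otimes>\<^bsub>?Q\<^esub> ?q x)"
        by (rule q.H.conj_swap_of_commute[OF q.hom_closed[OF xc] q.hom_closed[OF y] q.hom_closed[OF rc]
              q.hom_closed[OF cc(1)] q.hom_closed[OF cc(2)] conj[OF xc rc] conj[OF y rc] xa
              central[OF b y, symmetric] central[OF b cc(1), symmetric]])
      then have "group_commutator ?Q (?q x) (?q y) \<otimes>\<^bsub>?Q\<^esub>
          (?q y \<otimes>\<^bsub>?Q\<^esub> ?q x \<otimes>\<^bsub>?Q\<^esub> ?q r \<otimes>\<^bsub>?Q\<^esub> inv\<^bsub>?Q\<^esub> (?q y \<otimes>\<^bsub>?Q\<^esub> ?q x)) =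
          (?q y \<otimes>\<^bsub>?Q\<^esub> ?q x \<otimes>\<^bsub>?Q\<^esub> ?q r \<otimes>\<^bsub>?Q\<^esub> inv\<^bsub>?Q\<^esub> (?q y \<otimes>\<^bsub>?Q\<^esub> ?q x)) \<otimes>\<^bsub>?Q\<^esub>
          group_commutator ?Q (?q x) (?q y)"
        by (intro q.H.commute_commutator q.hom_closed xc y rc)
      moreover have "?q y \<otimes>\<^bsub>?Q\<^esub> ?q x \<otimes>\<^bsub>?Q\<^esub> ?q r \<otimes>\<^bsub>?Q\<^esub> inv\<^bsub>?Q\<^esub> (?q y \<otimes>\<^bsub>?Q\<^esub> ?q x) = ?q r'"
        unfolding r'_eq using xc y rc by (simp del: mult_FactGroup)
      ultimately show ?thesis
        using N.commutator_mem_iff[OF commutator_closed[OF xc y] r'c] by (simp only: q.hom_commutator[OF xc y])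
    qed
    then show "group_commutator S x y \<in> ?C" using xc y by simp
  qed
  then show ?case using Suc.prems(2,3) by auto
qed

lemma pow_Rel:
  assumes R: "R \<lhd> S" "closedin T R" and "n \<ge> 1" "x \<in> Rel R n"
  shows "x [^] p \<in> Rel R (Suc n)"
  using assms Rel_closed_normal[OF R, of n] by (simp add: Rel_Suc pow_in_cstep normal_subset)

lemma commutator_Ser: "\<lbrakk>m \<ge> 1; n \<ge> 1; x \<in> Ser m; y \<in> Ser n\<rbrakk> \<Longrightarrow> group_commutator S x y \<in> Ser (m + n)"
  using commutator_Ser_Rel[OF carrier_normal closedin_carrier] by (simp add: p_series_def)

lemma pow_Ser: "\<lbrakk>n \<ge> 1; x \<in> Ser n\<rbrakk> \<Longrightarrow> x [^] p \<in> Ser (Suc n)"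
  using pow_Rel[OF carrier_normal closedin_carrier] by (simp add: p_series_def)

end

text \<open>The factors \<open>u\<close> and \<open>v\<close> commute with enough to be moved to the
  front and cancelled. In the application they come from the next layers, and the lemma makes the
  bracket independent of representatives.\<close>

lemma (in mgroup) commutator_mult_of_commute:
  assumes c: "x \<in> carrier G" "y \<in> carrier G" "u \<in> carrier G" "v \<in> carrier G"
    and uy: "u \<otimes> y = y \<otimes> u" and vx: "v \<otimes> x = x \<otimes> v" and uv: "u \<otimes> v = v \<otimes> u"
    and uc: "u \<otimes> group_commutator G x y = group_commutator G x y \<otimes> u"
    and vc: "v \<otimes> group_commutator G x y = group_commutator G x y \<otimes> v"
  shows "group_commutator G (u \<otimes> x) (v \<otimes> y) = group_commutator G x y"
proof -
  let ?c = "group_commutator G x y"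
  have cc: "?c \<in> carrier G" using c by simp
  have "?c \<otimes> ((v \<otimes> y) \<otimes> (u \<otimes> x)) = ?c \<otimes> v \<otimes> (y \<otimes> u) \<otimes> x" using c cc by (simp add: m_assoc)
  also have "\<dots> = v \<otimes> (?c \<otimes> u) \<otimes> y \<otimes> x" unfolding uy[symmetric] vc[symmetric] using c cc by (simp add: m_assoc)
  also have "\<dots> = v \<otimes> u \<otimes> (?c \<otimes> (y \<otimes> x))" unfolding uc[symmetric] using c cc by (simp add: m_assoc)
  also have "\<dots> = u \<otimes> (v \<otimes> x) \<otimes> y" unfolding commutator_mult[OF c(1,2)] uv[symmetric] using c by (simp add: m_assoc)
  also have "\<dots> = (u \<otimes> x) \<otimes> (v \<otimes> y)" unfolding vx using c by (simp add: m_assoc)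
  also have "\<dots> = group_commutator G (u \<otimes> x) (v \<otimes> y) \<otimes> ((v \<otimes> y) \<otimes> (u \<otimes> x))"
    using c by (simp add: commutator_mult)
  finally show ?thesis using c cc by simp
qed

section \<open>Separation by the series, and approximation arguments\<close>

context pro_p
begin

text \<open>Evaluates the unions over representatives by which the maps on cosets are
  defined.\<close>

lemma UN_r_coset:
  assumes "subgroup N S" "x \<in> carrier S" "\<And>y. y \<in> N #> x \<Longrightarrow> f y = c"
  shows "(\<Union>y\<in>N #> x. f y) = c"
  using assms rcos_self[of x N] by blast

text \<open>Induction on the index, a power of \<open>p\<close>. If it is not 1, \<open>S/N\<close>
  has a central element of order \<open>p\<close>, so \<open>?N'\<close> is strictly larger than
  \<open>N\<close> and already contains some term of the series. The next term lies in
  \<open>N\<close>, since \<open>p\<close>-th powers of elements of \<open>?N'\<close> and their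
  commutators with \<open>S\<close> lie in \<open>N\<close>.\<close>

lemma Ser_in_open_normal:
  assumes "N \<lhd> S" "openin T N"
  shows "\<exists>n\<ge>1. Ser n \<subseteq> N"
  using assms
proof (induction "card (rcosets N)" arbitrary: N rule: less_induct)
  case less
  interpret N: mnormal N S by (rule mnormalI[OF less.prems(1)])
  interpret q: mgroup_hom S "S Mod N" "\<lambda>x. N #> x" by (rule N.rcos_group_hom)
  let ?Q = "S Mod N" and ?q = "\<lambda>x. N #> x"
  have cl: "closedin T N" using less.prems by (simp add: closedin_open_subgroup normal_imp_subgroup)
  obtain k where k: "card (rcosets N) = p ^ k"
    using pro_p less.prems unfolding pro_p_group_def by blast
  have carQ: "carrier ?Q = rcosets N" by (simp add: FactGroup_def)
  show ?case
  proof (cases "k = 0")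
    case True
    then obtain C where C: "rcosets N = {C}" using k by (auto simp: card_1_singleton_iff)
    have "x \<in> N" if "x \<in> carrier S" for x
    proof -
      have "?q x \<in> rcosets N" "?q \<one> \<in> rcosets N"
        by (rule rcosetsI[OF N.subset that], rule rcosetsI[OF N.subset one_closed])
      then have "?q x = ?q \<one>" unfolding C by blast
      then have "x \<otimes> inv \<one> \<in> N" using N.rcos_eq_iff[OF that one_closed] by blast
      then show ?thesis using that by simp
    qed
    then show ?thesis by (intro exI[of _ 1]) auto
  next
    case False
    then obtain z where z: "z \<in> carrier ?Q" "z \<noteq> \<one>\<^bsub>?Q\<^esub>" "z [^]\<^bsub>?Q\<^esub> p = \<one>\<^bsub>?Q\<^esub>"
      "\<And>y. y \<in> carrier ?Q \<Longrightarrow> z \<otimes>\<^bsub>?Q\<^esub> y = y \<otimes>\<^bsub>?Q\<^esub> z"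
      using q.H.central_element_of_order_p[OF prime_p, of k] k carQ by (metis gr0I)
    obtain w where w: "w \<in> carrier S" "z = ?q w"
      using z(1) unfolding carrier_FactGroup by blast
    \<comment> \<open>\<open>?N'/N\<close> consists of the central elements of \<open>S/N\<close> of exponent \<open>p\<close>.\<close>
    let ?C = "{g \<in> carrier S. \<forall>r\<in>carrier S. group_commutator S g r \<in> N}"
    let ?N' = "{x \<in> ?C. x [^] p \<in> N}"
    have C: "subgroup ?C S" using centralizer_mod_subgroup[OF less.prems(1) cl, of "carrier S"] by simp
    have pow_iff: "x [^] p \<in> N \<longleftrightarrow> ?q x [^]\<^bsub>?Q\<^esub> p = \<one>\<^bsub>?Q\<^esub>" if "x \<in> carrier S" for x
      using that N.FactGroup_pow[OF that, of p] N.rcos_eq_one_iff by simp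
    have sub: "subgroup ?N' S"
    proof (rule subgroupI)
      have "\<one> \<in> ?N'" using subgroup.one_closed[OF C] by simp
      then show "?N' \<noteq> {}" by blast
    next
      fix a assume a: "a \<in> ?N'"
      then have "inv a [^] p = inv (a [^] p)" by (simp add: nat_pow_inv)
      then show "inv a \<in> ?N'" using a subgroup.m_inv_closed[OF C, of a] N.m_inv_closed by auto
    next
      fix a b assume a: "a \<in> ?N'" and b: "b \<in> ?N'"
      then have c: "a \<in> carrier S" "b \<in> carrier S" by auto
      have "?q a \<otimes>\<^bsub>?Q\<^esub> ?q b = ?q b \<otimes>\<^bsub>?Q\<^esub> ?q a" using a c N.commutator_mem_iff by blast
      then have "(?q a \<otimes>\<^bsub>?Q\<^esub> ?q b) [^]\<^bsub>?Q\<^esub> p = ?q a [^]\<^bsub>?Q\<^esub> p \<otimes>\<^bsub>?Q\<^esub> ?q b [^]\<^bsub>?Q\<^esub> p"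
        using q.hom_closed c by (intro q.H.pow_mult_distrib) auto
      also have "\<dots> = \<one>\<^bsub>?Q\<^esub>" using pow_iff[OF c(1)] pow_iff[OF c(2)] a b q.H.l_one[OF q.H.one_closed] by simp
      finally have "(a \<otimes> b) [^] p \<in> N" using pow_iff[of "a \<otimes> b"] c q.hom_mult[OF c] by simp
      then show "a \<otimes> b \<in> ?N'" using a b subgroup.m_closed[OF C, of a b] by auto
    qed auto
    have NN': "N \<subseteq> ?N'"
      using commutator_mem_normal[OF less.prems(1)] N.mem_carrier cstep_subset[OF less.prems(1) cl]
        pow_in_cstep[OF N.subset] by auto
    have "?N' \<lhd> S"
      unfolding normal_inv_iff
    proof (intro conjI ballI sub)
      fix x h assume x: "x \<in> carrier S" and h: "h \<in> ?N'"
      have hc: "h \<in> carrier S" using h by simp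
      have "group_commutator S h x \<in> N" using x h by blast
      then have "inv (group_commutator S h x) \<in> N" by (rule N.m_inv_closed)
      then have "group_commutator S x h \<in> ?N'" using NN' x hc by (auto simp: inv_commutator)
      then show "x \<otimes> h \<otimes> inv x \<in> ?N'"
        using subgroup.m_closed[OF sub _ h] conj_eq_commutator_mult[OF x hc] by simp
    qed
    moreover have "openin T ?N'"
      using openin_subgroup[OF sub less.prems(2) _ NN'] by simp
    moreover have "card (rcosets ?N') < card (rcosets N)"
    proof -
      \<comment> \<open>The projection from the cosets of \<open>N\<close> to those of
        \<open>?N'\<close> is surjective but not injective, as it identifies the cosets of
        \<open>w\<close> and \<open>\<one>\<close>; so the index drops.\<close>
      define f where "f = (\<lambda>C. \<Union>y\<in>C. ?N' #> y)"
      have f: "f (?q x) = ?N' #> x" if "x \<in> carrier S" for x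
        unfolding f_def
      proof (rule UN_r_coset[OF N.subgroup_axioms that])
        fix y assume "y \<in> N #> x"
        then have "y \<in> ?N' #> x" using NN' unfolding r_coset_def by blast
        then show "?N' #> y = ?N' #> x" using repr_independence[OF _ that sub] by simp
      qed
      have fin: "finite (rcosets N)" using k prime_p by (metis card.infinite not_prime_0 power_not_zero)
      have im: "f ` (rcosets N) = rcosets ?N'"
        unfolding RCOSETS_def using f by auto
      have wN': "w \<in> ?N'"
      proof -
        have "group_commutator S w y \<in> N" if "y \<in> carrier S" for y
          using N.commutator_mem_iff[OF w(1) that] z(4)[OF q.hom_closed[OF that]] w(2) by blast
        then show ?thesis using w z(3) pow_iff[OF w(1)] by simp
      qed
      have "f (?q w) = f (?q \<one>)"
        using f[OF w(1)] f[OF one_closed] coset_join2[OF w(1) sub wN'] subgroup.subset[OF sub]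
        by (simp add: coset_mult_one)
      moreover have "?q w \<noteq> ?q \<one>" using z(2) w N.subset by (simp add: coset_mult_one)
      moreover have "?q w \<in> rcosets N" "?q \<one> \<in> rcosets N"
        by (rule rcosetsI[OF N.subset w(1)], rule rcosetsI[OF N.subset one_closed])
      ultimately have "\<not> inj_on f (rcosets N)" unfolding inj_on_def by blast
      then have "card (f ` (rcosets N)) \<noteq> card (rcosets N)" using eq_card_imp_inj_on[OF fin] by blast
      then show ?thesis using card_image_le[OF fin, of f] im by simp
    qed
    ultimately obtain n where n: "n \<ge> 1" "Ser n \<subseteq> ?N'" using less.hyps by blast
    have "Ser (Suc n) \<subseteq> N"
      unfolding Ser_Suc[OF n(1)] using n(2) cl by (intro cstep_minimal N.subgroup_axioms) auto
    then show ?thesis using n(1) by (intro exI[of _ "Suc n"]) auto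
  qed
qed

text \<open>Outside a closed set, \<open>x\<close> is separated from it by an open normal subgroup,
  which contains some \<open>Ser n\<close>. This passes from approximations of every order to
  membership.\<close>

lemma mem_closed_of_Ser:
  assumes "closedin T M" "x \<in> carrier S" "\<And>n. n \<ge> 1 \<Longrightarrow> x \<in> M <#> Ser n"
  shows "x \<in> M"
proof (rule ccontr)
  assume "x \<notin> M"
  then obtain N where N: "N \<lhd> S" "openin T N" "x \<notin> M <#> N"
    using open_normal_separates assms(1,2) by blast
  obtain n where "n \<ge> 1" "Ser n \<subseteq> N" using Ser_in_open_normal[OF N(1,2)] by blast
  then show False using assms(3)[of n] N(3) by (auto simp: set_mult_def)
qed

lemma Rel_subset_Ser:
  assumes "R \<subseteq> carrier S" "n \<ge> 1"
  shows "Rel R n \<subseteq> Ser n"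
  using assms(2)
proof (induction n rule: nat_induct_at_least)
  case (Suc n)
  then show ?case using cstep_mono[OF Suc.IH] by (simp add: Rel_Suc Ser_Suc normal_subset[OF Ser_normal])
qed (use assms in simp)

text \<open>Monotonicity of the central step carries \<open>R \<subseteq> Ser 2\<close> upwards;
  this is the origin of the degree shift in \<open>iota\<close>.\<close>

lemma Rel_subset_Ser_Suc:
  assumes "R \<subseteq> Ser 2" "n \<ge> 1"
  shows "Rel R n \<subseteq> Ser (Suc n)"
  using assms(2)
proof (induction n rule: nat_induct_at_least)
  case (Suc n)
  then show ?case using cstep_mono[OF Suc.IH] by (simp add: Rel_Suc Ser_Suc[of "Suc n"] normal_subset[OF Ser_normal])
qed (use assms in \<open>simp add: numeral_2_eq_2\<close>)

text \<open>A Frattini argument with \<open>Rel R 2\<close> in the role of the Frattini subgroup. If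
  \<open>R\<close> is contained in \<open>M <#> Rel R n\<close>, then modulo \<open>M\<close> the
  generators of \<open>Rel R 2\<close> are powers and commutators of elements of
  \<open>Rel R n\<close>, so \<open>Rel R 2\<close> is contained in
  \<open>M <#> Rel R (Suc n)\<close>, and by \<open>gen\<close> so is \<open>R\<close>. The
  separation property finishes the proof.\<close>

lemma normal_generation_mod_Rel:
  assumes R: "R \<lhd> S" "closedin T R" and M: "M \<lhd> S" "closedin T M" "M \<subseteq> R"
    and gen: "R \<subseteq> M <#> Rel R 2"
  shows "M = R"
proof
  show "R \<subseteq> M"
  proof
    fix x assume x: "x \<in> R"
    interpret M: mnormal M S by (rule mnormalI[OF M(1)])
    interpret q: mgroup_hom S "S Mod M" "\<lambda>x. M #> x" by (rule M.rcos_group_hom)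
    note nn = Rel_closed_normal[OF R]
    have "R \<subseteq> M <#> Rel R n" if "n \<ge> 1" for n
      using that
    proof (induction n rule: nat_induct_at_least)
      case base
      then show ?case using closed_subgroup_mult(4)[OF M(1,2)] R by (simp add: normal_imp_subgroup)
    next
      case (Suc n)
      let ?H = "M <#> Rel R (Suc n)"
      have H: "subgroup ?H S" "closedin T ?H" "M \<subseteq> ?H" "Rel R (Suc n) \<subseteq> ?H"
        using closed_subgroup_mult[OF M(1,2), of "Rel R (Suc n)"] nn[of "Suc n"] by (auto simp: normal_imp_subgroup)
      have same: "a \<in> ?H" if "M #> a = M #> b" "a \<in> carrier S" "b \<in> carrier S" "b \<in> Rel R (Suc n)" for a b
      proof -
        have "a \<otimes> inv b \<in> M" using that M.rcos_eq_iff by blast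
        then have "(a \<otimes> inv b) \<otimes> b \<in> ?H" using that by (auto simp: set_mult_def)
        then show ?thesis using that by (simp add: m_assoc)
      qed
      \<comment> \<open>Modulo \<open>M\<close>, each element of \<open>R\<close> may be replaced by
        one of \<open>Rel R n\<close>.\<close>
      have dec: "\<exists>r\<in>Rel R n. M #> x = M #> r \<and> r \<in> carrier S \<and> x \<in> carrier S" if xR: "x \<in> R" for x
      proof -
        obtain m r where mr: "m \<in> M" "r \<in> Rel R n" "x = m \<otimes> r"
          using subsetD[OF Suc.IH xR] by (auto simp: set_mult_def)
        then have c: "m \<in> carrier S" "r \<in> carrier S"
          using nn[of n] M.mem_carrier normal_mem by blast+
        have "M #> x = M #> r" using M.rcos_eq_iff[of x r] mr c by (simp add: m_assoc)
        then show ?thesis using mr c by blast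
      qed
      have "Rel R 2 \<subseteq> ?H"
        unfolding numeral_2_eq_2 Rel_Suc[OF order_refl] One_nat_def[symmetric]
        unfolding One_nat_def Rel_1
      proof (rule cstep_minimal[OF H(1,2)])
        fix x assume "x \<in> R"
        then obtain r where r: "r \<in> Rel R n" "M #> x = M #> r" "r \<in> carrier S" "x \<in> carrier S"
          using dec by blast
        have "M #> (x [^] p) = M #> (r [^] p)"
          using M.FactGroup_pow[OF r(3), of p] M.FactGroup_pow[OF r(4), of p] r(2) by simp
        then show "x [^] p \<in> ?H" using same pow_Rel[OF R Suc.hyps r(1)] r by simp
        fix y assume y: "y \<in> carrier S"
        have "M #> group_commutator S x y = M #> group_commutator S r y"
          unfolding q.hom_commutator[OF r(3) y] q.hom_commutator[OF r(4) y] r(2) ..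
        moreover have "group_commutator S r y \<in> Rel R (Suc n)"
          using commutator_in_cstep[of "Rel R n" r y] nn[of n] Suc.hyps r(1) y by (simp add: Rel_Suc normal_subset)
        ultimately show "group_commutator S x y \<in> ?H" using same y r by simp
      qed
      have "M <#> Rel R 2 \<subseteq> ?H"
      proof
        fix z assume "z \<in> M <#> Rel R 2"
        then obtain m r where "m \<in> M" "r \<in> Rel R 2" "z = m \<otimes> r" unfolding set_mult_def by blast
        then show "z \<in> ?H" using \<open>Rel R 2 \<subseteq> ?H\<close> H(3) subgroup.m_closed[OF H(1)] by blast
      qed
      then show ?case using gen by blast
    qed
    then have "x \<in> M <#> Ser n" if "n \<ge> 1" for n
      using that x Rel_subset_Ser[OF normal_subset[OF R(1)] that] mono_set_mult[of M M "Rel R n" "Ser n" S] by blast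
    then show "x \<in> M" using mem_closed_of_Ser[OF M(2)] x normal_mem[OF R(1)] by blast
  qed
qed (use M in simp)

lemma Ser_Int_eq_Rel:
  assumes R: "R \<lhd> S" "closedin T R" and R2: "R \<subseteq> Ser 2"
    and step: "\<And>n. n \<ge> 1 \<Longrightarrow> R \<inter> Ser (n + 1) \<subseteq> Rel R n <#> (R \<inter> Ser (n + 2))"
    and n: "n \<ge> 1"
  shows "R \<inter> Ser (n + 1) = Rel R n"
proof
  note nn = Rel_closed_normal[OF R]
  have sub: "subgroup (Rel R n) S" using nn by (simp add: normal_imp_subgroup)
  show "R \<inter> Ser (n + 1) \<subseteq> Rel R n"
  proof
    fix x assume x: "x \<in> R \<inter> Ser (n + 1)"
    \<comment> \<open>Telescoping: \<open>step\<close> at index \<open>n + k\<close> splits the last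
      factor, and the new factor from \<open>Rel R (n + k)\<close> is absorbed into
      \<open>Rel R n\<close>.\<close>
    have *: "R \<inter> Ser (n + 1) \<subseteq> Rel R n <#> (R \<inter> Ser (n + 1 + k))" for k
    proof (induction k)
      case 0
      have "y = \<one> \<otimes> y" if "y \<in> R" for y using that normal_mem[OF R(1)] by simp
      then show ?case using subgroup.one_closed[OF sub] by (fastforce simp: set_mult_def)
    next
      case (Suc k)
      show ?case
      proof
        fix y assume "y \<in> R \<inter> Ser (n + 1)"
        then obtain a b where ab: "a \<in> Rel R n" "b \<in> R \<inter> Ser (n + 1 + k)" "y = a \<otimes> b"
          using subsetD[OF Suc] unfolding set_mult_def by blast
        then obtain c d where cd: "c \<in> Rel R (n + k)" "d \<in> R \<inter> Ser (n + k + 2)" "b = c \<otimes> d"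
          using subsetD[OF step[of "n + k"], of b] n unfolding set_mult_def by (auto simp: add_ac)
        have cn: "c \<in> Rel R n" using cd Rel_antimono[OF R, of n "n + k"] by auto
        have "y = (a \<otimes> c) \<otimes> d" using ab cd cn subgroup.mem_carrier[OF sub] by (auto simp: m_assoc)
        moreover have "a \<otimes> c \<in> Rel R n" using ab cn subgroup.m_closed[OF sub] by blast
        ultimately show "y \<in> Rel R n <#> (R \<inter> Ser (n + 1 + Suc k))"
          using cd by (auto simp: set_mult_def)
      qed
    qed
    have "x \<in> Rel R n <#> Ser k" if "k \<ge> 1" for k
    proof -
      have "x \<in> Rel R n <#> (R \<inter> Ser (n + 1 + k))" using * x by blast
      moreover have "R \<inter> Ser (n + 1 + k) \<subseteq> Ser k" using Ser_antimono[of k "n + 1 + k"] by auto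
      ultimately show ?thesis using mono_set_mult[of "Rel R n" "Rel R n" _ "Ser k" S] by blast
    qed
    then show "x \<in> Rel R n" using mem_closed_of_Ser[of "Rel R n" x] nn x by auto
  qed
  show "Rel R n \<subseteq> R \<inter> Ser (n + 1)"
    using Rel_antimono[OF R n] Rel_subset_Ser_Suc[OF R2 n] by simp
qed

end

section \<open>Independence of representatives, and finiteness of the layers\<close>

context pro_p
begin

text \<open>Modulo \<open>Ser (n + 2)\<close> the factor \<open>u\<close> commutes with
  \<open>x\<close> and has exponent \<open>p\<close>. This does not make the power map additive,
  which for \<open>p = 2\<close> can fail in degree 1.\<close>

lemma pow_coset_Ser:
  assumes "n \<ge> 1" "x \<in> Ser n" "u \<in> Ser (Suc n)"
  shows "Ser (n + 2) #> ((u \<otimes> x) [^] p) = Ser (n + 2) #> (x [^] p)"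
proof -
  let ?N = "Ser (n + 2)"
  interpret N: mnormal ?N S by (rule mnormalI[OF Ser_normal])
  interpret q: mgroup_hom S "S Mod ?N" "\<lambda>x. ?N #> x" by (rule N.rcos_group_hom)
  have c: "x \<in> carrier S" "u \<in> carrier S" using assms by simp_all
  have "group_commutator S u x \<in> Ser (Suc n + 1)"
    using commutator_Ser[of "Suc n" 1 u x] assms by simp
  then have "(?N #> u) \<otimes>\<^bsub>S Mod ?N\<^esub> (?N #> x) = (?N #> x) \<otimes>\<^bsub>S Mod ?N\<^esub> (?N #> u)"
    using N.commutator_mem_iff c by simp
  then have "((?N #> u) \<otimes>\<^bsub>S Mod ?N\<^esub> (?N #> x)) [^]\<^bsub>S Mod ?N\<^esub> p
      = (?N #> u) [^]\<^bsub>S Mod ?N\<^esub> p \<otimes>\<^bsub>S Mod ?N\<^esub> (?N #> x) [^]\<^bsub>S Mod ?N\<^esub> p"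
    using q.hom_closed c by (intro q.H.pow_mult_distrib) auto
  moreover have "(?N #> u) [^]\<^bsub>S Mod ?N\<^esub> p = \<one>\<^bsub>S Mod ?N\<^esub>"
    unfolding N.FactGroup_pow[OF c(2)] using pow_Ser[of "Suc n" u] assms c N.rcos_eq_one_iff[of "u [^] p"] by simp
  moreover have "(?N #> u) \<otimes>\<^bsub>S Mod ?N\<^esub> (?N #> x) = ?N #> (u \<otimes> x)"
    using q.hom_mult c by simp
  ultimately have "?N #> ((u \<otimes> x) [^] p) = \<one>\<^bsub>S Mod ?N\<^esub> \<otimes>\<^bsub>S Mod ?N\<^esub> (?N #> (x [^] p))"
    using N.FactGroup_pow[OF c(1), of p] N.FactGroup_pow[of "u \<otimes> x" p] c by simp
  then show ?thesis
    using q.H.l_one q.hom_closed c by (metis nat_pow_closed)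
qed

text \<open>Each commutation demanded by \<open>commutator_mult_of_commute\<close> is between terms
  of the series whose indices add up to at least \<open>m + n + 1\<close>.\<close>

lemma commutator_coset_Ser:
  assumes mn: "m \<ge> 1" "n \<ge> 1" and x: "x \<in> Ser m" "u \<in> Ser (Suc m)" and y: "y \<in> Ser n" "v \<in> Ser (Suc n)"
  shows "Ser (m + n + 1) #> group_commutator S (u \<otimes> x) (v \<otimes> y) = Ser (m + n + 1) #> group_commutator S x y"
proof -
  let ?N = "Ser (m + n + 1)"
  interpret N: mnormal ?N S by (rule mnormalI[OF Ser_normal])
  interpret q: mgroup_hom S "S Mod ?N" "\<lambda>x. ?N #> x" by (rule N.rcos_group_hom)
  let ?Q = "S Mod ?N" and ?q = "\<lambda>x. ?N #> x"
  let ?c = "group_commutator S x y"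
  have c: "x \<in> carrier S" "u \<in> carrier S" "y \<in> carrier S" "v \<in> carrier S" using x y by simp_all
  have com: "?q a \<otimes>\<^bsub>?Q\<^esub> ?q b = ?q b \<otimes>\<^bsub>?Q\<^esub> ?q a"
    if "a \<in> Ser i" "b \<in> Ser j" "i \<ge> 1" "j \<ge> 1" "m + n + 1 \<le> i + j" for a b i j
    using commutator_Ser[of i j a b] that Ser_antimono[of "m + n + 1" "i + j"] N.commutator_mem_iff[of a b]
      Ser_mem[OF that(1)] Ser_mem[OF that(2)] by blast
  have cS: "?c \<in> Ser (m + n)" using commutator_Ser mn x y by blast
  have "group_commutator ?Q (?q u \<otimes>\<^bsub>?Q\<^esub> ?q x) (?q v \<otimes>\<^bsub>?Q\<^esub> ?q y) = group_commutator ?Q (?q x) (?q y)"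
    unfolding q.hom_commutator[OF c(1,3), symmetric]
  proof (subst q.H.commutator_mult_of_commute)
    show "?q u \<otimes>\<^bsub>?Q\<^esub> ?q y = ?q y \<otimes>\<^bsub>?Q\<^esub> ?q u" using com[OF x(2) y(1)] mn by simp
    show "?q v \<otimes>\<^bsub>?Q\<^esub> ?q x = ?q x \<otimes>\<^bsub>?Q\<^esub> ?q v" using com[OF y(2) x(1)] mn by simp
    show "?q u \<otimes>\<^bsub>?Q\<^esub> ?q v = ?q v \<otimes>\<^bsub>?Q\<^esub> ?q u" using com[OF x(2) y(2)] mn by simp
    show "?q u \<otimes>\<^bsub>?Q\<^esub> group_commutator ?Q (?q x) (?q y) = group_commutator ?Q (?q x) (?q y) \<otimes>\<^bsub>?Q\<^esub> ?q u"
      unfolding q.hom_commutator[OF c(1,3), symmetric] using com[OF x(2) cS] mn by simp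
    show "?q v \<otimes>\<^bsub>?Q\<^esub> group_commutator ?Q (?q x) (?q y) = group_commutator ?Q (?q x) (?q y) \<otimes>\<^bsub>?Q\<^esub> ?q v"
      unfolding q.hom_commutator[OF c(1,3), symmetric] using com[OF y(2) cS] mn by simp
  qed (use c q.hom_closed q.hom_commutator in auto)
  then show ?thesis
    using c q.hom_commutator q.hom_mult by (metis m_closed)
qed

text \<open>The hypotheses make \<open>K/N\<close> central of exponent \<open>p\<close> in
  \<open>S/N\<close>. Adjoining one element to a finite union of cosets then multiplies the list of
  representatives by the powers with exponents \<open>0\<close> to \<open>p - 1\<close>, and the
  result stays a subgroup because the old one is normal.\<close>

lemma finite_adjoin:
  assumes N: "N \<lhd> S" "closedin T N" and K: "subgroup K S" "N \<subseteq> K"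
    and pw: "\<And>x. x \<in> K \<Longrightarrow> x [^] p \<in> N"
    and cm: "\<And>x y. x \<in> K \<Longrightarrow> y \<in> carrier S \<Longrightarrow> group_commutator S x y \<in> N"
    and X: "finite X" "X \<subseteq> K"
  shows "\<exists>A F. subgroup A S \<and> N \<subseteq> A \<and> X \<subseteq> A \<and> A \<subseteq> K \<and> finite F \<and> F \<subseteq> A \<and> A = (\<Union>f\<in>F. N #> f)"
  using X
proof (induction X rule: finite_induct)
  case empty
  have "subgroup N S" using N by (simp add: normal_imp_subgroup)
  moreover have "N = (\<Union>f\<in>{\<one>}. N #> f)" using normal_subset[OF N(1)] by simp
  ultimately show ?case using K subgroup.one_closed by (intro exI[of _ N] exI[of _ "{\<one>}"]) auto
next
  case (insert x X)
  then obtain A F where A: "subgroup A S" "N \<subseteq> A" "X \<subseteq> A" "A \<subseteq> K" "finite F" "F \<subseteq> A" "A = (\<Union>f\<in>F. N #> f)"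
    by auto
  have x: "x \<in> K" "x \<in> carrier S" using insert.prems subgroup.mem_carrier[OF K(1)] by auto
  have "A \<lhd> S"
    unfolding normal_inv_iff
  proof (intro conjI ballI A(1))
    fix g h assume g: "g \<in> carrier S" and h: "h \<in> A"
    have hc: "h \<in> carrier S" using h subgroup.mem_carrier[OF A(1)] by blast
    have "group_commutator S h g \<in> A" using cm g h A by blast
    then have "inv (group_commutator S h g) \<in> A" using subgroup.m_inv_closed[OF A(1)] by blast
    then show "g \<otimes> h \<otimes> inv g \<in> A"
      using subgroup.m_closed[OF A(1) _ h] conj_eq_commutator_mult[OF g hc] inv_commutator[OF hc g] by simp
  qed
  let ?A = "A <#> generate S {x}"
  have gen: "generate S {x} = {x [^] (k::int) | k. k \<in> UNIV}" using generate_pow[OF x(2)] .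
  have gs: "subgroup (generate S {x}) S" using x by (intro generate_is_subgroup) simp
  have A': "subgroup ?A S" using mult_norm_subgroup[OF \<open>A \<lhd> S\<close> gs] .
  have AA': "A \<subseteq> ?A"
  proof
    fix a assume "a \<in> A"
    moreover have "a = a \<otimes> \<one>" using subgroup.mem_carrier[OF A(1) \<open>a \<in> A\<close>] by simp
    ultimately show "a \<in> ?A" using generate.one by (auto simp: set_mult_def)
  qed
  have xA': "x \<in> ?A"
  proof -
    have "x = \<one> \<otimes> x" using x by simp
    then show ?thesis using subgroup.one_closed[OF A(1)] generate.incl[of x "{x}" S] by (auto simp: set_mult_def)
  qed
  have A'K: "?A \<subseteq> K"
    using generate_subgroup_incl[of "{x}" K] x(1) K(1) A(4) subgroup.m_closed[OF K(1)]
    by (auto simp: set_mult_def)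
  let ?F = "(\<lambda>(f, i). f \<otimes> x [^] i) ` (F \<times> {0..<int p})"
  have FA': "?F \<subseteq> ?A" using A(6) gen by (auto simp: set_mult_def)
  moreover have "?A = (\<Union>f\<in>?F. N #> f)"
  proof
    show "(\<Union>f\<in>?F. N #> f) \<subseteq> ?A"
    proof
      fix z assume "z \<in> (\<Union>f\<in>?F. N #> f)"
      then obtain n f where "f \<in> ?F" "n \<in> N" "z = n \<otimes> f" unfolding r_coset_def by blast
      then show "z \<in> ?A" using FA' A(2) AA' subgroup.m_closed[OF A'] by blast
    qed
    show "?A \<subseteq> (\<Union>f\<in>?F. N #> f)"
    proof
      fix z assume "z \<in> ?A"
      then obtain a i where ai: "a \<in> A" "z = a \<otimes> x [^] (i::int)" using gen by (auto simp: set_mult_def)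
      have ac: "a \<in> carrier S" using ai subgroup.mem_carrier[OF A(1)] by blast
      \<comment> \<open>Division of the exponent by \<open>p\<close>: the part divisible by
        \<open>p\<close> is a power of \<open>x [^] p\<close>, which lies in \<open>N\<close>, and
        is absorbed by \<open>A\<close>.\<close>
      let ?b = "(x [^] int p) [^] (i div int p)"
      have "x [^] int p \<in> A" using pw[OF x(1)] A(2) by (auto simp: int_pow_int)
      then have b: "?b \<in> A" using A(1) by (rule subgroup_int_pow_closed[rotated])
      have bc: "?b \<in> carrier S" using b subgroup.mem_carrier[OF A(1)] by blast
      have "x [^] i = x [^] (int p * (i div int p) + i mod int p)" by simp
      also have "\<dots> = ?b \<otimes> x [^] (i mod int p)"
        using x by (simp only: int_pow_mult int_pow_pow)
      finally have "z = (a \<otimes> ?b) \<otimes> x [^] (i mod int p)" using ai ac bc x by (simp add: m_assoc)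
      moreover have "a \<otimes> ?b \<in> A" using subgroup.m_closed[OF A(1) ai(1) b] .
      then obtain f n where f: "f \<in> F" "n \<in> N" "a \<otimes> ?b = n \<otimes> f" using A(7) by (auto simp: r_coset_def)
      moreover have "f \<in> carrier S" "n \<in> carrier S"
        using f A(6) subgroup.mem_carrier[OF A(1)] normal_mem[OF N(1)] by auto
      ultimately have "z = n \<otimes> (f \<otimes> x [^] (i mod int p))" using x by (simp add: m_assoc)
      moreover have "i mod int p \<in> {0..<int p}" using prime_gt_0_nat[OF prime_p] by simp
      then have "f \<otimes> x [^] (i mod int p) \<in> ?F" using f(1) by (auto intro!: rev_image_eqI[of "(f, i mod int p)"])
      ultimately show "z \<in> (\<Union>f\<in>?F. N #> f)" using f(2) unfolding r_coset_def by blast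
    qed
  qed
  ultimately show ?case
    using A' A(2,3,5) AA' xA' A'K by (intro exI[of _ ?A] exI[of _ ?F]) auto
qed

lemma closedin_finite_cosets:
  assumes "closedin T N" "finite F" "F \<subseteq> carrier S" "A = (\<Union>f\<in>F. N #> f)"
  shows "closedin T A"
  using assms closedin_r_coset by (auto intro!: closedin_Union)

text \<open>Finiteness of a layer is expressed by representatives because it serves to write
  subgroups as finite unions of closed cosets.\<close>

definition fin_quot :: "nat \<Rightarrow> bool" where
  "fin_quot n \<longleftrightarrow> (\<exists>F. finite F \<and> F \<subseteq> Ser n \<and> Ser n = (\<Union>f\<in>F. Ser (Suc n) #> f))"

text \<open>Modulo \<open>Ser (Suc (Suc n))\<close>, a \<open>p\<close>-th power depends only on the
  class of its base modulo \<open>Ser (Suc n)\<close>, and a commutator only on that class and the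
  class of the second argument modulo \<open>Ser 2\<close>. So \<open>?Y\<close> represents all
  generators of the next term. The subgroup built from \<open>?Y\<close> is closed, hence contains
  everything they generate topologically.\<close>

lemma fin_quot_Suc:
  assumes 1: "fin_quot 1" and n: "n \<ge> 1" "fin_quot n"
  shows "fin_quot (Suc n)"
proof -
  obtain X where X: "finite X" "X \<subseteq> carrier S" "carrier S = (\<Union>f\<in>X. Ser 2 #> f)"
    using 1 unfolding fin_quot_def by (auto simp: numeral_2_eq_2)
  obtain F where F: "finite F" "F \<subseteq> Ser n" "Ser n = (\<Union>f\<in>F. Ser (Suc n) #> f)"
    using n unfolding fin_quot_def by blast
  let ?Y = "(\<lambda>f. f [^] p) ` F \<union> (\<lambda>(f, x). group_commutator S f x) ` (F \<times> X)"
  have "\<exists>A E. subgroup A S \<and> Ser (Suc (Suc n)) \<subseteq> A \<and> ?Y \<subseteq> A \<and> A \<subseteq> Ser (Suc n) \<and> finite E \<and> E \<subseteq> A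
     \<and> A = (\<Union>f\<in>E. Ser (Suc (Suc n)) #> f)"
  proof (rule finite_adjoin[OF Ser_normal Ser_closed Ser_subgroup])
    show "Ser (Suc (Suc n)) \<subseteq> Ser (Suc n)" by (rule Ser_antimono) simp
    show "x [^] p \<in> Ser (Suc (Suc n))" if "x \<in> Ser (Suc n)" for x using pow_Ser that by simp
    show "group_commutator S x y \<in> Ser (Suc (Suc n))" if "x \<in> Ser (Suc n)" "y \<in> carrier S" for x y
      using commutator_Ser[of "Suc n" 1 x y] that by simp
    show "finite ?Y" using X F by simp
    show "?Y \<subseteq> Ser (Suc n)"
      using F(2) X(2) pow_Ser[OF n(1)] commutator_Ser[OF n(1), of 1] by (auto simp: subset_iff)
  qed
  then obtain A E where A: "subgroup A S" "Ser (Suc (Suc n)) \<subseteq> A" "?Y \<subseteq> A" "A \<subseteq> Ser (Suc n)"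
    "finite E" "E \<subseteq> A" "A = (\<Union>f\<in>E. Ser (Suc (Suc n)) #> f)"
    by (elim exE conjE) (rule that)
  have Acl: "closedin T A"
    by (rule closedin_finite_cosets[OF Ser_closed A(5) order_trans[OF A(6) subgroup.subset[OF A(1)]] A(7)])
  interpret N: mnormal "Ser (Suc (Suc n))" S by (rule mnormalI[OF Ser_normal])
  have same: "a \<in> A" if "Ser (Suc (Suc n)) #> a = Ser (Suc (Suc n)) #> b" "b \<in> A" "a \<in> carrier S" for a b
  proof -
    have bc: "b \<in> carrier S" using that subgroup.mem_carrier[OF A(1)] by blast
    then have "a \<otimes> inv b \<in> A" using that N.rcos_eq_iff A(2) by blast
    then have "(a \<otimes> inv b) \<otimes> b \<in> A" using that subgroup.m_closed[OF A(1)] by blast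
    then show ?thesis using that bc by (simp add: m_assoc)
  qed
  have "Ser (Suc n) \<subseteq> A"
    unfolding Ser_Suc[OF n(1)]
  proof (rule cstep_minimal[OF A(1) Acl])
    fix y assume y: "y \<in> Ser n"
    then obtain u f where u: "f \<in> F" "u \<in> Ser (Suc n)" "y = u \<otimes> f" using F(3) by (auto simp: r_coset_def)
    have f: "f \<in> Ser n" using u F by auto
    have "Ser (Suc (Suc n)) #> (y [^] p) = Ser (Suc (Suc n)) #> (f [^] p)"
      using pow_coset_Ser[OF n(1) f u(2)] u(3) by simp
    then show "y [^] p \<in> A" using same A(3) u(1) y by auto
    fix s assume s: "s \<in> carrier S"
    then obtain v x where v: "x \<in> X" "v \<in> Ser 2" "s = v \<otimes> x" using X(3) by (auto simp: r_coset_def)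
    have "Ser (Suc (Suc n)) #> group_commutator S y s = Ser (Suc (Suc n)) #> group_commutator S f x"
      using commutator_coset_Ser[OF n(1) le_refl f u(2), of x v] u(3) v X(2) by (auto simp: numeral_2_eq_2)
    then show "group_commutator S y s \<in> A" using same A(3) u(1) v(1) y s by auto
  qed
  then have "Ser (Suc n) = A" using A(4) by (rule equalityI)
  then show ?thesis unfolding fin_quot_def using A(5-7) by blast
qed

lemma fin_quot_all:
  assumes "fin_quot 1" "n \<ge> 1"
  shows "fin_quot n"
  using assms(2)
  by (induction n rule: nat_induct_at_least) (use assms(1) fin_quot_Suc in auto)

text \<open>The representatives that lie in \<open>A\<close> describe \<open>A\<close> as a finite
  union of cosets of a closed subgroup. This lets algebraically defined subgroups enter arguments by
  \<open>cstep_minimal\<close>.\<close>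

lemma closedin_between_Ser:
  assumes fin: "fin_quot n" and A: "subgroup A S" "Ser (Suc n) \<subseteq> A" "A \<subseteq> Ser n"
  shows "closedin T A"
proof -
  obtain F where F: "finite F" "F \<subseteq> Ser n" "Ser n = (\<Union>f\<in>F. Ser (Suc n) #> f)"
    using fin unfolding fin_quot_def by blast
  let ?F = "F \<inter> A"
  have "A = (\<Union>f\<in>?F. Ser (Suc n) #> f)"
  proof
    show "(\<Union>f\<in>?F. Ser (Suc n) #> f) \<subseteq> A"
      using A(2) subgroup.m_closed[OF A(1)] by (auto simp: r_coset_def)
    show "A \<subseteq> (\<Union>f\<in>?F. Ser (Suc n) #> f)"
    proof
      fix a assume a: "a \<in> A"
      then have "a \<in> Ser n" using A(3) by blast
      then obtain u f where u: "f \<in> F" "u \<in> Ser (Suc n)" "a = u \<otimes> f" using F(3) by (auto simp: r_coset_def)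
      have "inv u \<otimes> a \<in> A" using u A(2) a subgroup.m_closed[OF A(1)] subgroup.m_inv_closed[OF A(1)] by blast
      moreover have "inv u \<otimes> a = f" using u F(2) by auto
      ultimately show "a \<in> (\<Union>f\<in>?F. Ser (Suc n) #> f)" using u by (auto simp: r_coset_def)
    qed
  qed
  then show ?thesis using F(1,2) by (intro closedin_finite_cosets[OF Ser_closed, of ?F]) auto
qed

end

section \<open>Finite test groups for the universal property\<close>

lemma pro_p_group_finite_discrete:
  assumes p: "Factorial_Ring.prime p" and H: "group H" and card: "card (carrier H) = p ^ k"
  shows "pro_p_group p H (discrete_topology (carrier H))"
proof -
  interpret H: group H by (rule H)
  have fin: "finite (carrier H)" using card p by (metis card.infinite not_prime_0 power_not_zero)
  have "topological_group H (discrete_topology (carrier H))"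
    unfolding topological_group_def
    by (simp add: H prod_topology_discrete_topology[symmetric] Pi_iff)
  moreover have "totally_disconnected_space (discrete_topology (carrier H))"
    unfolding totally_disconnected_space_def by (auto simp: connectedin_discrete_topology)
  ultimately have "profinite_group H (discrete_topology (carrier H))"
    unfolding profinite_group_def using fin
    by (simp add: compact_space_discrete_topology Hausdorff_space_discrete_topology)
  moreover have "\<exists>k. card (rcosets\<^bsub>H\<^esub> N) = p ^ k" if "N \<lhd> H" for N
  proof -
    have "card (rcosets\<^bsub>H\<^esub> N) * card N = p ^ k"
      using H.lagrange[OF normal_imp_subgroup[OF that]] card by (simp add: order_def)
    then have "card (rcosets\<^bsub>H\<^esub> N) dvd p ^ k" by (metis dvd_triv_left)
    then show ?thesis using divides_primepow_nat[OF p] by blast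
  qed
  ultimately show ?thesis unfolding pro_p_group_def by blast
qed

text \<open>The universal property speaks of groups whose elements are reals, so a finite quotient
  of \<open>S\<close> must be transported to that type.\<close>

lemma real_copy_of_finite_group:
  assumes Q: "group Q" and fin: "finite (carrier Q)"
  obtains H :: "real monoid" and g where "group H" "bij_betw g (carrier Q) (carrier H)" "g \<in> hom Q H"
proof -
  interpret Q: group Q by (rule Q)
  obtain f :: "_ \<Rightarrow> nat" and n where f: "f ` carrier Q = {i. i < n}" "inj_on f (carrier Q)"
    using finite_imp_inj_to_nat_seg[OF fin] by blast
  define g where "g = real \<circ> f"
  have inj: "inj_on g (carrier Q)" unfolding g_def using f(2) by (auto simp: inj_on_def)
  let ?i = "inv_into (carrier Q) g"
  define H where "H = \<lparr>carrier = g ` carrier Q, monoid.mult = (\<lambda>x y. g (?i x \<otimes>\<^bsub>Q\<^esub> ?i y)), one = g \<one>\<^bsub>Q\<^esub>\<rparr>"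
  have i: "?i (g x) = x" if "x \<in> carrier Q" for x using inj that by (rule inv_into_f_f)
  have "group H"
  proof (rule groupI)
    fix x assume "x \<in> carrier H"
    then obtain a where a: "a \<in> carrier Q" "x = g a" by (auto simp: H_def)
    then show "\<exists>y\<in>carrier H. y \<otimes>\<^bsub>H\<^esub> x = \<one>\<^bsub>H\<^esub>"
      by (intro bexI[of _ "g (inv\<^bsub>Q\<^esub> a)"]) (auto simp: H_def i)
  qed (auto simp: H_def i Q.m_assoc)
  moreover have "bij_betw g (carrier Q) (carrier H)" using inj by (simp add: bij_betw_def H_def)
  moreover have "g \<in> hom Q H" by (auto simp: hom_def H_def i)
  ultimately show thesis using that by blast
qed

context pro_p
begin

text \<open>Uniqueness in the universal property forces \<open>B\<close> to generate. The subgroup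
  \<open>A\<close> generated by \<open>B\<close> over \<open>Ser 2\<close> is a finite union of
  cosets, hence closed. An element outside \<open>A\<close> would survive in a finite
  \<open>p\<close>-quotient in which \<open>B\<close> becomes trivial, giving two homomorphisms with
  the same values on \<open>B\<close>.\<close>

lemma fin_quot_1:
  assumes free: "free_pro_p_on p S T B"
  shows "fin_quot 1"
proof -
  have B: "finite B" "B \<subseteq> carrier S" using free by (auto simp: free_pro_p_on_def)
  have "\<exists>A F. subgroup A S \<and> Ser 2 \<subseteq> A \<and> B \<subseteq> A \<and> A \<subseteq> carrier S \<and> finite F \<and> F \<subseteq> A
     \<and> A = (\<Union>f\<in>F. Ser 2 #> f)"
  proof (rule finite_adjoin[OF Ser_normal Ser_closed subgroup_self _ _ _ B])
    show "Ser 2 \<subseteq> carrier S" by (rule normal_subset[OF Ser_normal])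
    show "x [^] p \<in> Ser 2" if "x \<in> carrier S" for x using pow_Ser[of 1 x] that by (simp add: numeral_2_eq_2)
    show "group_commutator S x y \<in> Ser 2" if "x \<in> carrier S" "y \<in> carrier S" for x y
      using commutator_Ser[of 1 1 x y] that by (simp add: numeral_2_eq_2)
  qed
  then obtain A F where A: "subgroup A S" "Ser 2 \<subseteq> A" "B \<subseteq> A" "finite F" "F \<subseteq> A" "A = (\<Union>f\<in>F. Ser 2 #> f)"
    by (elim exE conjE) (rule that)
  have Acl: "closedin T A"
    by (rule closedin_finite_cosets[OF Ser_closed A(4) order_trans[OF A(5) subgroup.subset[OF A(1)]] A(6)])
  have "carrier S \<subseteq> A"
  proof
    fix x assume x: "x \<in> carrier S"
    show "x \<in> A"
    proof (rule ccontr)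
      assume "x \<notin> A"
      then obtain N where N: "N \<lhd> S" "openin T N" "x \<notin> A <#> N"
        using open_normal_separates[OF Acl x] by blast
      have Nsub: "subgroup N S" using N(1) by (rule normal_imp_subgroup)
      have "A \<lhd> S"
        unfolding normal_inv_iff
      proof (intro conjI ballI A(1))
        fix g h assume g: "g \<in> carrier S" and h: "h \<in> A"
        have hc: "h \<in> carrier S" using h subgroup.mem_carrier[OF A(1)] by blast
        have "group_commutator S g h \<in> A" using commutator_Ser[of 1 1 g h] g hc A(2) by (auto simp: numeral_2_eq_2)
        then show "g \<otimes> h \<otimes> inv g \<in> A"
          using subgroup.m_closed[OF A(1) _ h] conj_eq_commutator_mult[OF g hc] by simp
      qed
      \<comment> \<open>Enlarging \<open>A\<close> by the separating \<open>N\<close> gives an open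
        normal subgroup that still misses \<open>x\<close>; the quotient by it is a finite
        \<open>p\<close>-group.\<close>
      let ?M = "A <#> N"
      have M: "?M \<lhd> S" using normal_set_mult[OF \<open>A \<lhd> S\<close> N(1)] .
      have Msub: "subgroup ?M S" using M by (rule normal_imp_subgroup)
      have AM: "A \<subseteq> ?M" "N \<subseteq> ?M"
        using closed_subgroup_mult(3,4)[OF \<open>A \<lhd> S\<close> Acl Nsub] closedin_open_subgroup[OF Nsub N(2)] by auto
      have Mop: "openin T ?M" using openin_subgroup[OF Msub N(2) subgroup.one_closed[OF Nsub] AM(2)] .
      interpret M: mnormal ?M S by (rule mnormalI[OF M])
      obtain k where k: "card (rcosets ?M) = p ^ k"
        using pro_p M Mop unfolding pro_p_group_def by blast
      have carQ: "carrier (S Mod ?M) = rcosets ?M" by (simp add: FactGroup_def)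
      have finQ: "finite (carrier (S Mod ?M))"
        unfolding carQ using k prime_p by (metis card.infinite not_prime_0 power_not_zero)
      obtain H :: "real monoid" and g where H: "group H" "bij_betw g (carrier (S Mod ?M)) (carrier H)" "g \<in> hom (S Mod ?M) H"
        using real_copy_of_finite_group[OF M.factorgroup_is_group finQ] .
      let ?D = "discrete_topology (carrier H)"
      have cH: "card (carrier H) = p ^ k"
        using bij_betw_same_card[OF H(2)] carQ k by simp
      have proH: "pro_p_group p H ?D"
        using pro_p_group_finite_discrete[OF prime_p H(1) cH] .
      interpret H: group H by (rule H(1))
      have gM: "g ?M = \<one>\<^bsub>H\<^esub>"
        using hom_one[OF H(3) M.factorgroup_is_group H(1)] by simp
      \<comment> \<open>\<open>S \<rightarrow> S/?M\<close> and the trivial homomorphism agree on \<open>B\<close>, hence are equal.\<close>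
      let ?h1 = "restrict (\<lambda>x. g (?M #> x)) (carrier S)"
      let ?h2 = "restrict (\<lambda>x. \<one>\<^bsub>H\<^esub>) (carrier S)"
      have ghom: "?h1 \<in> hom S H"
        using hom_compose[OF M.r_coset_hom_Mod H(3)] by (simp add: compose_def)
      have "?h1 \<in> hom S H" by (rule ghom)
      moreover have "?h2 \<in> hom S H" by (auto simp: hom_def)
      moreover have "continuous_map T ?D ?h1"
        unfolding continuous_map_def
      proof (intro conjI allI impI)
        show "?h1 \<in> topspace T \<rightarrow> topspace ?D"
          using ghom by (simp add: hom_def)
        fix U assume "openin ?D U"
        have "{x \<in> topspace T. ?h1 x \<in> U} = (\<Union>x\<in>{x \<in> carrier S. g (?M #> x) \<in> U}. ?M #> x)"
        proof (intro equalityI subsetI)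
          fix y assume "y \<in> {x \<in> topspace T. ?h1 x \<in> U}"
          then show "y \<in> (\<Union>x\<in>{x \<in> carrier S. g (?M #> x) \<in> U}. ?M #> x)"
            using rcos_self[of y ?M, OF _ Msub] by auto
        next
          fix y assume "y \<in> (\<Union>x\<in>{x \<in> carrier S. g (?M #> x) \<in> U}. ?M #> x)"
          then obtain x where x: "x \<in> carrier S" "g (?M #> x) \<in> U" "y \<in> ?M #> x" by blast
          then have "?M #> y = ?M #> x" "y \<in> carrier S"
            using repr_independence[OF x(3,1) Msub] r_coset_subset_G[OF M.subset x(1)] by auto
          then show "y \<in> {x \<in> topspace T. ?h1 x \<in> U}" using x by simp
        qed
        then show "openin T {x \<in> topspace T. ?h1 x \<in> U}"
          using openin_r_coset[OF Mop] by auto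
      qed
      moreover have "continuous_map T ?D ?h2"
        by (rule continuous_map_eq[of T ?D "\<lambda>_. \<one>\<^bsub>H\<^esub>"]) auto
      moreover have "\<forall>b\<in>B. ?h1 b = \<one>\<^bsub>H\<^esub>"
      proof
        fix b assume b: "b \<in> B"
        then have "?M #> b = ?M" using A(3) AM(1) B(2) M.rcos_eq_one_iff[of b] by blast
        then show "?h1 b = \<one>\<^bsub>H\<^esub>" using b B(2) gM by auto
      qed
      moreover have "\<forall>b\<in>B. ?h2 b = \<one>\<^bsub>H\<^esub>" using B(2) by auto
      moreover have "\<exists>!h. h \<in> extensional (carrier S) \<and> h \<in> hom S H \<and> continuous_map T ?D h \<and>
              (\<forall>x\<in>B. h x = \<one>\<^bsub>H\<^esub>)"
        using free[unfolded free_pro_p_on_def, THEN conjunct2, THEN conjunct2, THEN conjunct2, rule_format, of H ?D "\<lambda>_. \<one>\<^bsub>H\<^esub>"] proH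
        by simp
      ultimately have "?h1 = ?h2" by blast
      then have "?h1 x = ?h2 x" by simp
      then have "g (?M #> x) = g ?M" using x gM by simp
      moreover have "?M #> x \<in> carrier (S Mod ?M)" "?M \<in> carrier (S Mod ?M)"
        using rcosetsI[OF M.subset x] M.subgroup_in_rcosets[OF is_group] carQ by auto
      ultimately have "?M #> x = ?M" using H(2) by (auto simp: bij_betw_def inj_on_def)
      then show False using N(3) M.rcos_eq_one_iff[OF x] by simp
    qed
  qed
  then have "Ser 1 = A" using subgroup.subset[OF A(1)] by auto
  then show ?thesis unfolding fin_quot_def using A(4-6) by (metis Suc_1)
qed

end

section \<open>The graded Lie algebra\<close>

text \<open>The neutral elements \<open>N i\<close> are a parameter because in a quotient the
  identity is the subgroup divided out, which varies with the degree.\<close>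

definition single :: "(nat \<Rightarrow> 'b) \<Rightarrow> nat \<Rightarrow> 'b \<Rightarrow> (nat \<Rightarrow> 'b)" where
  "single N n C = (\<lambda>i\<in>{1..}. if i = n then C else N i)"

lemma sum_group_mem_iff:
  assumes "\<And>i. i \<ge> 1 \<Longrightarrow> group (Q i)"
  shows "f \<in> carrier (sum_group {1..} Q) \<longleftrightarrow>
    f \<in> extensional {1..} \<and> (\<forall>n\<ge>1. f n \<in> carrier (Q n)) \<and> finite {n. n \<ge> 1 \<and> f n \<noteq> \<one>\<^bsub>Q n\<^esub>}"
  using assms by (subst carrier_sum_group) (auto simp: PiE_def Pi_def)

lemma single_in_sum_group:
  assumes "\<And>i. i \<ge> 1 \<Longrightarrow> group (Q i)" "\<And>i. i \<ge> 1 \<Longrightarrow> \<one>\<^bsub>Q i\<^esub> = N i" "n \<ge> 1" "C \<in> carrier (Q n)"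
  shows "single N n C \<in> carrier (sum_group {1..} Q)"
proof -
  have "{i. i \<ge> 1 \<and> single N n C i \<noteq> \<one>\<^bsub>Q i\<^esub>} \<subseteq> {n}" using assms(2) by (auto simp: single_def)
  then have "finite {i. i \<ge> 1 \<and> single N n C i \<noteq> \<one>\<^bsub>Q i\<^esub>}" by (rule finite_subset) simp
  moreover have "N i \<in> carrier (Q i)" if "i \<ge> 1" for i
    using assms(1,2)[OF that] by (metis group.is_monoid monoid.one_closed)
  ultimately show ?thesis
    using assms by (subst sum_group_mem_iff) (auto simp: single_def)
qed

text \<open>An element of the direct sum is the finite product of its homogeneous parts; the
  induction adds one degree of the support at a time.\<close>

lemma subgroup_contains_of_single:
  assumes Q: "\<And>i. i \<ge> 1 \<Longrightarrow> group (Q i)" "\<And>i. i \<ge> 1 \<Longrightarrow> \<one>\<^bsub>Q i\<^esub> = N i"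
    and I: "subgroup I (sum_group {1..} Q)" and f: "f \<in> carrier (sum_group {1..} Q)"
    and s: "\<And>n. n \<ge> 1 \<Longrightarrow> single N n (f n) \<in> I"
  shows "f \<in> I"
proof -
  have fm: "f \<in> extensional {1..}" "\<And>n. n \<ge> 1 \<Longrightarrow> f n \<in> carrier (Q n)" "finite {n. n \<ge> 1 \<and> f n \<noteq> \<one>\<^bsub>Q n\<^esub>}"
    using f sum_group_mem_iff[of Q f] Q(1) by auto
  have *: "(\<lambda>i\<in>{1..}. if i \<in> A then f i else N i) \<in> I" if "finite A" "A \<subseteq> {1..}" for A
    using that
  proof (induction A rule: finite_induct)
    case empty
    have e: "(\<lambda>i\<in>{1..}. if i \<in> {} then f i else N i) = \<one>\<^bsub>sum_group {1..} Q\<^esub>"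
      using Q(2) by (auto intro!: restrict_ext)
    show ?case unfolding e by (rule subgroup.one_closed[OF I])
  next
    case (insert a A)
    have one: "N i \<in> carrier (Q i)" "\<And>c. c \<in> carrier (Q i) \<Longrightarrow> N i \<otimes>\<^bsub>Q i\<^esub> c = c" "\<And>c. c \<in> carrier (Q i) \<Longrightarrow> c \<otimes>\<^bsub>Q i\<^esub> N i = c"
      if "i \<ge> 1" for i
    proof -
      interpret group "Q i" using Q(1) that .
      show "N i \<in> carrier (Q i)" "\<And>c. c \<in> carrier (Q i) \<Longrightarrow> N i \<otimes>\<^bsub>Q i\<^esub> c = c" "\<And>c. c \<in> carrier (Q i) \<Longrightarrow> c \<otimes>\<^bsub>Q i\<^esub> N i = c"
        unfolding Q(2)[OF that, symmetric] by auto
    qed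
    have "single N a (f a) \<otimes>\<^bsub>sum_group {1..} Q\<^esub> (\<lambda>i\<in>{1..}. if i \<in> A then f i else N i) \<in> I"
    proof (rule subgroup.m_closed[OF I s])
      show "a \<ge> 1" using insert.prems by simp
      show "(\<lambda>i\<in>{1..}. if i \<in> A then f i else N i) \<in> I" using insert.prems by (intro insert.IH) blast
    qed
    moreover have "single N a (f a) \<otimes>\<^bsub>sum_group {1..} Q\<^esub> (\<lambda>i\<in>{1..}. if i \<in> A then f i else N i)
        = (\<lambda>i\<in>{1..}. if i \<in> insert a A then f i else N i)"
      using insert.hyps fm(2) one unfolding mult_sum_group single_def by (intro restrict_ext) auto
    ultimately show ?case by (simp only:)
  qed
  have "(\<lambda>i\<in>{1..}. if i \<in> {n. n \<ge> 1 \<and> f n \<noteq> \<one>\<^bsub>Q n\<^esub>} then f i else N i) = f"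
    using fm(1) Q(2) by (auto simp: extensional_def fun_eq_iff)
  then show ?thesis using *[OF fm(3)] by auto
qed

section \<open>Homogeneous elements, bracket and \<open>P\<close> on cosets, and ideals from
  filtrations\<close>

context pro_p
begin

abbreviation Quo :: "'a set \<Rightarrow> 'a set \<Rightarrow> 'a set monoid" where
  "Quo K N \<equiv> (S\<lparr>carrier := K\<rparr>) Mod N"

lemma Quo_carrier: "carrier (Quo K N) = (\<lambda>x. N #> x) ` K"
  by (simp add: carrier_FactGroup)

lemma Quo_normal:
  assumes "subgroup K S" "N \<lhd> S" "N \<subseteq> K"
  shows "N \<lhd> (S\<lparr>carrier := K\<rparr>)"
  using assms by (simp add: normal_restrict_supergroup)

lemma Quo_group:
  assumes "subgroup K S" "N \<lhd> S" "N \<subseteq> K"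
  shows "group (Quo K N)"
  using normal.factorgroup_is_group[OF Quo_normal[OF assms]] .

lemma Quo_mult:
  assumes "subgroup K S" "N \<lhd> S" "x \<in> K" "y \<in> K"
  shows "(N #> x) \<otimes>\<^bsub>Quo K N\<^esub> (N #> y) = N #> (x \<otimes> y)"
  using normal.rcos_sum[OF assms(2)] subgroup.mem_carrier[OF assms(1)] assms by simp

lemma Quo_inv:
  assumes "subgroup K S" "N \<lhd> S" "N \<subseteq> K" "x \<in> K"
  shows "inv\<^bsub>Quo K N\<^esub> (N #> x) = N #> inv x"
proof (rule group.inv_equality[OF Quo_group[OF assms(1-3)]])
  have x: "x \<in> carrier S" "inv x \<in> K" using assms by (auto simp: subgroup.mem_carrier subgroup.m_inv_closed)
  show "(N #> inv x) \<otimes>\<^bsub>Quo K N\<^esub> (N #> x) = \<one>\<^bsub>Quo K N\<^esub>"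
    using Quo_mult[OF assms(1,2) x(2) assms(4)] x normal_subset[OF assms(2)] by simp
qed (use assms in \<open>auto simp: Quo_carrier subgroup.m_inv_closed\<close>)

lemma Quo_comm_group:
  assumes "subgroup K S" "N \<lhd> S" "N \<subseteq> K" "\<And>x y. x \<in> K \<Longrightarrow> y \<in> K \<Longrightarrow> group_commutator S x y \<in> N"
  shows "comm_group (Quo K N)"
proof (rule group.group_comm_groupI[OF Quo_group[OF assms(1-3)]])
  fix a b assume "a \<in> carrier (Quo K N)" "b \<in> carrier (Quo K N)"
  then obtain x y where xy: "x \<in> K" "y \<in> K" "a = N #> x" "b = N #> y" by (auto simp: Quo_carrier)
  have c: "x \<in> carrier S" "y \<in> carrier S" using xy subgroup.mem_carrier[OF assms(1)] by auto
  interpret N: mnormal N S by (rule mnormalI[OF assms(2)])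
  have "(N #> x) <#> (N #> y) = (N #> y) <#> (N #> x)"
    using N.commutator_mem_iff[OF c] assms(4)[OF xy(1,2)] by simp
  then show "a \<otimes>\<^bsub>Quo K N\<^esub> b = b \<otimes>\<^bsub>Quo K N\<^esub> a" using xy by simp
qed

lemma coset_one: "N \<lhd> S \<Longrightarrow> N #> \<one> = N"
  using coset_mult_one normal_subset by blast

lemma coset_eq_iff:
  assumes "N \<lhd> S" "x \<in> carrier S" "y \<in> carrier S"
  shows "N #> x = N #> y \<longleftrightarrow> x \<otimes> inv y \<in> N"
proof -
  interpret N: mnormal N S by (rule mnormalI[OF assms(1)])
  show ?thesis using N.rcos_eq_iff assms by blast
qed

lemma coset_eq_self_iff:
  assumes "N \<lhd> S" "x \<in> carrier S"
  shows "N #> x = N \<longleftrightarrow> x \<in> N"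
proof -
  interpret N: mnormal N S by (rule mnormalI[OF assms(1)])
  show ?thesis using N.rcos_eq_one_iff assms by blast
qed

lemma coset_mono_eq:
  assumes "N \<subseteq> M" "M \<lhd> S" "x \<in> carrier S" "y \<in> N #> x"
  shows "M #> y = M #> x"
proof -
  have "y \<in> M #> x" using assms(1,4) unfolding r_coset_def by blast
  then show ?thesis using repr_independence[OF _ assms(3) normal_imp_subgroup[OF assms(2)]] by simp
qed

text \<open>Evaluates \<open>iota_comp\<close> and \<open>gr_ind_incl\<close>, which send a coset to
  the coset of a larger subgroup.\<close>

lemma UN_coset_mono:
  assumes "N \<subseteq> M" "N \<lhd> S" "M \<lhd> S" "x \<in> carrier S"
  shows "(\<Union>y\<in>N #> x. M #> y) = M #> x"
  by (rule UN_r_coset[OF normal_imp_subgroup[OF assms(2)] assms(4)]) (rule coset_mono_eq[OF assms(1,3,4)])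

lemma gr_comp_eq: "gr_comp p S T n = Quo (Ser n) (Ser (Suc n))"
  by (simp add: gr_comp_def)

lemma gr_comp_group: "group (gr_comp p S T n)"
  unfolding gr_comp_eq by (intro Quo_group Ser_subgroup Ser_normal Ser_antimono) simp

lemma gr_comp_one: "\<one>\<^bsub>gr_comp p S T n\<^esub> = Ser (Suc n)"
  by (simp add: gr_comp_def)

lemma gr_comp_comm_group: "n \<ge> 1 \<Longrightarrow> comm_group (gr_comp p S T n)"
  unfolding gr_comp_eq
  by (intro Quo_comm_group Ser_subgroup Ser_normal Ser_antimono)
    (use commutator_Ser[of n 1] in auto)

lemma gr_group: "group (gr p S T)"
  unfolding gr_def using gr_comp_group by simp

lemma gr_mem_iff:
  "f \<in> carrier (gr p S T) \<longleftrightarrow> f \<in> extensional {1..} \<and> (\<forall>n\<ge>1. \<exists>x\<in>Ser n. f n = Ser (Suc n) #> x)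
    \<and> finite {n. n \<ge> 1 \<and> f n \<noteq> Ser (Suc n)}"
  unfolding gr_def by (subst sum_group_mem_iff) (auto simp: gr_comp_group[unfolded gr_comp_eq] gr_comp_one gr_comp_eq Quo_carrier image_iff)

lemma bracket_comp_coset:
  assumes "m \<ge> 1" "n \<ge> 1" "x \<in> Ser m" "y \<in> Ser n"
  shows "bracket_comp p S T m n (Ser (Suc m) #> x) (Ser (Suc n) #> y) = Ser (Suc (m + n)) #> group_commutator S x y"
  unfolding bracket_comp_def
proof (intro UN_r_coset Ser_subgroup)
  fix x' y' assume "x' \<in> Ser (Suc m) #> x" "y' \<in> Ser (Suc n) #> y"
  then obtain u v where "u \<in> Ser (Suc m)" "v \<in> Ser (Suc n)" "x' = u \<otimes> x" "y' = v \<otimes> y"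
    by (auto simp: r_coset_def)
  then show "Ser (m + n + 1) #> group_commutator S x' y' = Ser (Suc (m + n)) #> group_commutator S x y"
    using commutator_coset_Ser[OF assms(1,2,3) _ assms(4)] by simp
qed (use assms in auto)

lemma P_comp_coset:
  assumes "n \<ge> 1" "x \<in> Ser n"
  shows "P_comp p S T n (Ser (Suc n) #> x) = Ser (Suc (Suc n)) #> (x [^] p)"
  unfolding P_comp_def
proof (intro UN_r_coset Ser_subgroup)
  fix x' assume "x' \<in> Ser (Suc n) #> x"
  then obtain u where "u \<in> Ser (Suc n)" "x' = u \<otimes> x" by (auto simp: r_coset_def)
  then show "Ser (n + 2) #> (x' [^] p) = Ser (Suc (Suc n)) #> (x [^] p)"
    using pow_coset_Ser[OF assms] by simp
qed (use assms in auto)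

abbreviation gsingle :: "nat \<Rightarrow> 'a \<Rightarrow> (nat \<Rightarrow> 'a set)" where
  "gsingle n x \<equiv> single (\<lambda>i. Ser (Suc i)) n (Ser (Suc n) #> x)"

lemma gsingle_in_gr: "n \<ge> 1 \<Longrightarrow> x \<in> Ser n \<Longrightarrow> gsingle n x \<in> carrier (gr p S T)"
  unfolding gr_def
  by (rule single_in_sum_group) (auto simp: gr_comp_group[unfolded gr_comp_eq] gr_comp_one gr_comp_eq Quo_carrier)

text \<open>Writing the trivial components as cosets of \<open>\<one>\<close> lets the rules for
  cosets treat all degrees uniformly.\<close>

lemma gsingle_apply: "i \<ge> 1 \<Longrightarrow> gsingle n x i = Ser (Suc i) #> (if i = n then x else \<one>)"
  by (simp add: single_def coset_one Ser_normal)

lemma initial_form_eq: "initial_form p S T r = gsingle 2 r"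
  unfolding initial_form_def single_def by (intro restrict_ext) (auto simp: gr_comp_one numeral_3_eq_3 numeral_2_eq_2)

lemma gr_P_gsingle:
  assumes "n \<ge> 1" "x \<in> Ser n"
  shows "gr_P p S T (gsingle n x) = gsingle (Suc n) (x [^] p)"
  unfolding gr_P_def
proof (subst (2) single_def, intro restrict_ext)
  fix i :: nat assume i: "i \<in> {1..}"
  show "(if i = 1 then \<one>\<^bsub>gr_comp p S T 1\<^esub> else P_comp p S T (i - 1) (gsingle n x (i - 1))) =
      (if i = Suc n then Ser (Suc (Suc n)) #> (x [^] p) else Ser (Suc i))"
  proof (cases "i = 1")
    case False
    then have i1: "i - 1 \<ge> 1" "Suc (i - 1) = i" using i by auto
    have "P_comp p S T (i - 1) (gsingle n x (i - 1)) = Ser (Suc i) #> ((if i - 1 = n then x else \<one>) [^] p)"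
      unfolding gsingle_apply[OF i1(1)] using P_comp_coset[OF i1(1), of "if i - 1 = n then x else \<one>"] assms
        subgroup.one_closed[OF Ser_subgroup] i1(2) by auto
    then show ?thesis using False i by (auto simp: coset_one Ser_normal)
  qed (use assms in \<open>simp add: gr_comp_one\<close>)
qed

text \<open>In the convolution defining degree \<open>i\<close>, a factor is trivial unless
  \<open>j = m\<close> and \<open>i - j = n\<close>.\<close>

lemma gr_bracket_gsingle:
  assumes "m \<ge> 1" "n \<ge> 1" "x \<in> Ser m" "y \<in> Ser n"
  shows "gr_bracket p S T (gsingle m x) (gsingle n y) = gsingle (m + n) (group_commutator S x y)"
  unfolding gr_bracket_def
proof (subst (3) single_def, intro restrict_ext)
  fix i :: nat assume i: "i \<in> {1..}"
  then have i1: "i \<ge> 1" by simp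
  interpret C: comm_group "gr_comp p S T i" by (rule gr_comp_comm_group[OF i1])
  let ?g = "\<lambda>j. bracket_comp p S T j (i - j) (gsingle m x j) (gsingle n y (i - j))"
  have g: "?g j = (if j = m \<and> i = m + n then Ser (Suc i) #> group_commutator S x y else \<one>\<^bsub>gr_comp p S T i\<^esub>)"
    if j: "j \<in> {1..<i}" for j
  proof -
    have j1: "j \<ge> 1" "i - j \<ge> 1" "j + (i - j) = i" using j by auto
    have "?g j = Ser (Suc i) #> group_commutator S (if j = m then x else \<one>) (if i - j = n then y else \<one>)"
      unfolding gsingle_apply[OF j1(1)] gsingle_apply[OF j1(2)]
      using bracket_comp_coset[OF j1(1,2), of "if j = m then x else \<one>" "if i - j = n then y else \<one>"] assms j1(3)
        subgroup.one_closed[OF Ser_subgroup] by auto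
    moreover have "x \<in> carrier S" "y \<in> carrier S" using assms by auto
    ultimately show ?thesis
      using j by (auto simp: gr_comp_one coset_one Ser_normal group_commutator_def)
  qed
  show "finprod (gr_comp p S T i) ?g {1..<i} =
    (if i = m + n then Ser (Suc (m + n)) #> group_commutator S x y else Ser (Suc i))"
  proof (cases "i = m + n")
    case True
    let ?c = "Ser (Suc i) #> group_commutator S x y"
    have c: "?c \<in> carrier (gr_comp p S T i)"
      using commutator_Ser[OF assms] True by (auto simp: gr_comp_eq Quo_carrier)
    have "finprod (gr_comp p S T i) ?g {1..<i} = finprod (gr_comp p S T i) (\<lambda>j. if m = j then ?c else \<one>\<^bsub>gr_comp p S T i\<^esub>) {1..<i}"
      using g True c C.one_closed by (intro C.finprod_cong') auto
    also have "\<dots> = ?c" using c assms True by (intro C.finprod_singleton) auto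
    finally show ?thesis using True by simp
  next
    case False
    then have "finprod (gr_comp p S T i) ?g {1..<i} = \<one>\<^bsub>gr_comp p S T i\<^esub>"
      using g by (intro C.finprod_one_eqI) auto
    then show ?thesis using False by (simp add: gr_comp_one)
  qed
qed

text \<open>The direct sum of the images of the \<open>A n\<close> in \<open>gr_n(S)\<close>. For
  \<open>A = Ind\<close> it is the image of \<open>gr(R)_ind\<close> in \<open>gr(S)\<close>; for
  \<open>A = shifted_Rel\<close> it is the image of \<open>iota\<close>.\<close>

definition graded_part :: "(nat \<Rightarrow> 'a set) \<Rightarrow> (nat \<Rightarrow> 'a set) set" where
  "graded_part A = {f \<in> carrier (gr p S T). \<forall>n\<ge>1. \<exists>x\<in>A n. f n = Ser (Suc n) #> x}"

lemma gsingle_in_graded_part: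
  assumes "n \<ge> 1" "x \<in> A n" "x \<in> Ser n" "\<And>i. i \<ge> 1 \<Longrightarrow> \<one> \<in> A i"
  shows "gsingle n x \<in> graded_part A"
  unfolding graded_part_def using gsingle_in_gr[of n x] assms gsingle_apply[of _ n x] by auto

text \<open>The conditions on commutators and powers are exactly closure under bracket and
  \<open>P\<close> on homogeneous elements. For general elements it remains to multiply the terms of
  the convolution and to control supports.\<close>

lemma graded_part_ideal:
  assumes A: "\<And>n. n \<ge> 1 \<Longrightarrow> subgroup (A n) S" "\<And>n. n \<ge> 1 \<Longrightarrow> A n \<subseteq> Ser n"
    and com: "\<And>m n x a. m \<ge> 1 \<Longrightarrow> n \<ge> 1 \<Longrightarrow> x \<in> Ser m \<Longrightarrow> a \<in> A n \<Longrightarrow> group_commutator S x a \<in> A (m + n)"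
    and pw: "\<And>n a. n \<ge> 1 \<Longrightarrow> a \<in> A n \<Longrightarrow> a [^] p \<in> A (Suc n)"
  shows "gr_ideal p S T (graded_part A)"
  unfolding gr_ideal_def
proof (intro conjI ballI)
  have sum: "gr p S T = sum_group {1..} (gr_comp p S T)" by (simp add: gr_def)
  have cg: "group (gr_comp p S T i)" for i by (rule gr_comp_group)
  show "subgroup (graded_part A) (gr p S T)"
  proof (rule group.subgroupI[OF gr_group])
    show "graded_part A \<subseteq> carrier (gr p S T)" by (auto simp: graded_part_def)
    have "gsingle 1 \<one> \<in> graded_part A"
      using A(1) by (intro gsingle_in_graded_part) (auto simp: subgroup.one_closed)
    then show "graded_part A \<noteq> {}" by blast
  next
    fix f assume f: "f \<in> graded_part A"
    then have fc: "f \<in> carrier (gr p S T)" by (simp add: graded_part_def)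
    have ic: "inv\<^bsub>gr p S T\<^esub> f \<in> carrier (gr p S T)" using group.inv_closed[OF gr_group fc] .
    have "\<exists>x\<in>A n. (inv\<^bsub>gr p S T\<^esub> f) n = Ser (Suc n) #> x" if n: "n \<ge> 1" for n
    proof -
      obtain x where x: "x \<in> A n" "f n = Ser (Suc n) #> x" using f n by (auto simp: graded_part_def)
      have "(inv\<^bsub>gr p S T\<^esub> f) n = inv\<^bsub>gr_comp p S T n\<^esub> (f n)"
        using inv_sum_group[of "{1..}" "gr_comp p S T" f] cg fc n unfolding sum by simp
      also have "\<dots> = Ser (Suc n) #> inv x"
        unfolding x(2) gr_comp_eq using A(2)[OF n] x(1)
        by (intro Quo_inv Ser_subgroup Ser_normal Ser_antimono) auto
      finally show ?thesis using x(1) A(1)[OF n] by (auto simp: subgroup.m_inv_closed)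
    qed
    then show "inv\<^bsub>gr p S T\<^esub> f \<in> graded_part A" using ic by (simp add: graded_part_def)
  next
    fix f g assume f: "f \<in> graded_part A" and g: "g \<in> graded_part A"
    then have fc: "f \<in> carrier (gr p S T)" "g \<in> carrier (gr p S T)" by (simp_all add: graded_part_def)
    have mc: "f \<otimes>\<^bsub>gr p S T\<^esub> g \<in> carrier (gr p S T)"
      using fc monoid.m_closed[OF group.is_monoid[OF gr_group]] by blast
    have "\<exists>x\<in>A n. (f \<otimes>\<^bsub>gr p S T\<^esub> g) n = Ser (Suc n) #> x" if n: "n \<ge> 1" for n
    proof -
      obtain x where x: "x \<in> A n" "f n = Ser (Suc n) #> x" using f n by (auto simp: graded_part_def)
      obtain y where y: "y \<in> A n" "g n = Ser (Suc n) #> y" using g n by (auto simp: graded_part_def)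
      have "(f \<otimes>\<^bsub>gr p S T\<^esub> g) n = f n \<otimes>\<^bsub>gr_comp p S T n\<^esub> g n"
        using n unfolding sum by simp
      also have "\<dots> = Ser (Suc n) #> (x \<otimes> y)"
        unfolding x(2) y(2) gr_comp_eq using A(2)[OF n] x(1) y(1)
        by (intro Quo_mult Ser_subgroup Ser_normal) auto
      finally show ?thesis using x(1) y(1) A(1)[OF n] by (auto simp: subgroup.m_closed)
    qed
    then show "f \<otimes>\<^bsub>gr p S T\<^esub> g \<in> graded_part A" using mc by (simp add: graded_part_def)
  qed
next
  fix f g assume f: "f \<in> carrier (gr p S T)" and g: "g \<in> graded_part A"
  let ?b = "gr_bracket p S T f g"
  let ?c = "\<lambda>n i. bracket_comp p S T i (n - i) (f i) (g (n - i))"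
  let ?B = "\<lambda>n. {Ser (Suc n) #> a | a. a \<in> A n}"
  have fx: "\<exists>x\<in>Ser n. f n = Ser (Suc n) #> x" if "n \<ge> 1" for n using f that by (auto simp: gr_mem_iff)
  have gx: "\<exists>x\<in>A n. g n = Ser (Suc n) #> x" if "n \<ge> 1" for n using g that by (auto simp: graded_part_def)
  have c: "?c n i \<in> ?B n" if "i \<in> {1..<n}" for n i
  proof -
    have i: "i \<ge> 1" "n - i \<ge> 1" "i + (n - i) = n" using that by auto
    obtain x where x: "x \<in> Ser i" "f i = Ser (Suc i) #> x" using fx i by blast
    obtain y where y: "y \<in> A (n - i)" "g (n - i) = Ser (Suc (n - i)) #> y" using gx i by blast
    have "?c n i = Ser (Suc n) #> group_commutator S x y"
      unfolding x(2) y(2) using bracket_comp_coset[OF i(1,2) x(1), of y] y(1) A(2)[OF i(2)] i(3) by auto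
    moreover have "group_commutator S x y \<in> A n" using com[OF i(1,2) x(1) y(1)] i(3) by simp
    ultimately show ?thesis by blast
  qed
  have Bc: "?B n \<subseteq> carrier (gr_comp p S T n)" if "n \<ge> 1" for n
    using A(2)[OF that] by (auto simp: gr_comp_eq Quo_carrier)
  \<comment> \<open>Each term of the convolution is represented in \<open>A n\<close>, and such
    classes are closed under products.\<close>
  have val: "?b n \<in> ?B n" if n: "n \<ge> 1" for n
  proof -
    interpret C: comm_group "gr_comp p S T n" by (rule gr_comp_comm_group[OF n])
    have "finprod (gr_comp p S T n) (?c n) I \<in> ?B n" if "finite I" "I \<subseteq> {1..<n}" for I
      using that
    proof (induction I rule: finite_induct)
      case empty
      have "\<one>\<^bsub>gr_comp p S T n\<^esub> = Ser (Suc n) #> \<one>" by (simp add: gr_comp_one coset_one Ser_normal)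
      then show ?case using subgroup.one_closed[OF A(1)[OF n]] by auto
    next
      case (insert i I)
      have "?c n \<in> I \<rightarrow> carrier (gr_comp p S T n)" "?c n i \<in> carrier (gr_comp p S T n)"
        using c Bc[OF n] insert.prems by blast+
      then have e: "finprod (gr_comp p S T n) (?c n) (insert i I) = ?c n i \<otimes>\<^bsub>gr_comp p S T n\<^esub> finprod (gr_comp p S T n) (?c n) I"
        using insert.hyps by (intro C.finprod_insert)
      obtain a where a: "a \<in> A n" "?c n i = Ser (Suc n) #> a" using c[of i n] insert.prems by blast
      obtain b where b: "b \<in> A n" "finprod (gr_comp p S T n) (?c n) I = Ser (Suc n) #> b"
        using insert by blast
      have "?c n i \<otimes>\<^bsub>gr_comp p S T n\<^esub> finprod (gr_comp p S T n) (?c n) I = Ser (Suc n) #> (a \<otimes> b)"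
        unfolding a(2) b(2) unfolding gr_comp_eq using a(1) b(1) A(2)[OF n] by (intro Quo_mult Ser_subgroup Ser_normal) auto
      then show ?case unfolding e using subgroup.m_closed[OF A(1)[OF n] a(1) b(1)] by blast
    qed
    then have "finprod (gr_comp p S T n) (?c n) {1..<n} \<in> ?B n" by blast
    then show ?thesis unfolding gr_bracket_def using n by simp
  qed
  \<comment> \<open>Above the sum of bounds for the two supports, every term of the convolution has
    a trivial factor.\<close>
  have "finite {n. n \<ge> 1 \<and> ?b n \<noteq> Ser (Suc n)}"
  proof -
    obtain M where M: "\<forall>n\<in>{n. n \<ge> 1 \<and> f n \<noteq> Ser (Suc n)}. n \<le> M"
      using f by (auto simp: gr_mem_iff finite_nat_set_iff_bounded_le)
    obtain M' where M': "\<forall>n\<in>{n. n \<ge> 1 \<and> g n \<noteq> Ser (Suc n)}. n \<le> M'"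
      using g by (auto simp: graded_part_def gr_mem_iff finite_nat_set_iff_bounded_le)
    have "?b n = Ser (Suc n)" if n: "n \<ge> 1" "n > M + M'" for n
    proof -
      interpret C: comm_group "gr_comp p S T n" by (rule gr_comp_comm_group[OF n(1)])
      have "?c n i = \<one>\<^bsub>gr_comp p S T n\<^esub>" if "i \<in> {1..<n}" for i
      proof -
        have i: "i \<ge> 1" "n - i \<ge> 1" "i + (n - i) = n" using that by auto
        obtain x where x: "x \<in> Ser i" "f i = Ser (Suc i) #> x" using fx i by blast
        obtain y where y: "y \<in> A (n - i)" "g (n - i) = Ser (Suc (n - i)) #> y" using gx i by blast
        have yS: "y \<in> Ser (n - i)" using y A(2)[OF i(2)] by blast
        have 1: "\<one> \<in> Ser k" for k by (rule subgroup.one_closed[OF Ser_subgroup])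
        have "f i = Ser (Suc i) \<or> g (n - i) = Ser (Suc (n - i))"
          using M M' i n(2) by force
        then consider "f i = Ser (Suc i) #> \<one>" | "g (n - i) = Ser (Suc (n - i)) #> \<one>"
          by (auto simp: coset_one Ser_normal)
        then have "?c n i = Ser (Suc n) #> \<one>"
        proof cases
          case 1
          then show ?thesis
            unfolding 1 y(2) using bracket_comp_coset[OF i(1,2) \<open>\<And>k. \<one> \<in> Ser k\<close> yS] i(3) yS
            by (simp add: group_commutator_def)
        next
          case 2
          then show ?thesis
            unfolding 2 x(2) using bracket_comp_coset[OF i(1,2) x(1) \<open>\<And>k. \<one> \<in> Ser k\<close>] i(3) x(1)
            by (simp add: group_commutator_def)
        qed
        then show ?thesis by (simp add: gr_comp_one coset_one Ser_normal)
      qed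
      then have "finprod (gr_comp p S T n) (?c n) {1..<n} = \<one>\<^bsub>gr_comp p S T n\<^esub>"
        by (intro C.finprod_one_eqI) auto
      then show ?thesis unfolding gr_bracket_def using n(1) by (simp add: gr_comp_one)
    qed
    then have "{n. n \<ge> 1 \<and> ?b n \<noteq> Ser (Suc n)} \<subseteq> {..M + M'}"
      by (metis (mono_tags, lifting) atMost_iff mem_Collect_eq not_le_imp_less subsetI)
    then show ?thesis by (rule finite_subset) simp
  qed
  moreover have "?b \<in> extensional {1..}" by (simp add: gr_bracket_def)
  ultimately show "?b \<in> graded_part A"
    unfolding graded_part_def gr_mem_iff using val A(2) by blast
next
  fix g assume g: "g \<in> graded_part A"
  let ?b = "gr_P p S T g"
  have gx: "\<exists>x\<in>A n. g n = Ser (Suc n) #> x" if "n \<ge> 1" for n using g that by (auto simp: graded_part_def)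
  have b1: "?b 1 = Ser (Suc 1) #> \<one>" by (simp add: gr_P_def gr_comp_one coset_one Ser_normal)
  have bS: "\<exists>x\<in>A n. g n = Ser (Suc n) #> x \<and> ?b (Suc n) = Ser (Suc (Suc n)) #> (x [^] p)" if n: "n \<ge> 1" for n
  proof -
    obtain x where x: "x \<in> A n" "g n = Ser (Suc n) #> x" using gx n by blast
    then show ?thesis using P_comp_coset[OF n, of x] A(2)[OF n] n by (auto simp: gr_P_def)
  qed
  have val: "\<exists>x\<in>A n. ?b n = Ser (Suc n) #> x" if n: "n \<ge> 1" for n
  proof (cases "n = 1")
    case True
    then show ?thesis using b1 subgroup.one_closed[OF A(1)] by auto
  next
    case False
    then obtain k where k: "n = Suc k" "k \<ge> 1" using n by (cases n) auto
    then show ?thesis using bS[OF k(2)] pw[OF k(2)] by auto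
  qed
  \<comment> \<open>If \<open>g\<close> vanishes in degree \<open>k\<close>, its representative
    there lies in \<open>Ser (Suc k)\<close>, and the \<open>p\<close>-th power lies one term
    deeper; thus \<open>gr_P\<close> shifts the support by one and adds nothing.\<close>
  have "{n. n \<ge> 1 \<and> ?b n \<noteq> Ser (Suc n)} \<subseteq> Suc ` {n. n \<ge> 1 \<and> g n \<noteq> Ser (Suc n)}"
  proof
    fix n assume n: "n \<in> {n. n \<ge> 1 \<and> ?b n \<noteq> Ser (Suc n)}"
    then have "n \<noteq> 1" using b1 by (auto simp: coset_one Ser_normal)
    then obtain k where k: "n = Suc k" "k \<ge> 1" using n by (cases n) auto
    obtain x where x: "x \<in> A k" "g k = Ser (Suc k) #> x" "?b n = Ser (Suc n) #> (x [^] p)" using bS[OF k(2)] k(1) by blast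
    have xS: "x \<in> Ser k" using x A(2)[OF k(2)] by blast
    have "g k \<noteq> Ser (Suc k)"
    proof
      assume "g k = Ser (Suc k)"
      then have "x \<in> Ser (Suc k)" using x(2) coset_eq_self_iff[OF Ser_normal] xS by auto
      then have "x [^] p \<in> Ser (Suc n)" using pow_Ser[of "Suc k" x] k by simp
      then show False using n x(3) coset_eq_self_iff[OF Ser_normal, of "x [^] p" "Suc n"] xS by auto
    qed
    then show "n \<in> Suc ` {n. n \<ge> 1 \<and> g n \<noteq> Ser (Suc n)}" using k by auto
  qed
  then have "finite {n. n \<ge> 1 \<and> ?b n \<noteq> Ser (Suc n)}"
    by (rule finite_subset) (use g in \<open>auto simp: graded_part_def gr_mem_iff\<close>)
  moreover have "?b \<in> extensional {1..}" by (simp add: gr_P_def)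
  ultimately show "?b \<in> graded_part A"
    unfolding graded_part_def gr_mem_iff using val A(2) by blast
qed

end

section \<open>Presentations\<close>

locale presented_pro_p = pro_p S T p for S :: "'a monoid" (structure) and T p +
  fixes R :: "'a set"
  assumes R_normal: "R \<lhd> S" and R_closed: "closedin T R" and R_Ser: "R \<subseteq> Ser 2"
begin

abbreviation "RelR \<equiv> Rel R"

definition Ind :: "nat \<Rightarrow> 'a set" where
  "Ind n = R \<inter> Ser n"

lemma RelR_normal: "RelR n \<lhd> S" and RelR_closed: "closedin T (RelR n)"
  using Rel_closed_normal[OF R_normal R_closed] by auto

lemma RelR_subgroup: "subgroup (RelR n) S"
  using RelR_normal by (rule normal_imp_subgroup)

lemma RelR_antimono: "m \<le> n \<Longrightarrow> RelR n \<subseteq> RelR m"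
  by (rule Rel_antimono[OF R_normal R_closed])

lemma R_mem: "x \<in> R \<Longrightarrow> x \<in> carrier S"
  using normal_mem[OF R_normal] .

lemma Ind_normal: "Ind n \<lhd> S"
proof -
  have "Ind n = \<Inter>{R, Ser n}" by (simp add: Ind_def)
  then show ?thesis using normal_Inter[of "{R, Ser n}"] R_normal Ser_normal by auto
qed

lemma Ind_subgroup: "subgroup (Ind n) S"
  using Ind_normal by (rule normal_imp_subgroup)

lemma Ind_antimono: "m \<le> n \<Longrightarrow> Ind n \<subseteq> Ind m"
  using Ser_antimono by (auto simp: Ind_def)

lemma Ind_mem: "x \<in> Ind n \<Longrightarrow> x \<in> carrier S"
  by (auto simp: Ind_def)

text \<open>The two values coincide, so \<open>gr(R)_ind\<close> vanishes in degree 1, the degree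
  that \<open>iota\<close> cannot reach.\<close>

lemma Ind_1: "Ind (Suc 0) = R" and Ind_2: "Ind (Suc (Suc 0)) = R"
  using R_Ser R_mem by (auto simp: Ind_def numeral_2_eq_2)

lemma RelR_Ind: "n \<ge> 1 \<Longrightarrow> RelR n \<subseteq> Ind (Suc n)"
  using RelR_antimono[of 1 n] Rel_subset_Ser_Suc[OF R_Ser] by (auto simp: Ind_def)

section \<open>The graded objects of \<open>R\<close> and the map \<open>iota\<close>\<close>

lemma gr_ind_comp_eq: "gr_ind_comp p S T R n = Quo (Ind n) (Ind (Suc n))"
  by (simp add: gr_ind_comp_def Ind_def)

lemma gr_rel_comp_eq: "gr_rel_comp p S T R n = Quo (RelR n) (RelR (Suc n))"
  by (simp add: gr_rel_comp_def)

lemma gr_ind_comp_group: "group (gr_ind_comp p S T R n)"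
  unfolding gr_ind_comp_eq by (intro Quo_group Ind_subgroup Ind_normal Ind_antimono) simp

lemma gr_rel_comp_group: "group (gr_rel_comp p S T R n)"
  unfolding gr_rel_comp_eq by (intro Quo_group RelR_subgroup RelR_normal RelR_antimono) simp

lemma gr_ind_mem_iff:
  "f \<in> carrier (gr_ind p S T R) \<longleftrightarrow> f \<in> extensional {1..} \<and> (\<forall>n\<ge>1. \<exists>x\<in>Ind n. f n = Ind (Suc n) #> x)
    \<and> finite {n. n \<ge> 1 \<and> f n \<noteq> Ind (Suc n)}"
  unfolding gr_ind_def
  by (subst sum_group_mem_iff) (auto simp: gr_ind_comp_group[unfolded gr_ind_comp_eq] gr_ind_comp_eq Quo_carrier image_iff)

lemma gr_rel_mem_iff:
  "f \<in> carrier (gr_rel p S T R) \<longleftrightarrow> f \<in> extensional {1..} \<and> (\<forall>n\<ge>1. \<exists>x\<in>RelR n. f n = RelR (Suc n) #> x)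
    \<and> finite {n. n \<ge> 1 \<and> f n \<noteq> RelR (Suc n)}"
  unfolding gr_rel_def
  by (subst sum_group_mem_iff) (auto simp: gr_rel_comp_group[unfolded gr_rel_comp_eq] gr_rel_comp_eq Quo_carrier image_iff)

lemma iota_comp_coset:
  assumes "n \<ge> 1" "x \<in> RelR n"
  shows "iota_comp p S T R n (RelR (Suc n) #> x) = Ind (Suc (Suc n)) #> x"
proof -
  have "x \<in> carrier S" using normal_mem[OF RelR_normal assms(2)] .
  then show ?thesis
    using UN_coset_mono[OF RelR_Ind RelR_normal Ind_normal, of "Suc n" x] by (simp add: iota_comp_def Ind_def)
qed

text \<open>Surjectivity is tested on the element concentrated in degree \<open>n + 1\<close> with
  class \<open>x\<close>; the degree \<open>n\<close> component of a preimage supplies the factor in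
  \<open>RelR n\<close>.\<close>

lemma iota_surj_imp:
  assumes surj: "iota p S T R ` carrier (gr_rel p S T R) = carrier (gr_ind p S T R)" and n: "n \<ge> 1"
  shows "R \<inter> Ser (n + 1) \<subseteq> RelR n <#> (R \<inter> Ser (n + 2))"
proof
  fix x assume "x \<in> R \<inter> Ser (n + 1)"
  then have x: "x \<in> Ind (Suc n)" by (simp add: Ind_def)
  let ?g = "single (\<lambda>i. Ind (Suc i)) (Suc n) (Ind (Suc (Suc n)) #> x)"
  have "?g \<in> carrier (gr_ind p S T R)"
    unfolding gr_ind_def
    by (rule single_in_sum_group) (use x in \<open>auto simp: gr_ind_comp_group[unfolded gr_ind_comp_eq] gr_ind_comp_eq Quo_carrier\<close>)
  then have "?g \<in> iota p S T R ` carrier (gr_rel p S T R)" unfolding surj .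
  then obtain f where f: "f \<in> carrier (gr_rel p S T R)" "iota p S T R f = ?g" by (elim imageE) (rule that, simp_all only:)
  obtain y where y: "y \<in> RelR n" "f n = RelR (Suc n) #> y" using f(1) n by (auto simp: gr_rel_mem_iff)
  have yc: "y \<in> carrier S" using normal_mem[OF RelR_normal y(1)] .
  have "iota p S T R f (Suc n) = Ind (Suc (Suc n)) #> y"
    using n iota_comp_coset[OF n y(1)] y(2) by (simp add: iota_def)
  moreover have "?g (Suc n) = Ind (Suc (Suc n)) #> x" by (simp add: single_def)
  ultimately have "Ind (Suc (Suc n)) #> x = Ind (Suc (Suc n)) #> y" using f(2) by simp
  then have "x \<otimes> inv y \<in> Ind (Suc (Suc n))"
    using coset_eq_iff[OF Ind_normal Ind_mem[OF x] yc] by simp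
  moreover have "x = (x \<otimes> inv y) \<otimes> y" using yc Ind_mem[OF x] by (simp add: m_assoc)
  ultimately have "x \<in> Ind (Suc (Suc n)) <#> RelR n" using y(1) unfolding set_mult_def by blast
  then show "x \<in> RelR n <#> (R \<inter> Ser (n + 2))"
    using commut_normal[OF RelR_subgroup Ind_normal, of n "Suc (Suc n)"] by (simp add: Ind_def)
qed

text \<open>When the filtrations agree up to the shift, the cosets on both sides are the same sets,
  and \<open>iota\<close> merely moves a sequence by one place and inserts \<open>R\<close> in
  degree 1.\<close>

lemma iota_bij:
  assumes eq: "\<And>n. n \<ge> 1 \<Longrightarrow> Ind (Suc n) = RelR n"
  shows "bij_betw (iota p S T R) (carrier (gr_rel p S T R)) (carrier (gr_ind p S T R))"
proof -
  have io: "iota p S T R f = (\<lambda>n\<in>{1..}. if n = 1 then R else f (n - 1))" if f: "f \<in> carrier (gr_rel p S T R)" for f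
    unfolding iota_def
  proof (intro restrict_ext)
    fix n :: nat assume "n \<in> {1..}"
    show "(if n = 1 then \<one>\<^bsub>gr_ind_comp p S T R 1\<^esub> else iota_comp p S T R (n - 1) (f (n - 1))) = (if n = 1 then R else f (n - 1))"
    proof (cases "n = 1")
      case True
      then show ?thesis by (simp add: gr_ind_comp_eq Ind_2)
    next
      case False
      then have k: "n - 1 \<ge> 1" using \<open>n \<in> {1..}\<close> by auto
      obtain y where y: "y \<in> RelR (n - 1)" "f (n - 1) = RelR (Suc (n - 1)) #> y" using f k by (auto simp: gr_rel_mem_iff)
      have "iota_comp p S T R (n - 1) (f (n - 1)) = f (n - 1)"
        unfolding y(2) iota_comp_coset[OF k y(1)] using eq[of "Suc (n - 1)"] by simp
      then show ?thesis using False by simp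
    qed
  qed
  \<comment> \<open>The inverse drops the component in degree 1, which is always
    \<open>R\<close>.\<close>
  let ?j = "\<lambda>g. \<lambda>n\<in>{1..}. g (Suc n)"
  show ?thesis
  proof (rule bij_betw_byWitness[where f' = ?j])
    show "\<forall>f\<in>carrier (gr_rel p S T R). ?j (iota p S T R f) = f"
    proof
      fix f assume f: "f \<in> carrier (gr_rel p S T R)"
      have "f \<in> extensional {1..}" using f by (simp add: gr_rel_mem_iff)
      then show "?j (iota p S T R f) = f" unfolding io[OF f] by (auto simp: extensional_def fun_eq_iff)
    qed
    have jm: "?j g \<in> carrier (gr_rel p S T R)" if g: "g \<in> carrier (gr_ind p S T R)" for g
    proof -
      have "finite {n. n \<ge> 1 \<and> g n \<noteq> Ind (Suc n)}" using g by (simp add: gr_ind_mem_iff)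
      moreover have "Suc ` {n. n \<ge> 1 \<and> ?j g n \<noteq> RelR (Suc n)} \<subseteq> {n. n \<ge> 1 \<and> g n \<noteq> Ind (Suc n)}"
        using eq by auto
      ultimately have "finite (Suc ` {n. n \<ge> 1 \<and> ?j g n \<noteq> RelR (Suc n)})" by (rule finite_subset[rotated])
      then have "finite {n. n \<ge> 1 \<and> ?j g n \<noteq> RelR (Suc n)}" by (rule finite_imageD) simp
      moreover have "\<exists>x\<in>RelR n. ?j g n = RelR (Suc n) #> x" if n: "n \<ge> 1" for n
      proof -
        obtain x where "x \<in> Ind (Suc n)" "g (Suc n) = Ind (Suc (Suc n)) #> x" using g by (auto simp: gr_ind_mem_iff)
        then show ?thesis using eq[OF n] eq[of "Suc n"] n by auto
      qed
      ultimately show ?thesis unfolding gr_rel_mem_iff by (auto simp: extensional_def)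
    qed
    show "\<forall>g\<in>carrier (gr_ind p S T R). iota p S T R (?j g) = g"
    proof
      fix g assume g: "g \<in> carrier (gr_ind p S T R)"
      have ge: "g \<in> extensional {1..}" using g by (simp add: gr_ind_mem_iff)
      obtain x where "x \<in> Ind 1" "g 1 = Ind (Suc 1) #> x" using g by (auto simp: gr_ind_mem_iff)
      then have "g 1 = R" using coset_eq_self_iff[OF R_normal R_mem] by (simp add: Ind_1 Ind_2)
      then show "iota p S T R (?j g) = g"
        unfolding io[OF jm[OF g]] using ge by (auto simp: extensional_def fun_eq_iff)
    qed
    show "iota p S T R ` carrier (gr_rel p S T R) \<subseteq> carrier (gr_ind p S T R)"
    proof
      fix g assume "g \<in> iota p S T R ` carrier (gr_rel p S T R)"
      then obtain f where f: "f \<in> carrier (gr_rel p S T R)" "g = (\<lambda>n\<in>{1..}. if n = 1 then R else f (n - 1))"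
        using io by auto
      have g1: "g 1 = Ind (Suc 1)" using f(2) by (simp add: Ind_2)
      have gS: "g (Suc n) = f n" if "n \<ge> 1" for n using f(2) that by simp
      have "\<exists>x\<in>Ind n. g n = Ind (Suc n) #> x" if n: "n \<ge> 1" for n
      proof (cases "n = 1")
        case True
        then show ?thesis using g1 subgroup.one_closed[OF Ind_subgroup, of 1]
          by (intro bexI[of _ \<one>]) (auto simp: coset_one[OF Ind_normal])
      next
        case False
        then obtain k where k: "n = Suc k" "k \<ge> 1" using n by (cases n) auto
        obtain x where "x \<in> RelR k" "f k = RelR (Suc k) #> x" using f(1) k(2) by (auto simp: gr_rel_mem_iff)
        then show ?thesis using eq[OF k(2)] eq[of n] gS[OF k(2)] k n by auto
      qed
      moreover have "{n. n \<ge> 1 \<and> g n \<noteq> Ind (Suc n)} \<subseteq> Suc ` {n. n \<ge> 1 \<and> f n \<noteq> RelR (Suc n)}"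
      proof
        fix n assume n: "n \<in> {n. n \<ge> 1 \<and> g n \<noteq> Ind (Suc n)}"
        then have "n \<noteq> 1" using g1 by auto
        then obtain k where k: "n = Suc k" "k \<ge> 1" using n by (cases n) auto
        then show "n \<in> Suc ` {n. n \<ge> 1 \<and> f n \<noteq> RelR (Suc n)}" using n eq[of n] gS[OF k(2)] by auto
      qed
      then have "finite {n. n \<ge> 1 \<and> g n \<noteq> Ind (Suc n)}"
        by (rule finite_subset) (use f(1) in \<open>simp add: gr_rel_mem_iff\<close>)
      moreover have "g \<in> extensional {1..}" using f(2) by simp
      ultimately show "g \<in> carrier (gr_ind p S T R)" by (simp add: gr_ind_mem_iff)
    qed
    show "?j ` carrier (gr_ind p S T R) \<subseteq> carrier (gr_rel p S T R)" using jm by blast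
  qed
qed

lemma iota_bij_iff:
  "bij_betw (iota p S T R) (carrier (gr_rel p S T R)) (carrier (gr_ind p S T R)) \<longleftrightarrow>
    (\<forall>n\<ge>1. Ind (Suc n) = RelR n)"
proof
  assume "bij_betw (iota p S T R) (carrier (gr_rel p S T R)) (carrier (gr_ind p S T R))"
  then have "iota p S T R ` carrier (gr_rel p S T R) = carrier (gr_ind p S T R)" by (simp add: bij_betw_def)
  then show "\<forall>n\<ge>1. Ind (Suc n) = RelR n"
    using Ser_Int_eq_Rel[OF R_normal R_closed R_Ser iota_surj_imp] by (simp add: Ind_def)
qed (use iota_bij in blast)

text \<open>Supports are preserved in both directions, because an element of \<open>Ind n\<close>
  lies in \<open>Ser (Suc n)\<close> exactly when it lies in \<open>Ind (Suc n)\<close>.\<close>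

lemma gr_ind_incl_image: "gr_ind_incl p S T ` carrier (gr_ind p S T R) = graded_part Ind"
proof (intro equalityI subsetI)
  have incl: "gr_ind_incl p S T f n = Ser (Suc n) #> x"
    if "n \<ge> 1" "x \<in> Ind n" "f n = Ind (Suc n) #> x" for f n x
    using that UN_coset_mono[of "Ind (Suc n)" "Ser (Suc n)" x, OF _ Ind_normal Ser_normal] Ind_mem[of x n]
    by (auto simp: gr_ind_incl_def Ind_def)
  {
    fix j assume "j \<in> gr_ind_incl p S T ` carrier (gr_ind p S T R)"
    then obtain f where f: "f \<in> carrier (gr_ind p S T R)" "j = gr_ind_incl p S T f" by blast
    have val: "\<exists>x\<in>Ind n. f n = Ind (Suc n) #> x \<and> j n = Ser (Suc n) #> x" if n: "n \<ge> 1" for n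
    proof -
      obtain x where x: "x \<in> Ind n" "f n = Ind (Suc n) #> x" using f(1) n by (auto simp: gr_ind_mem_iff)
      then show ?thesis using incl[OF n x(1), of f] f(2) by blast
    qed
    have "{n. n \<ge> 1 \<and> j n \<noteq> Ser (Suc n)} \<subseteq> {n. n \<ge> 1 \<and> f n \<noteq> Ind (Suc n)}"
    proof
      fix n assume n: "n \<in> {n. n \<ge> 1 \<and> j n \<noteq> Ser (Suc n)}"
      then obtain x where x: "x \<in> Ind n" "f n = Ind (Suc n) #> x" "j n = Ser (Suc n) #> x" using val by blast
      have "f n \<noteq> Ind (Suc n)"
      proof
        assume "f n = Ind (Suc n)"
        then have "x \<in> Ind (Suc n)" using x coset_eq_self_iff[OF Ind_normal Ind_mem[OF x(1)]] by auto
        then have "j n = Ser (Suc n)" using x coset_eq_self_iff[OF Ser_normal Ind_mem[OF x(1)]] by (auto simp: Ind_def)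
        then show False using n by simp
      qed
      then show "n \<in> {n. n \<ge> 1 \<and> f n \<noteq> Ind (Suc n)}" using n by simp
    qed
    then have "finite {n. n \<ge> 1 \<and> j n \<noteq> Ser (Suc n)}"
      by (rule finite_subset) (use f(1) in \<open>simp add: gr_ind_mem_iff\<close>)
    moreover have "j \<in> extensional {1..}" using f(2) by (simp add: gr_ind_incl_def)
    moreover have "\<exists>x\<in>Ser n. j n = Ser (Suc n) #> x" "\<exists>x\<in>Ind n. j n = Ser (Suc n) #> x" if "n \<ge> 1" for n
      using val[OF that] by (auto simp: Ind_def)
    ultimately show "j \<in> graded_part Ind" unfolding graded_part_def gr_mem_iff by blast
  next
    fix j assume j: "j \<in> graded_part Ind"
    then have "\<forall>n. \<exists>x. n \<ge> 1 \<longrightarrow> x \<in> Ind n \<and> j n = Ser (Suc n) #> x" by (auto simp: graded_part_def)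
    then obtain a where a: "\<And>n. n \<ge> 1 \<Longrightarrow> a n \<in> Ind n" "\<And>n. n \<ge> 1 \<Longrightarrow> j n = Ser (Suc n) #> a n"
      by metis
    let ?f = "\<lambda>n\<in>{1..}. Ind (Suc n) #> a n"
    have je: "j \<in> extensional {1..}" "finite {n. n \<ge> 1 \<and> j n \<noteq> Ser (Suc n)}"
      using j by (auto simp: graded_part_def gr_mem_iff)
    have "{n. n \<ge> 1 \<and> ?f n \<noteq> Ind (Suc n)} \<subseteq> {n. n \<ge> 1 \<and> j n \<noteq> Ser (Suc n)}"
    proof
      fix n assume "n \<in> {n. n \<ge> 1 \<and> ?f n \<noteq> Ind (Suc n)}"
      then have n: "n \<ge> 1" and "?f n \<noteq> Ind (Suc n)" by blast+
      then have "Ind (Suc n) #> a n \<noteq> Ind (Suc n)" by simp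
      then have "a n \<notin> Ind (Suc n)" using coset_eq_self_iff[OF Ind_normal Ind_mem[OF a(1)[OF n]]] by blast
      then have "a n \<notin> Ser (Suc n)" using a(1)[OF n] by (simp add: Ind_def)
      then have "j n \<noteq> Ser (Suc n)"
        unfolding a(2)[OF n] using coset_eq_self_iff[OF Ser_normal Ind_mem[OF a(1)[OF n]]] by blast
      then show "n \<in> {n. n \<ge> 1 \<and> j n \<noteq> Ser (Suc n)}" using n by simp
    qed
    then have "finite {n. n \<ge> 1 \<and> ?f n \<noteq> Ind (Suc n)}" using je(2) by (rule finite_subset)
    moreover have "\<exists>x\<in>Ind n. ?f n = Ind (Suc n) #> x" if "n \<ge> 1" for n
      using a(1)[OF that] that by (intro bexI[of _ "a n"]) simp_all
    ultimately have "?f \<in> carrier (gr_ind p S T R)" unfolding gr_ind_mem_iff by blast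
    moreover have "gr_ind_incl p S T ?f = j"
    proof
      fix n
      show "gr_ind_incl p S T ?f n = j n"
      proof (cases "n \<ge> 1")
        case True
        then show ?thesis using incl[OF True a(1)[OF True], of ?f] a(2) by simp
      next
        case False
        then show ?thesis using je(1) by (simp add: gr_ind_incl_def extensional_def)
      qed
    qed
    ultimately show "j \<in> gr_ind_incl p S T ` carrier (gr_ind p S T R)" by blast
  }
qed

section \<open>The two ideals of gr(S) attached to \<open>R\<close>\<close>

lemma Ind_ideal: "gr_ideal p S T (graded_part Ind)"
proof (rule graded_part_ideal)
  show "group_commutator S x a \<in> Ind (m + n)" if "m \<ge> 1" "n \<ge> 1" "x \<in> Ser m" "a \<in> Ind n" for m n x a
    using that commutator_Ser commutator_mem_normal(2)[OF R_normal] by (auto simp: Ind_def)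
  show "a [^] p \<in> Ind (Suc n)" if "n \<ge> 1" "a \<in> Ind n" for n a
    using that pow_Ser pow_in_cstep[OF normal_subset[OF R_normal]] cstep_subset[OF R_normal R_closed] by (auto simp: Ind_def)
qed (use Ind_subgroup in \<open>auto simp: Ind_def\<close>)

text \<open>The subgroups of \<open>S\<^sub>n\<close> whose images in \<open>gr\<^sub>n(S)\<close> make up the image of \<open>\<iota>\<close>.\<close>

definition shifted_Rel :: "nat \<Rightarrow> 'a set" where
  "shifted_Rel n = (if n \<le> 1 then {\<one>} else RelR (n - 1))"

text \<open>In degrees at least 2 this is \<open>commutator_Ser_Rel\<close> and
  \<open>pow_Rel\<close> with the index lowered by one; degree 1 carries only the trivial
  element.\<close>

lemma shifted_Rel_ideal: "gr_ideal p S T (graded_part shifted_Rel)"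
proof (rule graded_part_ideal)
  show "subgroup (shifted_Rel n) S" for n
    using RelR_subgroup by (simp add: shifted_Rel_def triv_subgroup)
  show "shifted_Rel n \<subseteq> Ser n" if "n \<ge> 1" for n
    using RelR_Ind[of "n - 1"] subgroup.one_closed[OF Ser_subgroup] by (auto simp: shifted_Rel_def Ind_def)
  show "group_commutator S x a \<in> shifted_Rel (m + n)" if "m \<ge> 1" "n \<ge> 1" "x \<in> Ser m" "a \<in> shifted_Rel n" for m n x a
  proof (cases "n = 1")
    case True
    then have "group_commutator S x a = \<one>" using that by (simp add: shifted_Rel_def group_commutator_def)
    then show ?thesis using subgroup.one_closed[OF RelR_subgroup] by (simp add: shifted_Rel_def)
  next
    case False
    then have "a \<in> RelR (n - 1)" "n - 1 \<ge> 1" using that by (auto simp: shifted_Rel_def)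
    then show ?thesis
      using commutator_Ser_Rel[OF R_normal R_closed that(1) _ that(3), of "n - 1" a] that by (simp add: shifted_Rel_def)
  qed
  show "a [^] p \<in> shifted_Rel (Suc n)" if "n \<ge> 1" "a \<in> shifted_Rel n" for n a
  proof (cases "n = 1")
    case True
    then show ?thesis using that subgroup.one_closed[OF RelR_subgroup, of 1] by (simp add: shifted_Rel_def)
  next
    case False
    then have "a \<in> RelR (n - 1)" "n - 1 \<ge> 1" using that by (auto simp: shifted_Rel_def)
    then show ?thesis
      using pow_Rel[OF R_normal R_closed, of "n - 1" a] that by (simp add: shifted_Rel_def)
  qed
qed

lemma quadratically_defined_imp:
  assumes E: "E \<subseteq> R" and gen: "gr_ideal_generated p S T (initial_form p S T ` E) = graded_part Ind"
    and n: "n \<ge> 1"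
  shows "Ind (Suc n) = RelR n"
proof -
  have "R \<inter> Ser (n + 1) \<subseteq> RelR n <#> (R \<inter> Ser (n + 2))" if n: "n \<ge> 1" for n
  proof
    fix x assume "x \<in> R \<inter> Ser (n + 1)"
    then have x: "x \<in> Ind (Suc n)" "x \<in> Ser (Suc n)" "x \<in> carrier S" "x \<in> R" by (auto simp: Ind_def)
    \<comment> \<open>Initial forms sit in degree 2, where \<open>shifted_Rel\<close> is all of
      \<open>R\<close>.\<close>
    have "initial_form p S T ` E \<subseteq> graded_part shifted_Rel"
    proof
      fix f assume "f \<in> initial_form p S T ` E"
      then obtain r where r: "r \<in> R" "f = gsingle 2 r" using E initial_form_eq by auto
      show "f \<in> graded_part shifted_Rel"
        unfolding r(2) using r(1) R_Ser subgroup.one_closed[OF RelR_subgroup]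
        by (intro gsingle_in_graded_part) (auto simp: shifted_Rel_def)
    qed
    then have "graded_part Ind \<subseteq> graded_part shifted_Rel"
      unfolding gen[symmetric] gr_ideal_generated_def using shifted_Rel_ideal by blast
    moreover have "gsingle (Suc n) x \<in> graded_part Ind"
      using x subgroup.one_closed[OF Ind_subgroup] by (intro gsingle_in_graded_part) auto
    ultimately have "gsingle (Suc n) x \<in> graded_part shifted_Rel" by blast
    then obtain y where y: "y \<in> shifted_Rel (Suc n)" "gsingle (Suc n) x (Suc n) = Ser (Suc (Suc n)) #> y"
      unfolding graded_part_def by force
    have yR: "y \<in> RelR n" using y n by (simp add: shifted_Rel_def)
    have yc: "y \<in> carrier S" "y \<in> R" using yR RelR_Ind[OF n] by (auto simp: Ind_def)
    have "Ser (Suc (Suc n)) #> x = Ser (Suc (Suc n)) #> y" using y(2) by (simp add: single_def)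
    then have "x \<otimes> inv y \<in> Ser (Suc (Suc n))" using coset_eq_iff[OF Ser_normal x(3) yc(1)] by simp
    moreover have "x \<otimes> inv y \<in> R"
      using normal_imp_subgroup[OF R_normal] x(4) yc(2) by (simp add: subgroup.m_closed subgroup.m_inv_closed)
    moreover have "x = (x \<otimes> inv y) \<otimes> y" using yc x by (simp add: m_assoc)
    ultimately have "x \<in> Ind (Suc (Suc n)) <#> RelR n" using yR unfolding set_mult_def Ind_def by blast
    then show "x \<in> RelR n <#> (R \<inter> Ser (n + 2))"
      using commut_normal[OF RelR_subgroup Ind_normal, of n "Suc (Suc n)"] by (simp add: Ind_def)
  qed
  then show ?thesis using Ser_Int_eq_Rel[OF R_normal R_closed R_Ser _ n] by (simp add: Ind_def)
qed

end

section \<open>From equality of the filtrations to quadratic generation\<close>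

context presented_pro_p
begin

lemma closed_normal_generate_R:
  assumes "E \<subseteq> R"
  shows "closed_normal_generate S T E \<subseteq> R"
  using closed_normal_generate_minimal[OF R_normal R_closed assms] .

text \<open>One element of \<open>R\<close> is chosen from each of the finitely many cosets of
  \<open>Ser 3\<close> that meet \<open>R\<close>. Since \<open>R \<inter> Ser 3\<close> is
  \<open>RelR 2\<close>, these elements exhaust \<open>R\<close> modulo \<open>RelR 2\<close>, and
  the Frattini argument applies.\<close>

lemma finite_normal_generating_set:
  assumes fin: "fin_quot 2" and eq: "Ind 3 = RelR 2"
  obtains E where "finite E" "E \<subseteq> R" "closed_normal_generate S T E = R"
proof -
  obtain F where F: "finite F" "F \<subseteq> Ser 2" "Ser 2 = (\<Union>f\<in>F. Ser 3 #> f)"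
    using fin unfolding fin_quot_def by (auto simp: numeral_3_eq_3 numeral_2_eq_2)
  define r where "r f = (SOME x. x \<in> R \<inter> (Ser 3 #> f))" for f
  let ?E = "r ` {f \<in> F. R \<inter> (Ser 3 #> f) \<noteq> {}}"
  have r: "r f \<in> R \<inter> (Ser 3 #> f)" if "R \<inter> (Ser 3 #> f) \<noteq> {}" for f
    unfolding r_def some_in_eq by (rule that)
  have ER: "?E \<subseteq> R" using r by blast
  let ?M = "closed_normal_generate S T ?E"
  have M: "?M \<lhd> S" "closedin T ?M" "?E \<subseteq> ?M"
    using closed_normal_generate_normal[OF order_trans[OF ER normal_subset[OF R_normal]]] by auto
  have "R \<subseteq> ?M <#> RelR 2"
  proof
    fix x assume x: "x \<in> R"
    then obtain f where f: "f \<in> F" "x \<in> Ser 3 #> f" using R_Ser F(3) by blast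
    have ne: "R \<inter> (Ser 3 #> f) \<noteq> {}" using x f by blast
    have rf: "r f \<in> R" "r f \<in> Ser 3 #> f" "r f \<in> ?M" using r[OF ne] M(3) f ne by auto
    have fc: "f \<in> carrier S" using f F(2) by auto
    have "Ser 3 #> x = Ser 3 #> r f"
      using repr_independence[OF f(2) fc Ser_subgroup] repr_independence[OF rf(2) fc Ser_subgroup] by simp
    then have "x \<otimes> inv r f \<in> Ser 3"
      using coset_eq_iff[OF Ser_normal] R_mem x rf(1) by blast
    moreover have "x \<otimes> inv r f \<in> R"
      using normal_imp_subgroup[OF R_normal] x rf(1) by (simp add: subgroup.m_closed subgroup.m_inv_closed)
    ultimately have "x \<otimes> inv r f \<in> RelR 2" using eq by (auto simp: Ind_def)
    moreover have "x = (x \<otimes> inv r f) \<otimes> r f" using R_mem[OF x] R_mem[OF rf(1)] by (simp add: m_assoc)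
    ultimately have "x \<in> RelR 2 <#> ?M" using rf(3) unfolding set_mult_def by blast
    then show "x \<in> ?M <#> RelR 2" using commut_normal[OF RelR_subgroup M(1)] by simp
  qed
  then have "?M = R"
    using normal_generation_mod_Rel[OF R_normal R_closed M(1,2) closed_normal_generate_R[OF ER]] by blast
  moreover have "finite ?E" using F(1) by simp
  ultimately show thesis using that[OF _ ER] by blast
qed

text \<open>A finite generating set of least cardinality is irredundant. An element of it in
  \<open>Ser 3\<close> would lie in \<open>RelR 2\<close>, so the others would generate
  \<open>R\<close> modulo \<open>RelR 2\<close> and hence \<open>R\<close>.\<close>

lemma quadratic_generating_set:
  assumes fin: "fin_quot 2" and eq: "Ind 3 = RelR 2"
  obtains E where "minimal_normal_generating_set S T R E" "\<And>r. r \<in> E \<Longrightarrow> r \<notin> Ser 3"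
proof -
  let ?P = "\<lambda>E. finite E \<and> E \<subseteq> R \<and> closed_normal_generate S T E = R"
  obtain E0 where "finite E0" "E0 \<subseteq> R" "closed_normal_generate S T E0 = R"
    using finite_normal_generating_set[OF assms] .
  then have "?P E0" by simp
  from ex_has_least_nat[of ?P, OF this, of card]
  obtain E where E: "?P E" "\<forall>E'. ?P E' \<longrightarrow> card E \<le> card E'" by (elim exE conjE) (rule that, simp_all)
  have min: "closed_normal_generate S T E' \<noteq> R" if "E' \<subset> E" for E'
  proof
    assume "closed_normal_generate S T E' = R"
    moreover have "finite E'" "E' \<subseteq> R" using E(1) that finite_subset[of E' E] by auto
    ultimately have "card E \<le> card E'" using E(2) by blast
    moreover have "card E' < card E" using E(1) that by (intro psubset_card_mono) auto
    ultimately show False by simp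
  qed
  then have "minimal_normal_generating_set S T R E" using E(1) by (auto simp: minimal_normal_generating_set_def)
  moreover have "r \<notin> Ser 3" if r: "r \<in> E" for r
  proof
    assume r3: "r \<in> Ser 3"
    have rR: "r \<in> RelR 2" using r r3 E(1) eq by (auto simp: Ind_def)
    let ?E = "E - {r}"
    have ER: "?E \<subseteq> R" using E(1) by blast
    let ?M = "closed_normal_generate S T ?E"
    have M: "?M \<lhd> S" "closedin T ?M" "?E \<subseteq> ?M"
      using closed_normal_generate_normal[OF order_trans[OF ER normal_subset[OF R_normal]]] by auto
    have P: "?M <#> RelR 2 \<lhd> S" "closedin T (?M <#> RelR 2)" "?M \<subseteq> ?M <#> RelR 2" "RelR 2 \<subseteq> ?M <#> RelR 2"
      using normal_set_mult[OF M(1) RelR_normal] closed_subgroup_mult[OF M(1,2) RelR_subgroup RelR_closed] by auto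
    have "E \<subseteq> ?M <#> RelR 2" using M(3) P(3,4) rR by blast
    then have "closed_normal_generate S T E \<subseteq> ?M <#> RelR 2" using P(1,2) by (intro closed_normal_generate_minimal)
    then have "R \<subseteq> ?M <#> RelR 2" using E(1) by simp
    then have "?M = R"
      using normal_generation_mod_Rel[OF R_normal R_closed M(1,2) closed_normal_generate_R[OF ER]] by blast
    then show False using min[of ?E] r by blast
  qed
  ultimately show thesis using that by blast
qed

text \<open>For an ideal \<open>I\<close> containing the initial forms, the induction shows that
  \<open>RelR k\<close> has its classes of degree \<open>k + 1\<close> in \<open>I\<close>. The
  start uses that \<open>E\<close> generates \<open>R\<close> as a closed normal subgroup, the step
  that \<open>I\<close> is stable under \<open>P\<close> and under brackets with degree 1.\<close>

lemma initial_forms_generate: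
  assumes fin: "\<And>n. n \<ge> 1 \<Longrightarrow> fin_quot n" and eq: "\<And>n. n \<ge> 1 \<Longrightarrow> Ind (Suc n) = RelR n"
    and E: "E \<subseteq> R" "closed_normal_generate S T E = R"
  shows "gr_ideal_generated p S T (initial_form p S T ` E) = graded_part Ind"
proof
  have "initial_form p S T ` E \<subseteq> graded_part Ind"
  proof
    fix f assume "f \<in> initial_form p S T ` E"
    then obtain r where r: "r \<in> R" "f = gsingle 2 r" using E(1) initial_form_eq by auto
    show "f \<in> graded_part Ind"
      unfolding r(2) using r(1) R_Ser subgroup.one_closed[OF Ind_subgroup]
      by (intro gsingle_in_graded_part) (auto simp: Ind_def)
  qed
  then show "gr_ideal_generated p S T (initial_form p S T ` E) \<subseteq> graded_part Ind"
    unfolding gr_ideal_generated_def using Ind_ideal by blast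
  show "graded_part Ind \<subseteq> gr_ideal_generated p S T (initial_form p S T ` E)"
    unfolding gr_ideal_generated_def
  proof (rule Inter_greatest)
    fix I assume "I \<in> {I. gr_ideal p S T I \<and> initial_form p S T ` E \<subseteq> I}"
    then have I: "subgroup I (gr p S T)" "\<And>x y. x \<in> carrier (gr p S T) \<Longrightarrow> y \<in> I \<Longrightarrow> gr_bracket p S T x y \<in> I"
      "\<And>y. y \<in> I \<Longrightarrow> gr_P p S T y \<in> I" "\<And>r. r \<in> E \<Longrightarrow> gsingle 2 r \<in> I"
      unfolding gr_ideal_def using initial_form_eq by auto
    \<comment> \<open>\<open>I\<close> may fail to be graded; \<open>V n\<close> records its
      homogeneous elements of degree \<open>n\<close>. By finiteness of the layer it is closed,
      which the topological generation of the series requires.\<close>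
    define V where "V n = {x \<in> Ser n. gsingle n x \<in> I}" for n
    have gs1: "gsingle n x = \<one>\<^bsub>gr p S T\<^esub>" if "n \<ge> 1" "x \<in> Ser (Suc n)" for n x
    proof -
      have "Ser (Suc n) #> x = Ser (Suc n)" using that coset_eq_self_iff[OF Ser_normal] by simp
      then show ?thesis unfolding gr_def single_def one_sum_group by (intro restrict_ext) (auto simp: gr_comp_one)
    qed
    have VS: "V n \<subseteq> Ser n" for n by (auto simp: V_def)
    have SV: "Ser (Suc n) \<subseteq> V n" if "n \<ge> 1" for n
      using gs1[OF that] subgroup.one_closed[OF I(1)] Ser_antimono[of n "Suc n"] by (auto simp: V_def)
    have Vsub: "subgroup (V n) S" if n: "n \<ge> 1" for n
    proof (rule subgroupI)
      show "V n \<subseteq> carrier S" by (auto simp: V_def)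
      show "V n \<noteq> {}" using SV[OF n] subgroup.one_closed[OF Ser_subgroup] by blast
    next
      fix a assume a: "a \<in> V n"
      then have aS: "a \<in> Ser n" "inv a \<in> Ser n" by (auto simp: V_def subgroup.m_inv_closed[OF Ser_subgroup])
      have "inv\<^bsub>gr p S T\<^esub> (gsingle n a) = gsingle n (inv a)"
      proof -
        have c: "gsingle n a \<in> carrier (sum_group {1..} (gr_comp p S T))"
          using gsingle_in_gr[OF n aS(1)] by (simp only: gr_def)
        have "inv\<^bsub>gr p S T\<^esub> (gsingle n a) = (\<lambda>i\<in>{1..}. inv\<^bsub>gr_comp p S T i\<^esub> (gsingle n a i))"
          unfolding gr_def using c by (intro inv_sum_group gr_comp_group)
        also have "\<dots> = gsingle n (inv a)"
        proof (subst (2) single_def, intro restrict_ext)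
          fix i :: nat assume "i \<in> {1..}"
          then have i: "i \<ge> 1" by simp
          let ?x = "if i = n then a else \<one>"
          have "inv\<^bsub>gr_comp p S T i\<^esub> (gsingle n a i) = Ser (Suc i) #> inv ?x"
            unfolding gsingle_apply[OF i] gr_comp_eq using aS subgroup.one_closed[OF Ser_subgroup]
            by (intro Quo_inv Ser_subgroup Ser_normal Ser_antimono) auto
          then show "inv\<^bsub>gr_comp p S T i\<^esub> (gsingle n a i) = (if i = n then Ser (Suc n) #> inv a else Ser (Suc i))"
            by (auto simp: coset_one Ser_normal)
        qed
        finally show ?thesis .
      qed
      then show "inv a \<in> V n" using subgroup.m_inv_closed[OF I(1), of "gsingle n a"] a aS by (simp add: V_def)
    next
      fix a b assume a: "a \<in> V n" and b: "b \<in> V n"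
      then have S: "a \<in> Ser n" "b \<in> Ser n" "a \<otimes> b \<in> Ser n"
        by (auto simp: V_def subgroup.m_closed[OF Ser_subgroup])
      have "gsingle n a \<otimes>\<^bsub>gr p S T\<^esub> gsingle n b = gsingle n (a \<otimes> b)"
        unfolding gr_def mult_sum_group
      proof (subst (3) single_def, intro restrict_ext)
        fix i :: nat assume "i \<in> {1..}"
        then have i: "i \<ge> 1" by simp
        have "gsingle n a i \<otimes>\<^bsub>gr_comp p S T i\<^esub> gsingle n b i
            = Ser (Suc i) #> ((if i = n then a else \<one>) \<otimes> (if i = n then b else \<one>))"
          unfolding gsingle_apply[OF i] gr_comp_eq using S subgroup.one_closed[OF Ser_subgroup]
          by (intro Quo_mult Ser_subgroup Ser_normal) auto
        then show "gsingle n a i \<otimes>\<^bsub>gr_comp p S T i\<^esub> gsingle n b i = (if i = n then Ser (Suc n) #> (a \<otimes> b) else Ser (Suc i))"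
          by (auto simp: coset_one Ser_normal)
      qed
      then show "a \<otimes> b \<in> V n" using subgroup.m_closed[OF I(1), of "gsingle n a" "gsingle n b"] a b S by (simp add: V_def)
    qed
    have Vcl: "closedin T (V n)" if "n \<ge> 1" for n
      using closedin_between_Ser[OF fin[OF that] Vsub[OF that] SV[OF that] VS] .
    have RV: "RelR k \<subseteq> V (Suc k)" if "k \<ge> 1" for k
      using that
    proof (induction k rule: nat_induct_at_least)
      case base
      \<comment> \<open>Normality holds because conjugation acts trivially on \<open>Ser 2\<close>
        modulo \<open>Ser 3\<close>, and \<open>V 2\<close> contains \<open>Ser 3\<close>.\<close>
      have "V 2 \<lhd> S"
        unfolding normal_inv_iff
      proof (intro conjI ballI)
        show V2: "subgroup (V 2) S" using Vsub by simp
        fix g h assume g: "g \<in> carrier S" and h: "h \<in> V 2"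
        have hS: "h \<in> Ser 2" "h \<in> carrier S" using h by (auto simp: V_def)
        have "group_commutator S g h \<in> Ser (Suc 2)" using commutator_Ser[of 1 2 g h] g hS by (simp add: numeral_3_eq_3)
        then have "group_commutator S g h \<in> V 2" using SV[OF one_le_numeral] by blast
        then show "g \<otimes> h \<otimes> inv g \<in> V 2"
          using subgroup.m_closed[OF V2 _ h] conj_eq_commutator_mult[OF g hS(2)] by simp
      qed
      moreover have "closedin T (V 2)" using Vcl by simp
      moreover have "E \<subseteq> V 2" using E(1) R_Ser I(4) by (auto simp: V_def)
      ultimately have "closed_normal_generate S T E \<subseteq> V 2" by (rule closed_normal_generate_minimal)
      then show ?case using E(2) by (simp add: numeral_2_eq_2)
    next
      case (Suc k)
      show ?case
        unfolding Rel_Suc[OF Suc.hyps]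
      proof (rule cstep_minimal)
        show V: "subgroup (V (Suc (Suc k))) S" using Vsub by simp
        show "closedin T (V (Suc (Suc k)))" using Vcl by simp
        fix x assume "x \<in> RelR k"
        then have x: "x \<in> Ser (Suc k)" "gsingle (Suc k) x \<in> I" using Suc.IH by (auto simp: V_def)
        have "gsingle (Suc (Suc k)) (x [^] p) \<in> I" using I(3)[OF x(2)] gr_P_gsingle[of "Suc k" x] x(1) by simp
        then show "x [^] p \<in> V (Suc (Suc k))" using pow_Ser[of "Suc k" x] x(1) by (simp add: V_def)
        fix y assume y: "y \<in> carrier S"
        have yS: "y \<in> Ser 1" using y by simp
        \<comment> \<open>Every \<open>y\<close> in \<open>S\<close> has a class in degree 1, and
          these brackets account for all commutator generators of the next term.\<close>
        have "gr_bracket p S T (gsingle 1 y) (gsingle (Suc k) x) \<in> I"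
          using I(2)[OF gsingle_in_gr[OF _ yS] x(2)] by blast
        then have "gsingle (1 + Suc k) (group_commutator S y x) \<in> I"
          using gr_bracket_gsingle[OF _ _ yS x(1)] by simp
        then have "group_commutator S y x \<in> V (Suc (Suc k))"
          using commutator_Ser[OF _ _ yS x(1)] by (simp add: V_def)
        then have "inv (group_commutator S y x) \<in> V (Suc (Suc k))" by (rule subgroup.m_inv_closed[OF V])
        then show "group_commutator S x y \<in> V (Suc (Suc k))" using y x(1) by (simp add: inv_commutator)
      qed
    qed
    show "graded_part Ind \<subseteq> I"
    proof
      fix f assume f: "f \<in> graded_part Ind"
      have "f \<in> carrier (sum_group {1..} (gr_comp p S T))" using f by (simp add: graded_part_def gr_def)
      then show "f \<in> I"
      proof (rule subgroup_contains_of_single[where N = "\<lambda>i. Ser (Suc i)", rotated 3])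
        show "subgroup I (sum_group {1..} (gr_comp p S T))" using I(1) by (simp add: gr_def)
        fix n :: nat assume n: "n \<ge> 1"
        obtain x where x: "x \<in> Ind n" "f n = Ser (Suc n) #> x" using f n by (auto simp: graded_part_def)
        have "x \<in> V n"
        proof (cases "n = 1")
          case True
          then show ?thesis using x(1) R_Ser SV[of 1] by (auto simp: Ind_def numeral_2_eq_2)
        next
          case False
          then obtain k where k: "n = Suc k" "k \<ge> 1" using n by (cases n) auto
          then show ?thesis using x(1) eq[OF k(2)] RV[OF k(2)] by auto
        qed
        then show "single (\<lambda>i. Ser (Suc i)) n (f n) \<in> I" unfolding x(2) by (simp add: V_def)
      qed (auto simp: gr_comp_group gr_comp_one)
    qed
  qed
qed

lemma trivial_R:
  assumes "R = {\<one>}" "n \<ge> 1"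
  shows "Ind (Suc n) = RelR n"
proof -
  have "RelR n \<subseteq> {\<one>}" using RelR_antimono[of 1 n] assms by simp
  then have "RelR n = {\<one>}" using subgroup.one_closed[OF RelR_subgroup] by blast
  moreover have "Ind (Suc n) = {\<one>}" unfolding Ind_def using assms(1) subgroup.one_closed[OF Ser_subgroup] by blast
  ultimately show ?thesis by simp
qed

lemma iota_bij_iff_quadratically_defined:
  assumes fin: "\<And>n. n \<ge> 1 \<Longrightarrow> fin_quot n"
  shows "bij_betw (iota p S T R) (carrier (gr_rel p S T R)) (carrier (gr_ind p S T R))
    \<longleftrightarrow> R = {\<one>} \<or> quadratically_defined p S T R"
  unfolding iota_bij_iff
proof
  assume eq: "\<forall>n\<ge>1. Ind (Suc n) = RelR n"
  show "R = {\<one>} \<or> quadratically_defined p S T R"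
  proof (cases "R = {\<one>}")
    case False
    have "Ind 3 = RelR 2" using eq[rule_format, of 2] by simp
    then obtain E where E: "minimal_normal_generating_set S T R E" "\<And>r. r \<in> E \<Longrightarrow> r \<notin> Ser 3"
      using quadratic_generating_set fin[of 2] by auto
    have "gr_ideal_generated p S T (initial_form p S T ` E) = gr_ind_incl p S T ` carrier (gr_ind p S T R)"
      unfolding gr_ind_incl_image using E(1) eq fin
      by (intro initial_forms_generate) (auto simp: minimal_normal_generating_set_def)
    \<comment> \<open>The same \<open>E\<close> witnesses both existential conditions in
      \<open>quadratically_defined\<close>.\<close>
    then show ?thesis using E False by (auto simp: quadratically_defined_def quadratic_def)
  qed simp
next
  assume "R = {\<one>} \<or> quadratically_defined p S T R"
  then show "\<forall>n\<ge>1. Ind (Suc n) = RelR n"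
  proof
    assume "quadratically_defined p S T R"
    then obtain E where "E \<subseteq> R"
      "gr_ideal_generated p S T (initial_form p S T ` E) = gr_ind_incl p S T ` carrier (gr_ind p S T R)"
      by (auto simp: quadratically_defined_def minimal_normal_generating_set_def)
    then show ?thesis using quadratically_defined_imp gr_ind_incl_image by simp
  qed (use trivial_R in blast)
qed

end

theorem theorem4p4:
  fixes p :: nat
    and G :: "'g monoid" and TG :: "'g topology"
    and S :: "'s monoid" and TS :: "'s topology"
    and \<phi> :: "'s \<Rightarrow> 'g" and R :: "'s set"
  assumes "Factorial_Ring.prime p"
    and "pro_p_group p G TG" and "topologically_fin_gen G TG"
    and "free_pro_p_finite_rank p S TS"
    and "minimal_presentation p S TS G TG \<phi> R"
  shows "bij_betw (iota p S TS R) (carrier (gr_rel p S TS R)) (carrier (gr_ind p S TS R))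
    \<longleftrightarrow> R = {\<one>\<^bsub>S\<^esub>} \<or> quadratically_defined p S TS R"
proof -
  obtain B where B: "free_pro_p_on p S TS B" using assms(4) by (auto simp: free_pro_p_finite_rank_def)
  then have S: "pro_p_group p S TS" by (simp add: free_pro_p_on_def)
  then have profS: "profinite_group S TS" by (simp add: pro_p_group_def)
  then have "group S" by (simp add: profinite_group_def topological_group_def)
  have profG: "profinite_group G TG" using assms(2) by (simp add: pro_p_group_def)
  then have G: "group G" "topspace TG = carrier G" "Hausdorff_space TG"
    by (auto simp: profinite_group_def topological_group_def)
  interpret pro_p S TS p
    by (intro pro_p.intro profinite.intro profinite_axioms.intro pro_p_axioms.intro mgroup.intro \<open>group S\<close> profS assms(1) S)
  have \<phi>: "\<phi> \<in> hom S G" "continuous_map TS TG \<phi>" "R = kernel S G \<phi>" "R \<subseteq> Ser 2"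
    using assms(5) by (auto simp: minimal_presentation_def)
  interpret \<phi>: group_hom S G \<phi>
    using \<open>group S\<close> G(1) \<phi>(1) by (simp add: group_hom_def group_hom_axioms_def)
  have "R \<lhd> S" unfolding \<phi>(3) by (rule \<phi>.normal_kernel)
  moreover have "closedin TS R"
  proof -
    have "closedin TG {\<one>\<^bsub>G\<^esub>}" using closedin_Hausdorff_singleton[OF G(3)] G(2) by simp
    then have "closedin TS {x \<in> topspace TS. \<phi> x \<in> {\<one>\<^bsub>G\<^esub>}}" by (rule closedin_continuous_map_preimage[OF \<phi>(2)])
    then show ?thesis unfolding \<phi>(3) kernel_def by simp
  qed
  ultimately interpret presented_pro_p S TS p R
    by (intro presented_pro_p.intro pro_p_axioms presented_pro_p_axioms.intro \<phi>(4))
  show ?thesis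
    using iota_bij_iff_quadratically_defined[OF fin_quot_all[OF fin_quot_1[OF B]]] .
qed

end
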